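(* Let the convection field be of the affine form $a(t,x;y)=\sum_{j=1}^{d_y}y_j\,a_j(t,x)$, $y\in\mathcal Y=[-1,1]^{d_y}$, where $a_j=\omega_ja_j^\circ$ with $\omega_j\ge0$, $\|a_j^\circ\|_{L_\infty([0,T]\times\mathbb R^m)}\le A^\circ$, $\Lambda:=\max_{j\le d_y,\,t\in[0,T]}|a_j^\circ(t,\cdot)|_{\mathrm{Lip}_1(\mathbb R^m)}$, and with $|\underline\omega|_1:=\sum_j\omega_j$, $A:=|\underline\omega|_1A^\circ$, so that $\sup_{(t,x)}\sum_{j=1}^{d_y}|a_j(t,x)|\le A$. Set $L:=A+\Lambda|\underline\omega|_1$. Let $z$ be the field of characteristics. Then for any $\varepsilon>0$ there exists a DNN $\mathcal N_\varepsilon$ such that $$\|z-\mathcal N_\varepsilon\|_{L_\infty(\Omega;\mathbb R^m)}\le\varepsilon,\qquad \#\mathcal N_\varepsilon\lesssim d_y\,m^2\,A\,T\Big(\frac{e^{LT}}{\varepsilon}\Big)^{m+1}\Big|\log_2\frac{e^{LT}}{\varepsilon}\Big|^2 .$$ Moreover, for every $N\in\mathbb N$ there exists a DNN $\mathcal N_N$ with complexity $\#\mathcal N_N\le N$ such that $$\|z-\mathcal N_N\|_{L_\infty(\Omega;\mathbb R^m)}\lesssim e^{LT}\tilde\gamma(N)^{-1},\qquad \tilde\gamma(r)=C\Big(\frac r{d_y}\Big)^{\frac1{m+1}}\Big|\log_2\frac r{d_y}\Big|^{-\frac2{m+1}},\qquad C=(ATm^2)^{-\frac1{m+1}}.$$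 The networks belong to $\mathrm{Lip}_1([0,T];C(\mathbb R^m\times\mathcal Y;\mathbb R^m))$ and are stable in the sense that $|\!|\!|\mathcal N_N|\!|\!|_{N,m}\lesssim e^{\hat LT}$, where $\hat L\le A+T^{-1}+c_3(1+A^\circ)\Lambda|\underline\omega|_1$ whenever the accuracy satisfies $\varepsilon\le1$, with a constant $c_3$ depending only on $m$.
   Context: **Conventions.** $|\cdot|$ on vectors is the max-norm. $\|g\|_\infty$ is the supremum of $|g|$ over the domain of $g$; $|g|_{\mathrm{Lip}_1}:=\sup|g(x)-g(x')|/|x-x'|$; $\|g\|_{\mathrm{Lip}_1}:=\max\{\|g\|_\infty,|g|_{\mathrm{Lip}_1}\}$ (norms taken on the respective domains). $a\lesssim b$ means $a\le Cb$ with $C$ independent of the parameters on which $a,b$ may depend; the dependence on the fixed spatial dimension $m\le3$ is not always tracked. $a\eqsim b$ means $a\lesssim b\lesssim a$. **Compositions.** A compositional representation is an array $\mathbf g=(g^j)_{j=1}^n$ of Lipschitz maps $g^1:D\subset\mathbb R^{d_0}\to\mathbb R^{d_1}$, $g^\ell:\mathbb R^{d_{\ell-1}}\to\mathbb R^{d_\ell}$, with $g^n$ linear, representing $G_{\mathbf g}=g^n\circ\cdots\circ g^1$; $n(\mathbf g)=n$. For scalar $v$, $\mathsf s(v)$ is the number of variables on which $v$ depends explicitly. Put $\mathsf s_\infty(g^j)=0$ if $g^j$ is the identity, $=1$ if $g^j$ is multilinear, and $=\max_i\mathsf s(g^j_i)$ otherwise; $\mathsf s_\infty(\mathbf g)=\max_{j\le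 n-1}\mathsf s_\infty(g^j)$; $\mathfrak N(\mathbf g)=\sum_{j=1}^n\sum_{i=1}^{d_j}\mathsf s(g^j_i)$. $L_{[n,k]}(\mathbf g)$ is the Lipschitz constant of $g^n\circ\cdots\circ g^k$, $L_{[n,n+1]}=1$. Let $\mathcal R(\mathbf g)=\max\{\|g^\ell\|_{\mathrm{Lip}_1},L_{[n(\mathbf g),\ell+1]}(\mathbf g):\ell=1,\dots,n(\mathbf g)\}$ and $|\!|\!|G|\!|\!|_{N,\mathsf s}=\inf\{\mathcal R(\mathbf g):G_{\mathbf g}=G,\ \mathsf s_\infty(\mathbf g)\le\mathsf s,\ \mathfrak N(\mathbf g)\le N\}$. For time-dependent maps this refers to the variables $(x,y)$ for each fixed $t$. **DNNs.** A DNN is a finitely parametrized composition whose factors are of the form $\sigma(A^j\cdot+b^j)$ with the ReLU activation $\sigma(t)=\max\{0,t\}$ acting componentwise, followed by a linear output layer; factors that are at most multilinear are also admitted, and layers may depend on the time variable $t$ in a piecewise affine way. $\#\mathcal N$ is the number of weights (entries of the $A^j,b^j$ and of the output layer; for sparse connectivity $\#\mathcal N\eqsim\mathfrak N(\mathbf g)$). **Setting.** $T>0$ is a fixed time horizon, $m\in\{1,2,3\}$, $\Omega=[0,T)\times\mathbb R^m\times\mathcal Y$. Throughout $a\in C(0,T;\mathrm{Lip}_1(\mathbb R^m\times\mathcal Y))$ is $\mathbb R^m$-valued, and $1\le A\le L$. $z(t,x;y)$ solves $\dot z(t)=a(t,z(t);y)$, $z(0)=x$. The constant $c_3$ is the one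 for which every $g\in\mathrm{Lip}_1((0,1)^m)$ can be approximated to any accuracy $\delta$ in $L_\infty$ by ReLU networks $\mathcal N_\delta$ with $\|\mathcal N_\delta\|_{\mathrm{Lip}_1}\le c_3(1+\|g\|_\infty)\|g\|_{\mathrm{Lip}_1}$ and $\#\mathcal N_\delta\lesssim\|g\|_{\mathrm{Lip}_1}^m\delta^{-m}\log_2\frac1\delta$.
   Formalization: Ω is cut to x in a cube [-R,R]^m (or the field vanishes off it), constants depend on m and R, the triple-bar norm is taken on that cube, the bound on #N is max{1,·}, the log in γ̃ is replaced by max{1,|log|}, and N ≥ m is required, since the literal claim fails otherwise. *)

theory Defs
  imports "HOL-Library.Extended_Nonnegative_Real" "Jordan_Normal_Form.Matrix"
begin

text \<open>Vectors of \<open>\<real>\<^sup>d\<close> are elements of \<open>carrier_vec d\<close>, because the parametric dimension and the widths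
  of the layers vary inside the statement.  A point \<open>(x,y)\<close> of \<open>\<real>\<^sup>m \<times> \<Y>\<close> is the concatenation
  \<open>x @\<^sub>v y\<close>.  Norms take values in \<open>ennreal\<close>, so that an unbounded function has norm \<open>\<infinity>\<close>.\<close>

section \<open>Norms\<close>

definition max_norm :: "real vec \<Rightarrow> real" where
  "max_norm v = Max (insert 0 ((\<lambda>i. \<bar>v $ i\<bar>) ` {..<dim_vec v}))"

definition linf_norm :: "'a set \<Rightarrow> ('a \<Rightarrow> real vec) \<Rightarrow> ennreal" where
  "linf_norm D g = (SUP x\<in>D. ennreal (max_norm (g x)))"

definition lip_seminorm :: "real vec set \<Rightarrow> (real vec \<Rightarrow> real vec) \<Rightarrow> ennreal" where
  "lip_seminorm D g =
     (SUP (x, x') \<in> {(x, x'). x \<in> D \<and> x' \<in> D \<and> x \<noteq> x'}.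
        ennreal (max_norm (g x - g x') / max_norm (x - x')))"

definition lip_norm :: "real vec set \<Rightarrow> (real vec \<Rightarrow> real vec) \<Rightarrow> ennreal" where
  "lip_norm D g = max (linf_norm D g) (lip_seminorm D g)"

definition cube :: "nat \<Rightarrow> real \<Rightarrow> real vec set" where
  "cube d R = {x \<in> carrier_vec d. max_norm x \<le> R}"

definition join_sets :: "real vec set \<Rightarrow> real vec set \<Rightarrow> real vec set" where
  "join_sets X Y = {x @\<^sub>v y | x y. x \<in> X \<and> y \<in> Y}"

text \<open>\<open>C([0,T]; Lip\<^sub>1(D))\<close>\<close>
definition continuous_into_Lip1 :: "real \<Rightarrow> real vec set \<Rightarrow> (real \<Rightarrow> real vec \<Rightarrow> real vec) \<Rightarrow> bool" where
  "continuous_into_Lip1 T D a \<longleftrightarrow>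
     (\<forall>t\<in>{0..T}. lip_norm D (a t) < \<infinity> \<and>
        ((\<lambda>s. lip_norm D (\<lambda>w. a s w - a t w)) \<longlongrightarrow> 0) (at t within {0..T}))"

definition max_norm_continuous_on :: "real vec set \<Rightarrow> (real vec \<Rightarrow> real vec) \<Rightarrow> bool" where
  "max_norm_continuous_on D g \<longleftrightarrow>
     (\<forall>w\<in>D. \<forall>e>0. \<exists>d>0. \<forall>w'\<in>D. max_norm (w' - w) < d \<longrightarrow> max_norm (g w' - g w) < e)"

text \<open>\<open>Lip\<^sub>1([0,T]; C(D))\<close>.  Only the increments in time are measured in the supremum norm: for
  unbounded \<open>D\<close> the maps themselves, being close to \<open>(x,y) \<mapsto> x\<close>, are unbounded.\<close>
definition Lip1_in_time :: "real \<Rightarrow> real vec set \<Rightarrow> (real \<Rightarrow> real vec \<Rightarrow> real vec) \<Rightarrow> bool" where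
  "Lip1_in_time T D F \<longleftrightarrow>
     (\<forall>t\<in>{0..T}. max_norm_continuous_on D (F t)) \<and>
     (\<exists>M. \<forall>s\<in>{0..T}. \<forall>t\<in>{0..T}. linf_norm D (\<lambda>w. F s w - F t w) \<le> ennreal (M * \<bar>s - t\<bar>))"

section \<open>Compositional representations\<close>

text \<open>A representation is a list \<open>gs = [g\<^sup>1, \<dots>, g\<^sup>n]\<close> with a list \<open>ds = [d\<^sub>0, \<dots>, d\<^sub>n]\<close> of dimensions;
  lists count from 0, so \<open>gs ! k\<close> is the factor number \<open>k + 1\<close>.\<close>

definition compose :: "(real vec \<Rightarrow> real vec) list \<Rightarrow> real vec \<Rightarrow> real vec" where
  "compose gs v = fold (\<lambda>g. g) gs v"

text \<open>The set on which a factor is declared: \<open>D\<close> for the first one, all of \<open>\<real>\<^sup>d\<close> for the others.\<close>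
definition factor_dom :: "real vec set \<Rightarrow> nat list \<Rightarrow> nat \<Rightarrow> real vec set" where
  "factor_dom D ds k = (if k = 0 then D else carrier_vec (ds ! k))"

text \<open>The set on which a factor is actually evaluated.  Norms and Lipschitz constants of factors are
  taken there: on all of \<open>\<real>\<^sup>d\<close> a nonzero linear map is unbounded and a bilinear map is not
  Lipschitz, so every representation would have \<open>\<R>(\<g>) = \<infinity>\<close>.\<close>
definition reach :: "real vec set \<Rightarrow> (real vec \<Rightarrow> real vec) list \<Rightarrow> nat \<Rightarrow> real vec set" where
  "reach D gs k = compose (take k gs) ` D"

definition comp_rep ::
  "real vec set \<Rightarrow> nat \<Rightarrow> nat \<Rightarrow> nat list \<Rightarrow> (real vec \<Rightarrow> real vec) list \<Rightarrow> bool" where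
  "comp_rep D d_in d_out ds gs \<longleftrightarrow>
     gs \<noteq> [] \<and> length ds = length gs + 1 \<and> hd ds = d_in \<and> last ds = d_out \<and>
     D \<subseteq> carrier_vec d_in \<and>
     (\<forall>k<length gs. \<forall>v\<in>factor_dom D ds k. (gs ! k) v \<in> carrier_vec (ds ! (k + 1))) \<and>
     (\<forall>k<length gs. lip_seminorm (reach D gs k) (gs ! k) < \<infinity>) \<and>
     (\<exists>M \<in> carrier_mat d_out (ds ! (length gs - 1)).
        \<forall>v\<in>factor_dom D ds (length gs - 1). last gs v = M *\<^sub>v v)"

text \<open>\<open>\<s>(v)\<close>: the number of variables on which the scalar function \<open>v\<close> on \<open>X \<subseteq> \<real>\<^sup>d\<close> depends.\<close>
definition num_vars :: "real vec set \<Rightarrow> nat \<Rightarrow> (real vec \<Rightarrow> real) \<Rightarrow> nat" where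
  "num_vars X d v =
     card {i. i < d \<and> (\<exists>u\<in>X. \<exists>u'\<in>X. (\<forall>j<d. j \<noteq> i \<longrightarrow> u $ j = u' $ j) \<and> v u \<noteq> v u')}"

text \<open>Multilinear means: every component is a polynomial of degree at most one in each variable.\<close>
definition multilinear_on :: "real vec set \<Rightarrow> nat \<Rightarrow> nat \<Rightarrow> (real vec \<Rightarrow> real vec) \<Rightarrow> bool" where
  "multilinear_on X d d' g \<longleftrightarrow>
     (\<forall>i<d'. \<exists>c :: nat set \<Rightarrow> real. \<forall>v\<in>X. g v $ i = (\<Sum>S\<in>Pow {..<d}. c S * (\<Prod>k\<in>S. v $ k)))"

definition s_inf_factor :: "real vec set \<Rightarrow> nat \<Rightarrow> nat \<Rightarrow> (real vec \<Rightarrow> real vec) \<Rightarrow> nat" where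
  "s_inf_factor X d d' g =
     (if \<forall>v\<in>X. g v = v then 0
      else if multilinear_on X d d' g then 1
      else Max (insert 0 ((\<lambda>i. num_vars X d (\<lambda>v. g v $ i)) ` {..<d'})))"

definition s_inf :: "real vec set \<Rightarrow> nat list \<Rightarrow> (real vec \<Rightarrow> real vec) list \<Rightarrow> nat" where
  "s_inf D ds gs =
     Max (insert 0 ((\<lambda>k. s_inf_factor (factor_dom D ds k) (ds ! k) (ds ! (k + 1)) (gs ! k))
                    ` {..<length gs - 1}))"

definition comp_complexity :: "real vec set \<Rightarrow> nat list \<Rightarrow> (real vec \<Rightarrow> real vec) list \<Rightarrow> nat" where
  "comp_complexity D ds gs =
     (\<Sum>k<length gs. \<Sum>i<ds ! (k + 1). num_vars (factor_dom D ds k) (ds ! k) (\<lambda>v. (gs ! k) v $ i))"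

text \<open>\<open>L\<^bsub>[n,k+1]\<^esub>(\<g>)\<close> for \<open>k \<le> n\<close>: the Lipschitz constant of the composition of the factors after the
  first \<open>k\<close> ones.\<close>
definition tail_lip :: "real vec set \<Rightarrow> (real vec \<Rightarrow> real vec) list \<Rightarrow> nat \<Rightarrow> ennreal" where
  "tail_lip D gs k =
     (if k = length gs then 1 else lip_seminorm (reach D gs k) (compose (drop k gs)))"

definition rep_stability :: "real vec set \<Rightarrow> (real vec \<Rightarrow> real vec) list \<Rightarrow> ennreal" where
  "rep_stability D gs =
     (SUP k\<in>{..<length gs}. max (lip_norm (reach D gs k) (gs ! k)) (tail_lip D gs (k + 1)))"

text \<open>The triple-bar quantity of \<open>G\<close>, equal to \<open>\<infinity>\<close> if there is no admissible representation.\<close>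
definition comp_norm ::
  "real vec set \<Rightarrow> nat \<Rightarrow> nat \<Rightarrow> nat \<Rightarrow> nat \<Rightarrow> (real vec \<Rightarrow> real vec) \<Rightarrow> ennreal" where
  "comp_norm D d_in d_out N s G =
     Inf {rep_stability D gs | ds gs.
            comp_rep D d_in d_out ds gs \<and> (\<forall>v\<in>D. compose gs v = G v) \<and>
            s_inf D ds gs \<le> s \<and> comp_complexity D ds gs \<le> N}"

section \<open>Deep neural networks\<close>

text \<open>\<open>TW c d [(g\<^sub>1,s\<^sub>1),\<dots>]\<close> is the continuous piecewise affine weight
  \<open>t \<mapsto> c + d t + \<Sum>\<^sub>i g\<^sub>i max{0, t - s\<^sub>i}\<close>.  It counts once for each of its affine pieces, hence
  once if it does not depend on time; \<open>TW 0 0 []\<close> stands for an absent connection.\<close>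
datatype time_weight = TW real real "(real \<times> real) list"

fun tw_val :: "real \<Rightarrow> time_weight \<Rightarrow> real" where
  "tw_val t (TW c d hs) = c + d * t + (\<Sum>(g, s)\<leftarrow>hs. g * max 0 (t - s))"

fun tw_cost :: "time_weight \<Rightarrow> nat" where
  "tw_cost (TW c d hs) = (if c = 0 \<and> d = 0 \<and> hs = [] then 0 else 1 + length hs)"

text \<open>\<open>Multilin ps\<close> lists for each component its monomials \<open>w \<Prod>\<^bsub>k \<in> S\<^esub> v\<^sub>k\<close> as pairs \<open>(w, S)\<close>;
  \<open>S\<close> being a set, each variable has degree at most one.\<close>
datatype layer =
  ReLU "time_weight mat" "time_weight vec"
| Multilin "(time_weight \<times> nat set) list list"

fun layer_type :: "nat \<Rightarrow> nat \<Rightarrow> layer \<Rightarrow> bool" where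
  "layer_type d d' (ReLU W b) \<longleftrightarrow> W \<in> carrier_mat d' d \<and> b \<in> carrier_vec d'"
| "layer_type d d' (Multilin ps) \<longleftrightarrow>
     length ps = d' \<and> (\<forall>p\<in>set ps. \<forall>(w, S)\<in>set p. S \<subseteq> {..<d})"

fun layer_eval :: "real \<Rightarrow> layer \<Rightarrow> real vec \<Rightarrow> real vec" where
  "layer_eval t (ReLU W b) v =
     map_vec (max 0) (map_mat (tw_val t) W *\<^sub>v v + map_vec (tw_val t) b)"
| "layer_eval t (Multilin ps) v =
     vec_of_list (map (\<lambda>p. \<Sum>(w, S)\<leftarrow>p. tw_val t w * (\<Prod>k\<in>S. v $ k)) ps)"

definition mat_cost :: "time_weight mat \<Rightarrow> nat" where
  "mat_cost W = (\<Sum>i<dim_row W. \<Sum>j<dim_col W. tw_cost (W $$ (i, j)))"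

text \<open>For a monomial, the variables entering the product are counted in addition to its weight, so
  that products of many variables are not free.\<close>
fun layer_cost :: "layer \<Rightarrow> nat" where
  "layer_cost (ReLU W b) = mat_cost W + (\<Sum>i<dim_vec b. tw_cost (b $ i))"
| "layer_cost (Multilin ps) =
     (\<Sum>p\<leftarrow>ps. \<Sum>(w, S)\<leftarrow>p. if tw_cost w = 0 then 0 else tw_cost w + card S)"

text \<open>Hidden layers in the order of application, and the matrix of the linear output layer.\<close>
datatype dnn = DNN (hidden: "layer list") (output_layer: "time_weight mat")

definition dnn_type :: "nat \<Rightarrow> nat \<Rightarrow> dnn \<Rightarrow> bool" where
  "dnn_type d_in d_out \<N> \<longleftrightarrow>
     (\<exists>ds. length ds = length (hidden \<N>) + 1 \<and> hd ds = d_in \<and>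
        (\<forall>k<length (hidden \<N>). layer_type (ds ! k) (ds ! (k + 1)) (hidden \<N> ! k)) \<and>
        output_layer \<N> \<in> carrier_mat d_out (last ds))"

definition dnn_eval :: "dnn \<Rightarrow> real \<Rightarrow> real vec \<Rightarrow> real vec" where
  "dnn_eval \<N> t v = map_mat (tw_val t) (output_layer \<N>) *\<^sub>v fold (layer_eval t) (hidden \<N>) v"

definition num_weights :: "dnn \<Rightarrow> nat" where
  "num_weights \<N> = (\<Sum>l\<leftarrow>hidden \<N>. layer_cost l) + mat_cost (output_layer \<N>)"

section \<open>Transport with affine parametric convection\<close>

text \<open>\<open>a(t,x;y) = \<Sum>\<^sub>j y\<^sub>j a\<^sub>j(t,x)\<close> as a function of \<open>t\<close> and \<open>x @\<^sub>v y\<close>\<close>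
definition affine_field ::
  "nat \<Rightarrow> nat \<Rightarrow> (nat \<Rightarrow> real \<Rightarrow> real vec \<Rightarrow> real vec) \<Rightarrow> real \<Rightarrow> real vec \<Rightarrow> real vec" where
  "affine_field m dy aj t w = vec m (\<lambda>i. \<Sum>j<dy. vec_last w dy $ j * aj j t (vec_first w m) $ i)"

text \<open>Within \<open>[0,T)\<close> the derivative is one-sided at \<open>t = 0\<close>.\<close>
definition characteristics ::
  "nat \<Rightarrow> real \<Rightarrow> real vec set \<Rightarrow> (real \<Rightarrow> real vec \<Rightarrow> real vec) \<Rightarrow>
   (real \<Rightarrow> real vec \<Rightarrow> real vec \<Rightarrow> real vec) \<Rightarrow> bool" where
  "characteristics m T Y a z \<longleftrightarrow>
     (\<forall>x\<in>carrier_vec m. \<forall>y\<in>Y. z 0 x y = x \<and>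
        (\<forall>t\<in>{0..<T}. z t x y \<in> carrier_vec m \<and>
           (\<forall>i<m. ((\<lambda>s. z s x y $ i) has_real_derivative a t (z t x y @\<^sub>v y) $ i)
                    (at t within {0..<T}))))"

text \<open>The rate \<open>\<gamma>~(r)\<close>.  The logarithm is cut off below at 1: near \<open>r = d\<^sub>y\<close> it vanishes and
  \<open>1/\<gamma>~(d\<^sub>y) = 0\<close> would demand an exact representation by \<open>d\<^sub>y\<close> weights.\<close>
definition gamma_rate :: "nat \<Rightarrow> real \<Rightarrow> real \<Rightarrow> nat \<Rightarrow> real \<Rightarrow> real" where
  "gamma_rate m A T dy r =
     (A * T * real m ^ 2) powr (- 1 / (real m + 1)) * (r / real dy) powr (1 / (real m + 1)) *
     (max 1 \<bar>log 2 (r / real dy)\<bar>) powr (- 2 / (real m + 1))"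

end

theory Submission
  imports "HOL-Analysis.Henstock_Kurzweil_Integration" Defs
begin

text \<open>The network imitates a forward Euler scheme for the characteristics, and its error is that of the
  scheme, which is arranged so that neither the number \<open>d\<^sub>y\<close> of parameters nor a modulus of continuity in time
  enters the error.

  With \<open>p\<^sub>j = \<omega>\<^sub>j / |\<omega>|\<^sub>1\<close> and \<open>b\<^sub>j = |\<omega>|\<^sub>1 a\<^sub>j\<^sup>o\<close> the field is a convex combination of the \<open>y\<^sub>j b\<^sub>j\<close>,
  each of which is bounded by \<open>A\<close> and has the Lipschitz constant \<open>l = \<Lambda> |\<omega>|\<^sub>1\<close>.  A step of length \<open>h\<close> adds
  \<open>\<Sum>\<^sub>j p\<^sub>j y\<^sub>j v\<^sub>j(x)\<close> to the position, where \<open>v\<^sub>j\<close> interpolates, on a grid of width \<open>H\<close>, the time integrals of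
  \<open>b\<^sub>j\<close> over the step.  The use of integrals replaces regularity in time: the mean value theorem, applied
  to the characteristic minus the primitive of the field frozen at a node, bounds the error of one step
  by \<open>l h (A h + e + H)\<close>, if \<open>e\<close> is the error so far (\<open>one_step\<close>).  The errors add up to at most
  \<open>exp (l T) (2 A h + H)\<close> (\<open>scheme_error\<close>), so about \<open>A T exp (l T) / \<epsilon>\<close> steps and a grid width of about
  \<open>\<epsilon> exp (- l T)\<close> suffice.

  The grid covers the cube of radius \<open>R + A T\<close>, and the hats clip their argument to this cube.
  Either the characteristics stay inside, or the field vanishes outside the smaller cube of radius \<open>R\<close>;
  in both cases clipping does not change the field along a characteristic (\<open>a_clip\<close>).

  A hat is a linear combination of ReLU neurons, and a multilinear layer multiplies the hats of
  all coordinates with the parameter \<open>y\<^sub>j\<close>, so three layers perform a step exactly (\<open>three_layers\<close>).  The weights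
  of the last of them are proportional to the elapsed fraction of the step, a continuous piecewise affine
  function of time.  A step costs about \<open>d\<^sub>y\<close> times the number of nodes, and the product with the number
  of steps is of the order \<open>d\<^sub>y A T (exp (L T) / \<epsilon>)\<^bsup>m+1\<^esup>\<close>; the factor \<open>exp (A T)\<close> contained in \<open>exp (L T)\<close>
  pays for the growth of the cube.  If \<open>\<epsilon> \<ge> A T\<close>, the map \<open>(x, y) \<mapsto> x\<close> is accurate enough, and if \<open>\<epsilon> < A T\<close>,
  the logarithm in the asserted bound is at least 1 (\<open>log_factor_ge_1\<close>).  The second assertion follows by solving
  the equation between the number of weights and \<open>N\<close> for \<open>\<epsilon>\<close> (\<open>rate_bound\<close>).

  At a fixed time a step is the composition of \<open>(x, y) \<mapsto> (x, y, v(x))\<close>, whose components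
  depend on at most \<open>m\<close> variables, with a bilinear map.  The multilinear interpolant of \<open>v\<close> has the
  Lipschitz constant \<open>m l h\<close> in the maximum norm, because on each coordinate line it is as Lipschitz as the
  data (\<open>interp_lipschitz\<close>).  Hence positions are amplified by at most \<open>exp (m l T)\<close>, and the parameters enter with
  total weight \<open>A T\<close> (\<open>tail_even\<close>), which gives the exponent with \<open>c\<^sub>3 = m\<close>.\<close>

unbundle no vec_syntax

section \<open>Interpolation by products of hats\<close>

text \<open>A ramp is a difference of two ReLU neurons; it climbs from 0 to 1 over the cell \<open>[i, i + 1]\<close> of the
  unit grid.  A hat is a difference of neighbouring ramps, with the missing ramp at either end of
  \<open>{0..n}\<close> replaced by a constant, so that the hats extend constantly beyond the grid: interpolation
  implicitly clips its argument to \<open>[0, n]\<close>.\<close>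
definition ramp :: "nat \<Rightarrow> real \<Rightarrow> real" where
  "ramp i u = max 0 (u - real i) - max 0 (u - real (Suc i))"

definition clip :: "real \<Rightarrow> real \<Rightarrow> real \<Rightarrow> real" where
  "clip a b u = max a (min b u)"

lemma ramp_eq: "ramp i u = clip 0 1 (u - real i)"
  by (auto simp: ramp_def clip_def max_def min_def)

lemma ramp_mono: "u \<le> u' \<Longrightarrow> ramp i u \<le> ramp i u'"
  by (auto simp: ramp_eq clip_def)

lemma sum_ramp: "(\<Sum>i<n. ramp i u) = clip 0 (real n) u"
proof -
  have "(\<Sum>i<n. ramp i u) = max 0 u - max 0 (u - real n)"
    by (induction n) (auto simp: ramp_def)
  then show ?thesis by (auto simp: clip_def max_def min_def)
qed

definition hat :: "nat \<Rightarrow> nat \<Rightarrow> real \<Rightarrow> real" where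
  "hat n i u = (if i = 0 then 1 else ramp (i - 1) u) - (if i < n then ramp i u else 0)"

lemma hat_nonneg: "i \<le> n \<Longrightarrow> 0 \<le> hat n i u"
  by (cases i) (auto simp: hat_def ramp_eq clip_def max_def min_def)

lemma hat_support:
  assumes "i \<le> n" "hat n i u \<noteq> 0"
  shows "\<bar>clip 0 (real n) u - real i\<bar> \<le> 1"
proof (cases i)
  case 0
  then show ?thesis using assms
    by (cases "n = 0") (auto simp: hat_def ramp_eq clip_def max_def min_def split: if_splits)
next
  case (Suc k)
  then show ?thesis using assms
    by (auto simp: hat_def ramp_eq clip_def max_def min_def split: if_splits)
qed

text \<open>Abel summation: the interpolant moves by the increments of the data weighted with ramps.  All ramps
  increase and their sum is the clipped argument, which is what makes interpolation as Lipschitz as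
  the data.\<close>
lemma sum_hat: "(\<Sum>i\<le>n. hat n i u * F i) = F 0 + (\<Sum>i<n. ramp i u * (F (Suc i) - F i))"
proof -
  have 1: "(\<Sum>i\<le>n. (if i = 0 then 1 else ramp (i - 1) u) * F i) = F 0 + (\<Sum>i<n. ramp i u * F (Suc i))"
    by (simp add: sum.atMost_shift)
  have 2: "(\<Sum>i\<le>n. (if i < n then ramp i u else 0) * F i) = (\<Sum>i<n. ramp i u * F i)"
    by (simp add: lessThan_Suc_atMost [symmetric])
  show ?thesis
    using 1 2 by (simp add: hat_def left_diff_distrib right_diff_distrib sum_subtractf)
qed

lemma sum_hat_eq_1: "(\<Sum>i\<le>n. hat n i u) = 1"
  using sum_hat [of n u "\<lambda>_. 1"] by simp

text \<open>Tensor product interpolation of data given at the multi-indices \<open>{0..n}\<^sup>m\<close>, peeling off one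
  coordinate at a time.\<close>
fun interp :: "nat \<Rightarrow> real list \<Rightarrow> (nat list \<Rightarrow> real) \<Rightarrow> real" where
  "interp n [] F = F []"
| "interp n (u # us) F = (\<Sum>i\<le>n. hat n i u * interp n us (\<lambda>\<iota>. F (i # \<iota>)))"

text \<open>The multi-indices in the order in which the recursion of \<open>interp\<close> visits them.\<close>
definition cells :: "nat \<Rightarrow> nat \<Rightarrow> nat list list" where
  "cells n m = product_lists (replicate m [0..<Suc n])"

lemma interp_sum:
  "interp n us (\<lambda>\<iota>. \<Sum>j\<in>J. c j * F j \<iota>) = (\<Sum>j\<in>J. c j * interp n us (F j))"
proof (induction us arbitrary: F)
  case (Cons u us)
  have "interp n (u # us) (\<lambda>\<iota>. \<Sum>j\<in>J. c j * F j \<iota>)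
      = (\<Sum>i\<le>n. \<Sum>j\<in>J. hat n i u * (c j * interp n us (\<lambda>\<iota>. F j (i # \<iota>))))"
    using Cons.IH by (simp add: sum_distrib_left)
  also have "\<dots> = (\<Sum>j\<in>J. c j * interp n (u # us) (F j))"
    by (subst sum.swap) (simp add: sum_distrib_left mult_ac)
  finally show ?case .
qed simp

lemma interp_diff: "interp n us (\<lambda>\<iota>. F \<iota> - G \<iota>) = interp n us F - interp n us G"
  by (induction us arbitrary: F G) (simp_all add: right_diff_distrib sum_subtractf)

text \<open>The hats are a partition of unity supported on neighbouring cells, so only data at nodes next to the
  clipped argument enter, with nonnegative weights of sum one.\<close>
lemma interp_near:
  assumes "\<And>\<iota>. length \<iota> = length us \<Longrightarrow>
      (\<And>k. k < length us \<Longrightarrow> \<iota> ! k \<le> n \<and> \<bar>clip 0 (real n) (us ! k) - real (\<iota> ! k)\<bar> \<le> 1)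
      \<Longrightarrow> \<bar>F \<iota> - c\<bar> \<le> \<delta>"
  shows "\<bar>interp n us F - c\<bar> \<le> \<delta>"
  using assms
proof (induction us arbitrary: F)
  case (Cons u us)
  let ?G = "\<lambda>i. interp n us (\<lambda>\<iota>. F (i # \<iota>))"
  have near: "hat n i u * \<bar>?G i - c\<bar> \<le> hat n i u * \<delta>" if "i \<le> n" for i
  proof (cases "hat n i u = 0")
    case False
    have "\<bar>?G i - c\<bar> \<le> \<delta>"
    proof (rule Cons.IH)
      fix \<iota> assume "length \<iota> = length us" and *: "\<And>k. k < length us \<Longrightarrow> \<iota> ! k \<le> n \<and> \<bar>clip 0 (real n) (us ! k) - real (\<iota> ! k)\<bar> \<le> 1"
      then show "\<bar>F (i # \<iota>) - c\<bar> \<le> \<delta>"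
        using hat_support [OF that False] that
        by (intro Cons.prems) (auto simp: nth_Cons split: nat.splits)
    qed
    then show ?thesis by (intro mult_left_mono hat_nonneg that)
  qed simp
  have "interp n (u # us) F - c = (\<Sum>i\<le>n. hat n i u * (?G i - c))"
    by (simp add: right_diff_distrib sum_subtractf sum_distrib_right [symmetric] sum_hat_eq_1)
  also have "\<bar>\<dots>\<bar> \<le> (\<Sum>i\<le>n. hat n i u * \<bar>?G i - c\<bar>)"
    by (rule order_trans [OF sum_abs]) (simp add: abs_mult hat_nonneg)
  also have "\<dots> \<le> (\<Sum>i\<le>n. hat n i u * \<delta>)"
    using near by (intro sum_mono) auto
  also have "\<dots> = \<delta>"
    by (simp add: sum_distrib_right [symmetric] sum_hat_eq_1)
  finally show ?case .
qed simp

lemma interp_abs_le: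
  assumes "\<And>\<iota>. length \<iota> = length us \<Longrightarrow> set \<iota> \<subseteq> {..n} \<Longrightarrow> \<bar>F \<iota>\<bar> \<le> B"
  shows "\<bar>interp n us F\<bar> \<le> B"
  using interp_near [of us n F 0 B] assms by (auto simp: in_set_conv_nth subset_iff)

text \<open>Coordinates are moved one after the other.  Along one coordinate the bound is that of \<open>sum_hat\<close>:
  the differences of the ramps all have the same sign, so their absolute values add up to the change of
  the clipped coordinate.  This yields one summand \<open>D * e\<close> per coordinate.\<close>
lemma interp_lipschitz:
  assumes "length us' = length us"
    and "\<And>k. k < length us \<Longrightarrow> \<bar>us ! k - us' ! k\<bar> \<le> e"
    and "\<And>\<iota> k. length \<iota> = length us \<Longrightarrow> set \<iota> \<subseteq> {..n} \<Longrightarrow> k < length us \<Longrightarrow> \<iota> ! k < n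
      \<Longrightarrow> \<bar>F (\<iota>[k := Suc (\<iota> ! k)]) - F \<iota>\<bar> \<le> D"
    and "0 \<le> D"
  shows "\<bar>interp n us F - interp n us' F\<bar> \<le> real (length us) * D * e"
  using assms
proof (induction us arbitrary: us' F)
  case (Cons u us)
  then obtain u' vs where us': "us' = u' # vs" and len: "length vs = length us"
    by (cases us') auto
  have uu: "\<bar>u - u'\<bar> \<le> e" using Cons.prems(2) [of 0] us' by simp
  have e: "\<bar>us ! k - vs ! k\<bar> \<le> e" if "k < length us" for k
    using Cons.prems(2) [of "Suc k"] us' that by simp
  let ?G = "\<lambda>us i. interp n us (\<lambda>\<iota>. F (i # \<iota>))"
  \<comment> \<open>moving the remaining coordinates\<close>
  have "\<bar>(\<Sum>i\<le>n. hat n i u * ?G us i) - (\<Sum>i\<le>n. hat n i u * ?G vs i)\<bar>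
      = \<bar>\<Sum>i\<le>n. hat n i u * (?G us i - ?G vs i)\<bar>"
    by (simp add: right_diff_distrib sum_subtractf)
  also have "\<dots> \<le> (\<Sum>i\<le>n. hat n i u * \<bar>?G us i - ?G vs i\<bar>)"
    by (rule order_trans [OF sum_abs]) (simp add: abs_mult hat_nonneg)
  also have "\<dots> \<le> (\<Sum>i\<le>n. hat n i u * (real (length us) * D * e))"
  proof (intro sum_mono mult_left_mono hat_nonneg)
    fix i assume i: "i \<in> {..n}"
    show "\<bar>?G us i - ?G vs i\<bar> \<le> real (length us) * D * e"
    proof (rule Cons.IH [OF len e _ Cons.prems(4)])
      fix \<iota> k assume "length \<iota> = length us" "set \<iota> \<subseteq> {..n}" "k < length us" "\<iota> ! k < n"
      then show "\<bar>F (i # \<iota>[k := Suc (\<iota> ! k)]) - F (i # \<iota>)\<bar> \<le> D"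
        using Cons.prems(3) [of "i # \<iota>" "Suc k"] i by simp
    qed
  qed auto
  also have "\<dots> = real (length us) * D * e"
    by (simp add: sum_distrib_right [symmetric] sum_hat_eq_1)
  finally have tail: "\<bar>(\<Sum>i\<le>n. hat n i u * ?G us i) - (\<Sum>i\<le>n. hat n i u * ?G vs i)\<bar>
      \<le> real (length us) * D * e" .
  \<comment> \<open>moving the first coordinate\<close>
  have step: "\<bar>?G vs (Suc i) - ?G vs i\<bar> \<le> D" if "i < n" for i
  proof -
    have "\<bar>interp n vs (\<lambda>\<iota>. F (Suc i # \<iota>) - F (i # \<iota>))\<bar> \<le> D"
    proof (rule interp_abs_le)
      fix \<iota> assume "length \<iota> = length vs" "set \<iota> \<subseteq> {..n}"
      then show "\<bar>F (Suc i # \<iota>) - F (i # \<iota>)\<bar> \<le> D"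
        using Cons.prems(3) [of "i # \<iota>" 0] that len by simp
    qed
    then show ?thesis by (simp add: interp_diff)
  qed
  have "\<bar>(\<Sum>i\<le>n. hat n i u * ?G vs i) - (\<Sum>i\<le>n. hat n i u' * ?G vs i)\<bar>
      = \<bar>\<Sum>i<n. (ramp i u - ramp i u') * (?G vs (Suc i) - ?G vs i)\<bar>"
    by (simp add: sum_hat left_diff_distrib sum_subtractf)
  also have "\<dots> \<le> (\<Sum>i<n. \<bar>ramp i u - ramp i u'\<bar> * D)"
    by (rule order_trans [OF sum_abs]) (auto simp: abs_mult intro!: sum_mono mult_left_mono step)
  also have "\<dots> = (\<Sum>i<n. \<bar>ramp i u - ramp i u'\<bar>) * D"
    by (simp add: sum_distrib_right)
  also have "(\<Sum>i<n. \<bar>ramp i u - ramp i u'\<bar>) = \<bar>\<Sum>i<n. ramp i u - ramp i u'\<bar>"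
  proof (cases "u \<le> u'")
    case True
    then show ?thesis by (simp add: ramp_mono sum_subtractf abs_of_nonpos sum_mono)
  next
    case False
    then show ?thesis by (simp add: ramp_mono sum_subtractf abs_of_nonneg sum_mono)
  qed
  also have "\<dots> = \<bar>clip 0 (real n) u - clip 0 (real n) u'\<bar>"
    by (simp add: sum_subtractf sum_ramp)
  also have "\<dots> * D \<le> e * D"
    using uu Cons.prems(4) by (intro mult_right_mono) (auto simp: clip_def max_def min_def)
  finally have head: "\<bar>(\<Sum>i\<le>n. hat n i u * ?G vs i) - (\<Sum>i\<le>n. hat n i u' * ?G vs i)\<bar> \<le> e * D" .
  show ?case
    using tail head by (simp add: us' algebra_simps)
qed simp

lemma cells_Suc: "cells n (Suc m) = concat (map (\<lambda>i. map ((#) i) (cells n m)) [0..<Suc n])"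
  by (simp add: cells_def del: upt_Suc)

lemma sum_cells_Suc:
  fixes g :: "nat list \<Rightarrow> real"
  shows "(\<Sum>\<iota>\<leftarrow>cells n (Suc m). g \<iota>) = (\<Sum>i\<le>n. \<Sum>\<iota>\<leftarrow>cells n m. g (i # \<iota>))"
proof -
  have "(\<Sum>\<iota>\<leftarrow>concat (map (\<lambda>i. map ((#) i) (cells n m)) is). g \<iota>) = (\<Sum>i\<leftarrow>is. \<Sum>\<iota>\<leftarrow>cells n m. g (i # \<iota>))" for "is"
    by (induction "is") (simp_all add: o_def)
  then show ?thesis
    unfolding cells_Suc
    by (simp only: interv_sum_list_conv_sum_set_nat set_upt atLeast0LessThan lessThan_Suc_atMost)
qed

text \<open>The form in which a multilinear layer evaluates the interpolant: one monomial per multi-index.\<close>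
lemma interp_expand:
  "interp n us F = (\<Sum>\<iota>\<leftarrow>cells n (length us). F \<iota> * (\<Prod>k<length us. hat n (\<iota> ! k) (us ! k)))"
proof (induction us arbitrary: F)
  case (Cons u us)
  show ?case
    unfolding interp.simps Cons.IH length_Cons sum_cells_Suc prod.lessThan_Suc_shift
    by (simp add: sum_list_const_mult [symmetric] mult.left_commute)
qed (simp add: cells_def)

lemma cells_set: "set (cells n m) = {\<iota>. length \<iota> = m \<and> set \<iota> \<subseteq> {..n}}"
proof (rule Set.set_eqI)
  fix \<iota> :: "nat list"
  have "\<iota> \<in> set (cells n m) \<longleftrightarrow> length \<iota> = m \<and> (\<forall>k<m. \<iota> ! k < Suc n)"
    unfolding cells_def product_lists_set
    by (auto simp: list_all2_conv_all_nth simp del: upt_Suc)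
  moreover have "set \<iota> \<subseteq> {..n} \<longleftrightarrow> (\<forall>k<length \<iota>. \<iota> ! k < Suc n)"
    by (auto simp: in_set_conv_nth subset_iff less_Suc_eq_le)
  ultimately show "\<iota> \<in> set (cells n m) \<longleftrightarrow> \<iota> \<in> {\<iota>. length \<iota> = m \<and> set \<iota> \<subseteq> {..n}}"
    by auto
qed

lemma length_cells: "length (cells n m) = (n + 1) ^ m"
proof (induction m)
  case (Suc m)
  have "length (cells n (Suc m)) = (\<Sum>i\<leftarrow>[0..<Suc n]. length (cells n m))"
    by (simp add: cells_def length_concat o_def del: upt_Suc)
  also have "\<dots> = length [0..<Suc n] * length (cells n m)"
    by (simp only: sum_list_triv of_nat_id)
  finally show ?case by (simp add: Suc del: upt_Suc)
qed (simp add: cells_def)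

section \<open>An Euler scheme with averaged drift\<close>

lemma clip_lipschitz: "\<bar>clip a b u - clip a b v\<bar> \<le> \<bar>u - v\<bar>"
  by (auto simp: clip_def max_def min_def)

lemma clip_id: "a \<le> u \<Longrightarrow> u \<le> b \<Longrightarrow> clip a b u = u"
  by (auto simp: clip_def)

lemma deriv_bound_increment:
  fixes f :: "real \<Rightarrow> real"
  assumes "\<And>r. r \<in> {s..t} \<Longrightarrow> (f has_real_derivative f' r) (at r within S)"
    and "{s..t} \<subseteq> S" "s \<le> t" "\<And>r. r \<in> {s..t} \<Longrightarrow> \<bar>f' r\<bar> \<le> c"
  shows "\<bar>f t - f s\<bar> \<le> c * (t - s)"
  using field_differentiable_bound [of "{s..t}" f f' c s t] assms DERIV_subset [OF assms(1,2)]
  by (auto simp: abs_minus_commute)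

text \<open>Pairs \<open>(i, j)\<close> are stored in a vector at position \<open>i * b + j\<close>.\<close>
lemma flat_index_less: "i < a \<Longrightarrow> j < b \<Longrightarrow> i * b + j < a * (b::nat)"
proof -
  assume "i < a" "j < b"
  then have "i * b + j < Suc i * b" by simp
  also have "\<dots> \<le> a * b" using \<open>i < a\<close> by (intro mult_right_mono) auto
  finally show ?thesis .
qed

text \<open>Normalized form of the transport problem: the drift is the average, with weights \<open>p j\<close> of sum one,
  of the fields \<open>y j * b j\<close>, all of which obey the same bound \<open>A\<close> and Lipschitz constant \<open>l\<close>.  The
  averaging is what keeps the number \<open>dy\<close> of parameters out of every estimate.  The Lipschitz condition
  is stated through the clipped coordinates, so it also says that \<open>b\<close> does not change outside the cube
  of radius \<open>R\<close>; hence the grid on that cube resolves it everywhere.  There are \<open>K\<close> time steps and \<open>n\<close>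
  cells per coordinate.\<close>
locale euler_scheme =
  fixes m dy K n :: nat and T A l R :: real and p :: "nat \<Rightarrow> real"
    and b :: "nat \<Rightarrow> nat \<Rightarrow> real \<Rightarrow> real vec \<Rightarrow> real"
  assumes m: "0 < m" and dy: "0 < dy" and n: "0 < n"
    and T: "0 < T" and A: "0 < A" and l: "0 \<le> l" and R: "0 < R"
    and p_nonneg: "j < dy \<Longrightarrow> 0 \<le> p j" and p_sum: "(\<Sum>j<dy. p j) = 1"
    and b_continuous: "j < dy \<Longrightarrow> i < m \<Longrightarrow> x \<in> carrier_vec m \<Longrightarrow> continuous_on {0..T} (\<lambda>t. b j i t x)"
    and b_bound: "j < dy \<Longrightarrow> i < m \<Longrightarrow> x \<in> carrier_vec m \<Longrightarrow> t \<in> {0..T} \<Longrightarrow> \<bar>b j i t x\<bar> \<le> A"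
    and b_lipschitz: "j < dy \<Longrightarrow> i < m \<Longrightarrow> x \<in> carrier_vec m \<Longrightarrow> x' \<in> carrier_vec m \<Longrightarrow> t \<in> {0..T}
      \<Longrightarrow> (\<And>k. k < m \<Longrightarrow> \<bar>clip (- R) R (x $ k) - clip (- R) R (x' $ k)\<bar> \<le> e)
      \<Longrightarrow> \<bar>b j i t x - b j i t x'\<bar> \<le> l * e"
begin

text \<open>The widths of a time step and of a cell.  Division by \<open>K = 0\<close> yields \<open>h = 0\<close>, in accordance with a
  scheme without steps.\<close>
definition h :: real where "h = T / real K"
definition H :: real where "H = 2 * R / real n"
definition grid_time :: "nat \<Rightarrow> real" where "grid_time k = real k * h"
definition grid_point :: "nat list \<Rightarrow> real vec" where "grid_point \<iota> = vec m (\<lambda>k. H * real (\<iota> ! k) - R)"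
text \<open>Continuity of \<open>b\<close> in time comes without a modulus, so sampling \<open>b\<close> at the grid times would give no
  rate.  The scheme uses its exact time integral over a step at each node instead, and interpolates
  these integrals in space.\<close>
definition primitive :: "nat \<Rightarrow> nat \<Rightarrow> real \<Rightarrow> real vec \<Rightarrow> real" where
  "primitive j i t x = integral {0..t} (\<lambda>s. b j i s x)"
definition drift_incr :: "nat \<Rightarrow> nat \<Rightarrow> nat \<Rightarrow> nat list \<Rightarrow> real" where
  "drift_incr k j i \<iota> = primitive j i (grid_time (Suc k)) (grid_point \<iota>) - primitive j i (grid_time k) (grid_point \<iota>)"
definition cell_coords :: "real vec \<Rightarrow> real list" where
  "cell_coords v = map (\<lambda>c. (v $ c + R) / H) [0..<m]"
definition drift :: "nat \<Rightarrow> nat \<Rightarrow> nat \<Rightarrow> real vec \<Rightarrow> real" where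
  "drift k j i v = interp n (cell_coords v) (drift_incr k j i)"
text \<open>The fraction of step \<open>k\<close> that has elapsed at time \<open>t\<close>, written with two ReLU functions of time as the
  weights of the network are.  Steps in the future are switched off by the value 0, so one network of
  \<open>K\<close> steps serves all times.\<close>
definition \<tau> :: "nat \<Rightarrow> real \<Rightarrow> real" where "\<tau> k t = (max 0 (t - grid_time k) - max 0 (t - grid_time (Suc k))) / h"

text \<open>A state \<open>(x, y)\<close> is a vector of length \<open>m + dy\<close>.  A step is split into a map whose new components
  depend on \<open>x\<close> only, hence on \<open>m\<close> variables, and a bilinear map.  This is the splitting that the
  compositional representation needs.\<close>
definition expand :: "nat \<Rightarrow> real vec \<Rightarrow> real vec" where
  "expand k v = vec (m + dy + dy * m) (\<lambda>r. if r < m + dy then v $ r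
      else drift k ((r - (m + dy)) div m) ((r - (m + dy)) mod m) v)"
definition update :: "nat \<Rightarrow> real \<Rightarrow> real vec \<Rightarrow> real vec" where
  "update k t v = vec (m + dy) (\<lambda>r. if r < m
      then v $ r + \<tau> k t * (\<Sum>j<dy. p j * (v $ (m + j) * v $ (m + dy + (j * m + r)))) else v $ r)"
definition step :: "nat \<Rightarrow> real \<Rightarrow> real vec \<Rightarrow> real vec" where
  "step k t v = update k t (expand k v)"
fun state :: "nat \<Rightarrow> real \<Rightarrow> real vec \<Rightarrow> real vec" where
  "state 0 t v = v"
| "state (Suc k) t v = step k t (state k t v)"

lemma H_pos: "0 < H" using R n by (simp add: H_def)
lemma h_pos: "0 < K \<Longrightarrow> 0 < h" using T by (simp add: h_def)
lemma h_nonneg: "0 \<le> h" using T by (simp add: h_def)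
lemma grid_time_Suc: "grid_time (Suc k) = grid_time k + h" by (simp add: grid_time_def algebra_simps)
lemma grid_time_nonneg: "0 \<le> grid_time k" using h_nonneg by (simp add: grid_time_def)
lemma grid_time_mono: "k \<le> k' \<Longrightarrow> grid_time k \<le> grid_time k'" using h_nonneg by (simp add: grid_time_def mult_right_mono)
lemma grid_time_le_T: "k \<le> K \<Longrightarrow> grid_time k \<le> T"
proof (cases "K = 0")
  case False
  assume "k \<le> K"
  then have "real k * T \<le> real K * T" using T by (intro mult_right_mono) auto
  then show ?thesis using False by (simp add: grid_time_def h_def field_simps)
qed (unfold grid_time_def h_def, use T in simp)

lemma convex_bound:
  assumes "\<And>j. j < dy \<Longrightarrow> \<bar>f j\<bar> \<le> c"
  shows "\<bar>\<Sum>j<dy. p j * f j\<bar> \<le> c"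
proof -
  have "\<bar>\<Sum>j<dy. p j * f j\<bar> \<le> (\<Sum>j<dy. p j * c)"
    by (rule order_trans [OF sum_abs]) (auto simp: abs_mult p_nonneg intro!: sum_mono mult_left_mono assms)
  also have "\<dots> = c" by (simp add: sum_distrib_right [symmetric] p_sum)
  finally show ?thesis .
qed

lemma \<tau>_eq: "0 < K \<Longrightarrow> \<tau> k t = clip 0 1 ((t - grid_time k) / h)"
  using h_pos by (auto simp: \<tau>_def clip_def grid_time_Suc max_def min_def field_simps)

lemma \<tau>_range: "0 \<le> \<tau> k t" "\<tau> k t \<le> 1"
proof -
  have "0 \<le> \<tau> k t \<and> \<tau> k t \<le> 1"
  proof (cases "K = 0")
    case True
    then show ?thesis unfolding \<tau>_def h_def by simp
  next
    case False
    then show ?thesis by (simp add: \<tau>_eq clip_def)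
  qed
  then show "0 \<le> \<tau> k t" "\<tau> k t \<le> 1" by auto
qed

lemma \<tau>_lipschitz: "0 < K \<Longrightarrow> \<bar>\<tau> k s - \<tau> k t\<bar> \<le> \<bar>s - t\<bar> / h"
  using clip_lipschitz [of 0 1 "(s - grid_time k) / h" "(t - grid_time k) / h"] h_pos
  by (simp add: \<tau>_eq diff_divide_distrib [symmetric])

lemma \<tau>_past: "0 < K \<Longrightarrow> grid_time (Suc k) \<le> t \<Longrightarrow> \<tau> k t = 1"
  using h_pos by (simp add: \<tau>_def grid_time_Suc)

lemma \<tau>_future: "t \<le> grid_time k \<Longrightarrow> \<tau> k t = 0"
  using h_nonneg by (simp add: \<tau>_def grid_time_Suc)

lemma grid_point_carrier [simp]: "grid_point \<iota> \<in> carrier_vec m" by (simp add: grid_point_def)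
lemma cell_coords_length [simp]: "length (cell_coords v) = m" by (simp add: cell_coords_def)
lemma cell_coords_nth: "k < m \<Longrightarrow> cell_coords v ! k = (v $ k + R) / H" by (simp add: cell_coords_def)

lemma primitive_deriv:
  assumes "j < dy" "i < m" "x \<in> carrier_vec m" "t \<in> {0..T}"
  shows "((\<lambda>t. primitive j i t x) has_real_derivative b j i t x) (at t within {0..T})"
  unfolding primitive_def
  using integral_has_real_derivative [OF b_continuous [OF assms(1-3)] assms(4)] .

lemma drift_incr_bound:
  assumes "k < K" "j < dy" "i < m"
  shows "\<bar>drift_incr k j i \<iota>\<bar> \<le> A * h"
proof -
  have sub: "{grid_time k..grid_time (Suc k)} \<subseteq> {0..T}"
    using grid_time_nonneg [of k] grid_time_le_T [of "Suc k"] assms by auto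
  have "\<bar>primitive j i (grid_time (Suc k)) (grid_point \<iota>) - primitive j i (grid_time k) (grid_point \<iota>)\<bar> \<le> A * (grid_time (Suc k) - grid_time k)"
    using sub assms h_nonneg
    by (intro deriv_bound_increment [where S = "{0..T}" and f' = "\<lambda>t. b j i t (grid_point \<iota>)"] primitive_deriv b_bound)
       (auto simp: grid_time_Suc)
  then show ?thesis by (simp add: drift_incr_def grid_time_Suc)
qed

lemma drift_incr_lipschitz:
  assumes "k < K" "j < dy" "i < m" "length \<iota> = m" "c < m"
  shows "\<bar>drift_incr k j i (\<iota>[c := Suc (\<iota> ! c)]) - drift_incr k j i \<iota>\<bar> \<le> l * H * h"
proof -
  let ?\<iota> = "\<iota>[c := Suc (\<iota> ! c)]"
  let ?f = "\<lambda>t. primitive j i t (grid_point ?\<iota>) - primitive j i t (grid_point \<iota>)"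
  have sub: "{grid_time k..grid_time (Suc k)} \<subseteq> {0..T}"
    using grid_time_nonneg [of k] grid_time_le_T [of "Suc k"] assms by auto
  have d: "\<bar>clip (- R) R (grid_point ?\<iota> $ q) - clip (- R) R (grid_point \<iota> $ q)\<bar> \<le> H" if "q < m" for q
    using clip_lipschitz [of "- R" R "grid_point ?\<iota> $ q" "grid_point \<iota> $ q"] that H_pos assms
    by (cases "q = c") (auto simp: grid_point_def algebra_simps)
  have "\<bar>?f (grid_time (Suc k)) - ?f (grid_time k)\<bar> \<le> (l * H) * (grid_time (Suc k) - grid_time k)"
  proof (rule deriv_bound_increment [where S = "{0..T}" and f' = "\<lambda>t. b j i t (grid_point ?\<iota>) - b j i t (grid_point \<iota>)"])
    fix r assume "r \<in> {grid_time k..grid_time (Suc k)}"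
    then have r: "r \<in> {0..T}" using sub by auto
    then show "(?f has_real_derivative b j i r (grid_point ?\<iota>) - b j i r (grid_point \<iota>)) (at r within {0..T})"
      using assms by (intro DERIV_diff primitive_deriv) auto
    show "\<bar>b j i r (grid_point ?\<iota>) - b j i r (grid_point \<iota>)\<bar> \<le> l * H"
      using assms r d by (intro b_lipschitz) auto
  qed (use sub h_nonneg in \<open>auto simp: grid_time_Suc\<close>)
  then show ?thesis by (simp add: drift_incr_def grid_time_Suc algebra_simps)
qed

lemma drift_bound: "k < K \<Longrightarrow> j < dy \<Longrightarrow> i < m \<Longrightarrow> \<bar>drift k j i v\<bar> \<le> A * h"
  unfolding drift_def by (rule interp_abs_le) (rule drift_incr_bound)

lemma drift_lipschitz:
  assumes "k < K" "j < dy" "i < m" "\<And>c. c < m \<Longrightarrow> \<bar>v $ c - v' $ c\<bar> \<le> e"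
  shows "\<bar>drift k j i v - drift k j i v'\<bar> \<le> real m * l * h * e"
proof -
  have "\<bar>drift k j i v - drift k j i v'\<bar> \<le> real (length (cell_coords v)) * (l * H * h) * (e / H)"
    unfolding drift_def
  proof (rule interp_lipschitz)
    fix c assume "c < length (cell_coords v)"
    then show "\<bar>cell_coords v ! c - cell_coords v' ! c\<bar> \<le> e / H"
      using assms(4) [of c] H_pos
      by (simp add: cell_coords_nth diff_divide_distrib [symmetric] divide_right_mono)
  qed (use assms drift_incr_lipschitz l H_pos h_nonneg in auto)
  then show ?thesis using H_pos by (simp add: field_simps)
qed

lemma drift_cong: "(\<And>c. c < m \<Longrightarrow> v $ c = v' $ c) \<Longrightarrow> drift k j i v = drift k j i v'"
  unfolding drift_def cell_coords_def by (rule arg_cong2 [where f = "interp n"]) auto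

lemma expand_carrier [simp]: "expand k v \<in> carrier_vec (m + dy + dy * m)" by (simp add: expand_def)
lemma update_carrier [simp]: "update k t v \<in> carrier_vec (m + dy)" by (simp add: update_def)
lemma step_carrier [simp]: "step k t v \<in> carrier_vec (m + dy)" by (simp add: step_def)

lemma index_bound: "j < dy \<Longrightarrow> i < m \<Longrightarrow> j * m + i < dy * m"
  by (rule flat_index_less)

lemma expand_low [simp]: "r < m + dy \<Longrightarrow> expand k v $ r = v $ r"
  by (simp add: expand_def)

lemma expand_high [simp]: "j < dy \<Longrightarrow> i < m \<Longrightarrow> expand k v $ (m + dy + (j * m + i)) = drift k j i v"
  using index_bound [of j i] by (simp add: expand_def)

lemma step_low: "r < m \<Longrightarrow> step k t v $ r = v $ r + \<tau> k t * (\<Sum>j<dy. p j * (v $ (m + j) * drift k j r v))"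
  by (simp add: step_def update_def)

lemma step_high: "m \<le> r \<Longrightarrow> r < m + dy \<Longrightarrow> step k t v $ r = v $ r"
  by (simp add: step_def update_def)

lemma state_high: "m \<le> r \<Longrightarrow> r < m + dy \<Longrightarrow> state k t v $ r = v $ r"
  by (induction k) (auto simp: step_high)

lemma state_carrier: "v \<in> carrier_vec (m + dy) \<Longrightarrow> state k t v \<in> carrier_vec (m + dy)"
  by (cases k) auto

lemma z_speed:
  fixes z :: "real \<Rightarrow> real vec"
  assumes z_carrier: "\<And>t. t \<in> {0..<T} \<Longrightarrow> z t \<in> carrier_vec m"
    and z_deriv: "\<And>t i. t \<in> {0..<T} \<Longrightarrow> i < m \<Longrightarrow>
        ((\<lambda>s. z s $ i) has_real_derivative (\<Sum>j<dy. p j * (y j * b j i t (z t)))) (at t within {0..<T})"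
    and y: "\<And>j. j < dy \<Longrightarrow> \<bar>y j\<bar> \<le> 1"
    and st: "0 \<le> s" "s \<le> t" "t < T" and i: "i < m"
  shows "\<bar>z t $ i - z s $ i\<bar> \<le> A * (t - s)"
proof (rule deriv_bound_increment [where S = "{0..<T}"])
  fix r assume "r \<in> {s..t}"
  then have r: "r \<in> {0..<T}" using st by auto
  show "((\<lambda>t. z t $ i) has_real_derivative (\<Sum>j<dy. p j * (y j * b j i r (z r)))) (at r within {0..<T})"
    using z_deriv [OF r i] .
  show "\<bar>\<Sum>j<dy. p j * (y j * b j i r (z r))\<bar> \<le> A"
  proof (rule convex_bound)
    fix j assume j: "j < dy"
    have "\<bar>y j\<bar> * \<bar>b j i r (z r)\<bar> \<le> 1 * A"
      using y [OF j] b_bound [OF j i z_carrier [OF r]] r by (intro mult_mono) auto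
    then show "\<bar>y j * b j i r (z r)\<bar> \<le> A" by (simp add: abs_mult)
  qed
qed (use st in auto)

text \<open>Subtracting from \<open>z\<close> the primitive of the drift frozen at a node leaves a function whose derivative is
  the drift at \<open>z\<close> minus the drift at the node.  It is at most \<open>l\<close> times the distance, which is made up
  of the motion within the step (\<open>A * h\<close>), the error so far (\<open>E\<close>) and the width of a cell (\<open>H\<close>).  The
  Lipschitz constant of the interpolant does not enter, because \<open>z\<close> is compared directly with the nodes
  next to the numerical state; it would cost a factor \<open>m\<close> in the exponent.\<close>
lemma one_step:
  fixes z :: "real \<Rightarrow> real vec" and v :: "real vec"
  assumes z_carrier: "\<And>t. t \<in> {0..<T} \<Longrightarrow> z t \<in> carrier_vec m"
    and z_deriv: "\<And>t i. t \<in> {0..<T} \<Longrightarrow> i < m \<Longrightarrow>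
        ((\<lambda>s. z s $ i) has_real_derivative (\<Sum>j<dy. p j * (y j * b j i t (z t)))) (at t within {0..<T})"
    and y: "\<And>j. j < dy \<Longrightarrow> \<bar>y j\<bar> \<le> 1"
    and k: "k < K" "grid_time (Suc k) < T" and i: "i < m"
    and close: "\<And>c. c < m \<Longrightarrow> \<bar>z (grid_time k) $ c - v $ c\<bar> \<le> E"
  shows "\<bar>(z (grid_time (Suc k)) $ i - z (grid_time k) $ i) - (\<Sum>j<dy. p j * (y j * drift k j i v))\<bar>
     \<le> l * (A * h + E + H) * h"
proof -
  let ?G = "\<lambda>\<iota>. \<Sum>j<dy. (p j * y j) * drift_incr k j i \<iota>"
  let ?d = "z (grid_time (Suc k)) $ i - z (grid_time k) $ i"
  have sub: "{grid_time k..grid_time (Suc k)} \<subseteq> {0..<T}"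
    using grid_time_nonneg [of k] k by auto
  have "\<bar>interp n (cell_coords v) ?G - ?d\<bar> \<le> l * (A * h + E + H) * h"
  proof (rule interp_near)
    fix \<iota> :: "nat list"
    assume \<iota>: "length \<iota> = length (cell_coords v)"
      "\<And>c. c < length (cell_coords v) \<Longrightarrow> \<iota> ! c \<le> n \<and> \<bar>clip 0 (real n) (cell_coords v ! c) - real (\<iota> ! c)\<bar> \<le> 1"
    have near: "\<bar>clip (- R) R (v $ c) - clip (- R) R (grid_point \<iota> $ c)\<bar> \<le> H" if c: "c < m" for c
    proof -
      have nH: "real n * H = 2 * R" using n by (simp add: H_def)
      have clip_scale: "clip (- R) R (v $ c) = H * clip 0 (real n) ((v $ c + R) / H) - R"
        using H_pos nH R unfolding clip_def max_def min_def
        by (auto simp: field_simps)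
      have "real (\<iota> ! c) \<le> real n" using \<iota>(2) [of c] c by simp
      then have "H * real (\<iota> ! c) \<le> H * real n" using H_pos by (intro mult_left_mono) auto
      then have "clip (- R) R (grid_point \<iota> $ c) = H * real (\<iota> ! c) - R"
        using H_pos nH c by (simp add: grid_point_def mult.commute clip_id)
      then have "\<bar>clip (- R) R (v $ c) - clip (- R) R (grid_point \<iota> $ c)\<bar>
          = H * \<bar>clip 0 (real n) ((v $ c + R) / H) - real (\<iota> ! c)\<bar>"
        using H_pos by (simp add: clip_scale right_diff_distrib [symmetric] abs_mult)
      also have "\<dots> \<le> H * 1"
        using \<iota>(2) [of c] c H_pos by (intro mult_left_mono) (auto simp: cell_coords_nth)
      finally show ?thesis by simp
    qed
    let ?f = "\<lambda>t. z t $ i - (\<Sum>j<dy. (p j * y j) * primitive j i t (grid_point \<iota>))"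
    have "\<bar>?f (grid_time (Suc k)) - ?f (grid_time k)\<bar> \<le> l * (A * h + E + H) * (grid_time (Suc k) - grid_time k)"
    proof (rule deriv_bound_increment [where S = "{0..<T}"
          and f' = "\<lambda>t. \<Sum>j<dy. p j * (y j * (b j i t (z t) - b j i t (grid_point \<iota>)))"])
      fix r assume rk: "r \<in> {grid_time k..grid_time (Suc k)}"
      then have r: "r \<in> {0..<T}" using sub by auto
      have "((\<lambda>t. primitive j i t (grid_point \<iota>)) has_real_derivative b j i r (grid_point \<iota>)) (at r within {0..<T})"
        if "j < dy" for j
        using r that i by (intro DERIV_subset [OF primitive_deriv]) auto
      then have "(?f has_real_derivative (\<Sum>j<dy. p j * (y j * b j i r (z r)))
          - (\<Sum>j<dy. (p j * y j) * b j i r (grid_point \<iota>))) (at r within {0..<T})"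
        by (intro DERIV_diff z_deriv r i DERIV_sum DERIV_cmult) auto
      then show "(?f has_real_derivative (\<Sum>j<dy. p j * (y j * (b j i r (z r) - b j i r (grid_point \<iota>)))))
          (at r within {0..<T})"
        by (simp add: sum_subtractf right_diff_distrib mult.assoc)
      show "\<bar>\<Sum>j<dy. p j * (y j * (b j i r (z r) - b j i r (grid_point \<iota>)))\<bar> \<le> l * (A * h + E + H)"
      proof (rule convex_bound)
        fix j assume j: "j < dy"
        have "\<bar>b j i r (z r) - b j i r (grid_point \<iota>)\<bar> \<le> l * (A * h + E + H)"
        proof (rule b_lipschitz [OF j i z_carrier [OF r]])
          fix c assume c: "c < m"
          have "\<bar>z r $ c - z (grid_time k) $ c\<bar> \<le> A * (r - grid_time k)"
            using rk r grid_time_nonneg [of k] c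
            by (intro z_speed [where y = y] z_carrier z_deriv y) auto
          also have "\<dots> \<le> A * h" using rk A by (intro mult_left_mono) (auto simp: grid_time_Suc)
          finally have "\<bar>z r $ c - v $ c\<bar> \<le> A * h + E" using close [OF c] by linarith
          then have "\<bar>clip (- R) R (z r $ c) - clip (- R) R (v $ c)\<bar> \<le> A * h + E"
            using clip_lipschitz order_trans by blast
          then show "\<bar>clip (- R) R (z r $ c) - clip (- R) R (grid_point \<iota> $ c)\<bar> \<le> A * h + E + H"
            using near [OF c] by linarith
        qed (use r in auto)
        then have "\<bar>y j\<bar> * \<bar>b j i r (z r) - b j i r (grid_point \<iota>)\<bar> \<le> 1 * (l * (A * h + E + H))"
          using y [OF j] by (intro mult_mono) auto
        then show "\<bar>y j * (b j i r (z r) - b j i r (grid_point \<iota>))\<bar> \<le> l * (A * h + E + H)"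
          by (simp add: abs_mult)
      qed
    qed (use sub h_nonneg in \<open>auto simp: grid_time_Suc\<close>)
    also have "?f (grid_time (Suc k)) - ?f (grid_time k) = - (?G \<iota> - ?d)"
      by (simp add: drift_incr_def right_diff_distrib sum_subtractf)
    finally show "\<bar>?G \<iota> - ?d\<bar> \<le> l * (A * h + E + H) * h"
      by (simp add: grid_time_Suc abs_minus_commute)
  qed
  moreover have "interp n (cell_coords v) ?G = (\<Sum>j<dy. p j * (y j * drift k j i v))"
    unfolding interp_sum drift_def by (simp add: mult.assoc)
  ultimately show ?thesis by (simp add: abs_minus_commute)
qed

text \<open>The solution of \<open>e\<^sub>0 = 0\<close>, \<open>e\<^sub>k\<^sub>+\<^sub>1 = e\<^sub>k + l * h * (A * h + e\<^sub>k + H)\<close>, which is the recursion that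
  \<open>one_step\<close> provides.\<close>
definition err :: "nat \<Rightarrow> real" where "err k = ((1 + l * h) ^ k - 1) * (A * h + H)"

lemma power_le_exp: "k \<le> K \<Longrightarrow> (1 + c * l * h) ^ k \<le> exp (c * l * T)" if "0 \<le> c" for c
proof -
  assume k: "k \<le> K"
  have "(1 + c * l * h) ^ k \<le> exp (c * l * h) ^ k"
    using that l h_nonneg by (intro power_mono) (auto intro: exp_ge_add_one_self)
  also have "\<dots> = exp (c * l * grid_time k)" by (simp add: exp_of_nat_mult [symmetric] grid_time_def mult_ac)
  also have "\<dots> \<le> exp (c * l * T)" using grid_time_le_T [OF k] l that by (simp add: mult_left_mono)
  finally show ?thesis .
qed

context
  fixes z :: "real \<Rightarrow> real vec" and w :: "real vec"
  assumes w: "w \<in> carrier_vec (m + dy)" "\<And>j. j < dy \<Longrightarrow> \<bar>w $ (m + j)\<bar> \<le> 1"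
    and z_0: "\<And>i. i < m \<Longrightarrow> z 0 $ i = w $ i"
    and z_carrier: "\<And>t. t \<in> {0..<T} \<Longrightarrow> z t \<in> carrier_vec m"
    and z_deriv: "\<And>t i. t \<in> {0..<T} \<Longrightarrow> i < m \<Longrightarrow>
        ((\<lambda>s. z s $ i) has_real_derivative (\<Sum>j<dy. p j * (w $ (m + j) * b j i t (z t)))) (at t within {0..<T})"
begin

lemma grid_error:
  assumes "k < K" "grid_time k \<le> t" "i < m"
  shows "\<bar>z (grid_time k) $ i - state k t w $ i\<bar> \<le> err k"
  using assms
proof (induction k arbitrary: i)
  case 0
  then show ?case by (simp add: grid_time_def z_0 err_def)
next
  case (Suc k)
  have h: "0 < h" using Suc.prems h_pos by simp
  have "grid_time (Suc (Suc k)) \<le> T" using Suc.prems by (intro grid_time_le_T) auto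
  then have lt: "grid_time (Suc k) < T" using h by (simp add: grid_time_Suc)
  have IH: "\<bar>z (grid_time k) $ c - state k t w $ c\<bar> \<le> err k" if "c < m" for c
    using Suc.IH [of c] Suc.prems h that by (simp add: grid_time_Suc)
  have "\<bar>(z (grid_time (Suc k)) $ i - z (grid_time k) $ i)
      - (\<Sum>j<dy. p j * (w $ (m + j) * drift k j i (state k t w)))\<bar> \<le> l * (A * h + err k + H) * h"
    using Suc.prems by (intro one_step z_carrier z_deriv w lt IH) auto
  moreover have "state (Suc k) t w $ i
      = state k t w $ i + (\<Sum>j<dy. p j * (w $ (m + j) * drift k j i (state k t w)))"
    using Suc.prems by (simp add: step_low state_high \<tau>_past)
  ultimately have "\<bar>z (grid_time (Suc k)) $ i - state (Suc k) t w $ i\<bar>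
      \<le> err k + l * (A * h + err k + H) * h"
    using IH [of i] Suc.prems by linarith
  also have "\<dots> = err (Suc k)" by (simp add: err_def algebra_simps)
  finally show ?case .
qed

lemma state_after:
  "k \<le> k' \<Longrightarrow> t \<le> grid_time k \<Longrightarrow> i < m \<Longrightarrow> state k' t w $ i = state k t w $ i"
proof (induction rule: dec_induct)
  case (step k')
  then show ?case using grid_time_mono [of k k'] by (simp add: step_low \<tau>_future)
qed simp

text \<open>Up to the last completed step the error is \<open>err\<close>.  Within the running step the characteristic and its
  approximation, which moves linearly in time, both travel at most \<open>A * h\<close>.\<close>
lemma scheme_error:
  assumes "0 < K" "t \<in> {0..<T}" "i < m"
  shows "\<bar>z t $ i - state K t w $ i\<bar> \<le> exp (l * T) * (2 * A * h + H)"
proof -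
  define k where "k = nat \<lfloor>t / h\<rfloor>"
  have h: "0 < h" using assms h_pos by simp
  have k: "real k \<le> t / h" "t / h < real k + 1"
    using assms h unfolding k_def by (simp_all add: of_nat_nat)
  then have t: "grid_time k \<le> t" "t < grid_time (Suc k)" using h by (simp_all add: grid_time_def field_simps)
  have kK: "k < K"
  proof (rule ccontr)
    assume "\<not> k < K"
    then have "grid_time K \<le> grid_time k" by (intro grid_time_mono) auto
    moreover have "grid_time K = T" using assms by (simp add: grid_time_def h_def)
    ultimately show False using t assms by auto
  qed
  let ?s = "\<Sum>j<dy. p j * (w $ (m + j) * drift k j i (state k t w))"
  have s: "\<bar>?s\<bar> \<le> A * h"
  proof (rule convex_bound)
    fix j assume j: "j < dy"
    have "\<bar>w $ (m + j)\<bar> * \<bar>drift k j i (state k t w)\<bar> \<le> 1 * (A * h)"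
      using w(2) [OF j] drift_bound [OF kK j assms(3)] by (intro mult_mono) auto
    then show "\<bar>w $ (m + j) * drift k j i (state k t w)\<bar> \<le> A * h" by (simp add: abs_mult)
  qed
  have "\<bar>\<tau> k t * ?s\<bar> \<le> 1 * (A * h)"
    using s \<tau>_range [of k t] unfolding abs_mult by (intro mult_mono) auto
  moreover have "state K t w $ i = state k t w $ i + \<tau> k t * ?s"
    using state_after [of "Suc k" K t i] kK t assms by (simp add: step_low state_high)
  moreover have "\<bar>z (grid_time k) $ i - state k t w $ i\<bar> \<le> err k"
    using grid_error kK t assms by simp
  moreover have "\<bar>z t $ i - z (grid_time k) $ i\<bar> \<le> A * (t - grid_time k)"
    using assms t grid_time_nonneg [of k] w
    by (intro z_speed [where y = "\<lambda>j. w $ (m + j)"] z_carrier z_deriv) auto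
  moreover have "A * (t - grid_time k) \<le> A * h" using t A by (intro mult_left_mono) (auto simp: grid_time_Suc)
  ultimately have "\<bar>z t $ i - state K t w $ i\<bar> \<le> err k + 2 * A * h" by linarith
  also have "\<dots> \<le> (exp (l * T) - 1) * (A * h + H) + 2 * A * h"
    using power_le_exp [of 1 k] kK A h H_pos unfolding err_def
    by (intro add_right_mono mult_right_mono) auto
  also have "\<dots> \<le> exp (l * T) * (2 * A * h + H)"
  proof -
    have "0 \<le> (exp (l * T) - 1) * (A * h)"
      using A h l T by simp
    then show ?thesis using H_pos by (simp add: algebra_simps)
  qed
  finally show ?thesis .
qed

end

end

section \<open>A network that executes the scheme\<close>

text \<open>Unlike the list of dimensions in the definition of a well-typed network, this recursive form can be
  concatenated.\<close>
fun layers_type :: "nat \<Rightarrow> layer list \<Rightarrow> nat \<Rightarrow> bool" where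
  "layers_type d [] d' \<longleftrightarrow> d = d'"
| "layers_type d (L # Ls) d' \<longleftrightarrow> (\<exists>e. layer_type d e L \<and> layers_type e Ls d')"

lemma layers_type_append:
  "layers_type d Ls e \<Longrightarrow> layers_type e Ls' d' \<Longrightarrow> layers_type d (Ls @ Ls') d'"
  by (induction Ls arbitrary: d) auto

lemma layers_type_dims:
  assumes "layers_type d Ls d'"
  shows "\<exists>ds. length ds = length Ls + 1 \<and> hd ds = d \<and> last ds = d' \<and>
    (\<forall>k<length Ls. layer_type (ds ! k) (ds ! (k + 1)) (Ls ! k))"
  using assms
proof (induction Ls arbitrary: d)
  case Nil
  then show ?case by (intro exI [of _ "[d]"]) auto
next
  case (Cons L Ls)
  then obtain e es where "layer_type d e L"
    and es: "length es = length Ls + 1" "hd es = e" "last es = d'"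
      "\<forall>k<length Ls. layer_type (es ! k) (es ! (k + 1)) (Ls ! k)"
    by (metis layers_type.simps(2))
  moreover have "es \<noteq> []" using es by auto
  ultimately show ?case
    by (intro exI [of _ "d # es"]) (auto simp: nth_Cons hd_conv_nth split: nat.splits)
qed

lemma sum_concat_upt:
  fixes g :: "'b \<Rightarrow> 'a::comm_monoid_add"
  shows "(\<Sum>x\<leftarrow>concat (map f [0..<k]). g x) = (\<Sum>j<k. \<Sum>x\<leftarrow>f j. g x)"
  by (induction k) (simp_all add: add.commute)

lemma sum_list_le: "(\<And>x. x \<in> set xs \<Longrightarrow> f x \<le> (c::nat)) \<Longrightarrow> (\<Sum>x\<leftarrow>xs. f x) \<le> length xs * c"
  by (induction xs) (auto intro: add_mono)

context euler_scheme
begin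

definition width :: nat where "width = m + dy"
definition hats :: nat where "hats = n + 1"

definition const :: "real \<Rightarrow> time_weight" where "const c = TW c 0 []"

lemma tw_val_const [simp]: "tw_val t (const c) = c" by (simp add: const_def)

lemma tw_cost_const: "tw_cost (const c) = (if c = 0 then 0 else 1)" by (simp add: const_def)

text \<open>One step of the scheme is carried out by three layers.  The ReLU layer has the neurons \<open>max 0 u\<close> and
  \<open>max 0 (- u)\<close> for every component \<open>u\<close> of the state, which is recovered as their difference, followed
  for every coordinate by the \<open>n + 1\<close> neurons from which its hats are built.\<close>
definition relu_layer :: layer where
  "relu_layer = ReLU
     (mat (2 * width + m * hats) width (\<lambda>(r, c).
        if r < width then const (if c = r then 1 else 0)
        else if r < 2 * width then const (if c = r - width then - 1 else 0)
        else const (if c = (r - 2 * width) div hats then 1 / H else 0)))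
     (vec (2 * width + m * hats) (\<lambda>r. const (if r < 2 * width then 0 else R / H - real ((r - 2 * width) mod hats))))"

text \<open>The monomials of hat \<open>i\<close>, if the ReLU neurons of its coordinate start at position \<open>q\<close>.\<close>
definition hat_terms :: "nat \<Rightarrow> nat \<Rightarrow> (time_weight \<times> nat set) list" where
  "hat_terms q i =
     (if i = 0 then [(const 1, {})] else [(const 1, {q + (i - 1)}), (const (- 1), {q + i})]) @
     (if i < n then [(const (- 1), {q + i}), (const 1, {q + Suc i})] else [])"

definition hat_layer :: layer where
  "hat_layer = Multilin (map (\<lambda>r.
     if r < width then [(const 1, {r}), (const (- 1), {width + r})]
     else hat_terms (2 * width + (r - width) div hats * hats) ((r - width) mod hats)) [0..<width + m * hats])"

definition time_ramp :: "nat \<Rightarrow> real \<Rightarrow> time_weight" where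
  "time_ramp k c = TW 0 0 [(c / h, grid_time k), (- (c / h), grid_time (Suc k))]"

text \<open>The parameter \<open>y j\<close> and the hats whose product is the tensor product hat of the cell \<open>\<iota>\<close>.\<close>
definition cell_vars :: "nat \<Rightarrow> nat list \<Rightarrow> nat set" where
  "cell_vars j \<iota> = insert (m + j) ((\<lambda>c. width + (c * hats + \<iota> ! c)) ` {..<m})"

definition update_terms :: "nat \<Rightarrow> nat \<Rightarrow> (time_weight \<times> nat set) list" where
  "update_terms k r = concat (map (\<lambda>j. map (\<lambda>\<iota>. (time_ramp k (p j * drift_incr k j r \<iota>), cell_vars j \<iota>))
     (cells n m)) [0..<dy])"

definition update_layer :: "nat \<Rightarrow> layer" where
  "update_layer k = Multilin (map (\<lambda>r. (const 1, {r}) # (if r < m then update_terms k r else [])) [0..<width])"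

definition euler_net :: dnn where
  "euler_net = DNN (concat (map (\<lambda>k. [relu_layer, hat_layer, update_layer k]) [0..<K]))
     (mat m width (\<lambda>(r, c). const (if r = c then 1 else 0)))"

lemma tw_val_time_ramp: "tw_val t (time_ramp k c) = \<tau> k t * c"
  by (simp add: time_ramp_def \<tau>_def diff_divide_distrib algebra_simps)

lemma hats_pos: "0 < hats" by (simp add: hats_def)

lemma hat_terms_vars: "i \<le> n \<Longrightarrow> (u, S) \<in> set (hat_terms q i) \<Longrightarrow> S \<subseteq> {q..q + n}"
  by (auto simp: hat_terms_def split: if_splits)

lemma hat_index_less: "c < m \<Longrightarrow> i \<le> n \<Longrightarrow> c * hats + i < m * hats"
  using flat_index_less [of c m i hats] by (simp add: hats_def)

lemma hat_index_div:
  assumes "i \<le> n"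
  shows "(c * hats + i) div hats = c" "(c * hats + i) mod hats = i" "i div hats = 0" "i mod hats = i"
proof -
  have "i < hats" using assms by (simp add: hats_def)
  then show "(c * hats + i) div hats = c" "(c * hats + i) mod hats = i" "i div hats = 0" "i mod hats = i" using hats_pos by simp_all
qed

lemma cells_nth_le: "\<iota> \<in> set (cells n m) \<Longrightarrow> c < m \<Longrightarrow> \<iota> ! c \<le> n"
  using subsetD [of "set \<iota>" "{..n}" "\<iota> ! c"] by (simp add: cells_set)

lemma euler_net_type: "dnn_type (m + dy) m euler_net"
proof -
  have relu: "layer_type width (2 * width + m * hats) relu_layer"
    by (simp add: relu_layer_def)
  have hat: "layer_type (2 * width + m * hats) (width + m * hats) hat_layer"
  proof -
    have "S \<subseteq> {..<2 * width + m * hats}"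
      if r: "\<not> r < width" "r < width + m * hats" and S: "(u, S) \<in> set (hat_terms (2 * width + (r - width) div hats * hats) ((r - width) mod hats))"
      for r u S
    proof -
      have "(r - width) div hats < m" using r hats_pos by (simp add: less_mult_imp_div_less)
      then have "(r - width) div hats * hats + n < m * hats" by (intro hat_index_less) auto
      moreover have "(r - width) mod hats \<le> n" using hats_pos by (simp add: hats_def less_Suc_eq_le [symmetric])
      ultimately show ?thesis using hat_terms_vars [OF _ S] by fastforce
    qed
    then show ?thesis unfolding hat_layer_def by (fastforce split: if_splits)
  qed
  have update: "layer_type (width + m * hats) width (update_layer k)" for k
    using hat_index_less cells_nth_le
    by (fastforce simp: update_layer_def update_terms_def cell_vars_def width_def split: if_splits)
  have "layers_type width (concat (map (\<lambda>k. [relu_layer, hat_layer, update_layer k]) [0..<K'])) width" for K'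
  proof (induction K')
    case (Suc K')
    have "layers_type width [relu_layer, hat_layer, update_layer K'] width"
      using relu hat update by auto
    from layers_type_append [OF Suc this] show ?case by simp
  qed simp
  then obtain ds where "length ds = length (hidden euler_net) + 1" "hd ds = width" "last ds = width"
    "\<forall>k<length (hidden euler_net). layer_type (ds ! k) (ds ! (k + 1)) (hidden euler_net ! k)"
    using layers_type_dims unfolding euler_net_def dnn.sel by metis
  then show ?thesis
    unfolding dnn_type_def by (intro exI [of _ ds]) (auto simp: euler_net_def width_def)
qed

lemma relu_layer_index:
  assumes "v \<in> carrier_vec width" "r < 2 * width + m * hats"
  shows "layer_eval t relu_layer v $ r = max 0
    (if r < width then v $ r else if r < 2 * width then - v $ (r - width)
     else v $ ((r - 2 * width) div hats) / H + (R / H - real ((r - 2 * width) mod hats)))"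
proof -
  have *: "(\<Sum>c<width. (if c = q then x else 0) * v $ c) = (if q < width then x * v $ q else 0)" for q x
    by (simp add: if_distrib [of "\<lambda>a. a * _"] cong: if_cong)
  have "(r - 2 * width) div hats < width" if "\<not> r < 2 * width"
  proof -
    have "(r - 2 * width) div hats < m" using that assms hats_pos by (simp add: less_mult_imp_div_less)
    then show ?thesis by (simp add: width_def)
  qed
  then show ?thesis
    using assms
    by (auto simp: relu_layer_def scalar_prod_def row_def atLeast0LessThan * )
qed

lemma hat_layer_low:
  assumes "v \<in> carrier_vec width" "r < width"
  shows "layer_eval t hat_layer (layer_eval t relu_layer v) $ r = v $ r"
  using assms by (simp add: hat_layer_def relu_layer_index vec_of_list_index)

lemma hat_layer_high:
  assumes "v \<in> carrier_vec width" "c < m" "i \<le> n"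
  shows "layer_eval t hat_layer (layer_eval t relu_layer v) $ (width + (c * hats + i)) = hat n i (cell_coords v ! c)"
proof -
  have ramp: "layer_eval t relu_layer v $ (2 * width + c * hats + i') = max 0 (cell_coords v ! c - real i')" if "i' \<le> n" for i'
    using assms that hat_index_less [of c i'] relu_layer_index [of v "2 * width + c * hats + i'" t]
    by (simp add: cell_coords_nth add_divide_distrib add.assoc hat_index_div)
  have "layer_eval t hat_layer (layer_eval t relu_layer v) $ (width + (c * hats + i))
      = (\<Sum>(u, S)\<leftarrow>hat_terms (2 * width + c * hats) i. tw_val t u * (\<Prod>q\<in>S. layer_eval t relu_layer v $ q))"
    using assms hat_index_less [of c i] by (simp add: hat_layer_def vec_of_list_index hat_index_div)
  also have "\<dots> = hat n i (cell_coords v ! c)"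
  proof (cases i)
    case 0
    then show ?thesis using ramp [of 0] ramp [of 1] n by (simp add: hat_terms_def hat_def ramp_def)
  next
    case (Suc i')
    then show ?thesis using ramp [of i'] ramp [of "Suc i'"] ramp [of "Suc (Suc i')"] assms
      by (simp add: hat_terms_def hat_def ramp_def)
  qed
  finally show ?thesis .
qed

lemma cell_vars_prod:
  assumes "\<iota> \<in> set (cells n m)" "j < dy"
  shows "(\<Prod>q\<in>cell_vars j \<iota>. f q) = f (m + j) * (\<Prod>c<m. f (width + (c * hats + \<iota> ! c)) :: real)"
    and "card (cell_vars j \<iota>) = m + 1"
proof -
  let ?g = "\<lambda>c. width + (c * hats + \<iota> ! c)"
  have inj: "inj_on ?g {..<m}"
  proof (rule inj_onI)
    fix c c' assume c: "c \<in> {..<m}" "c' \<in> {..<m}" "?g c = ?g c'"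
    then have "(c * hats + \<iota> ! c) div hats = (c' * hats + \<iota> ! c') div hats" by simp
    moreover have "\<iota> ! c < hats" "\<iota> ! c' < hats"
      using c cells_nth_le [OF assms(1)] by (auto simp: hats_def less_Suc_eq_le)
    ultimately show "c = c'" by simp
  qed
  have notin: "m + j \<notin> ?g ` {..<m}" using assms by (auto simp: width_def)
  show "(\<Prod>q\<in>cell_vars j \<iota>. f q) = f (m + j) * (\<Prod>c<m. f (?g c))"
    using notin by (simp add: cell_vars_def prod.reindex [OF inj])
  show "card (cell_vars j \<iota>) = m + 1"
    using notin by (simp add: cell_vars_def card_image [OF inj])
qed

lemma three_layers:
  assumes v: "v \<in> carrier_vec width"
  shows "layer_eval t (update_layer k) (layer_eval t hat_layer (layer_eval t relu_layer v)) = step k t v"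
    (is "?lhs = _")
proof (rule eq_vecI)
  let ?u = "layer_eval t hat_layer (layer_eval t relu_layer v)"
  show "dim_vec ?lhs = dim_vec (step k t v)" by (simp add: update_layer_def step_def update_def width_def)
  fix r assume "r < dim_vec (step k t v)"
  then have r: "r < width" by (simp add: step_def update_def width_def)
  have terms: "(\<Sum>(u, S)\<leftarrow>update_terms k r. tw_val t u * (\<Prod>q\<in>S. ?u $ q))
      = \<tau> k t * (\<Sum>j<dy. p j * (v $ (m + j) * drift k j r v))"
  proof -
    have "(\<Sum>\<iota>\<leftarrow>cells n m. \<tau> k t * (p j * drift_incr k j r \<iota>) * (\<Prod>q\<in>cell_vars j \<iota>. ?u $ q))
        = \<tau> k t * (p j * (v $ (m + j) * drift k j r v))" if j: "j < dy" for j
    proof -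
      have "(\<Sum>\<iota>\<leftarrow>cells n m. \<tau> k t * (p j * drift_incr k j r \<iota>) * (\<Prod>q\<in>cell_vars j \<iota>. ?u $ q))
          = (\<Sum>\<iota>\<leftarrow>cells n m. (\<tau> k t * p j * v $ (m + j)) *
              (drift_incr k j r \<iota> * (\<Prod>c<m. hat n (\<iota> ! c) (cell_coords v ! c))))"
      proof (intro arg_cong [where f = sum_list] map_cong refl)
        fix \<iota> assume \<iota>: "\<iota> \<in> set (cells n m)"
        have "(\<Prod>c<m. ?u $ (width + (c * hats + \<iota> ! c))) = (\<Prod>c<m. hat n (\<iota> ! c) (cell_coords v ! c))"
          using cells_nth_le [OF \<iota>] by (intro prod.cong refl hat_layer_high v) auto
        moreover have "?u $ (m + j) = v $ (m + j)" using j by (intro hat_layer_low v) (simp add: width_def)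
        ultimately show "\<tau> k t * (p j * drift_incr k j r \<iota>) * (\<Prod>q\<in>cell_vars j \<iota>. ?u $ q) =
            (\<tau> k t * p j * v $ (m + j)) * (drift_incr k j r \<iota> * (\<Prod>c<m. hat n (\<iota> ! c) (cell_coords v ! c)))"
          by (simp add: cell_vars_prod(1) [OF \<iota> j])
      qed
      then show ?thesis
        unfolding sum_list_const_mult drift_def interp_expand cell_coords_length by (simp add: mult_ac)
    qed
    then show ?thesis
      unfolding update_terms_def sum_concat_upt
      by (simp add: o_def tw_val_time_ramp sum_distrib_left)
  qed
  show "?lhs $ r = step k t v $ r"
  proof (cases "r < m")
    case True
    then show ?thesis using r terms hat_layer_low [OF v r]
      by (simp add: update_layer_def vec_of_list_index step_low)
  next
    case False
    then show ?thesis using r hat_layer_low [OF v r]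
      by (simp add: update_layer_def vec_of_list_index step_high width_def)
  qed
qed

lemma euler_net_eval:
  assumes v: "v \<in> carrier_vec (m + dy)"
  shows "dnn_eval euler_net t v = vec m (\<lambda>i. state K t v $ i)"
proof -
  have "fold (layer_eval t) (concat (map (\<lambda>k. [relu_layer, hat_layer, update_layer k]) [0..<K'])) v = state K' t v" for K'
    by (induction K') (use v in \<open>simp_all add: three_layers state_carrier width_def\<close>)
  then have "dnn_eval euler_net t v = map_mat (tw_val t) (mat m width (\<lambda>(r, c). const (if r = c then 1 else 0))) *\<^sub>v state K t v"
    by (simp add: dnn_eval_def euler_net_def)
  also have "\<dots> = vec m (\<lambda>i. state K t v $ i)"
  proof (rule eq_vecI)
    fix i assume "i < dim_vec (vec m (\<lambda>i. state K t v $ i))"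
    then have "i < m" "i < width" by (simp_all add: width_def)
    then show "(map_mat (tw_val t) (mat m width (\<lambda>(r, c). const (if r = c then 1 else 0))) *\<^sub>v state K t v) $ i
        = vec m (\<lambda>i. state K t v $ i) $ i"
      using state_carrier [OF v, of K t]
      by (simp add: scalar_prod_def width_def if_distrib [of "\<lambda>a. a * _"] cong: if_cong)
  qed simp
  finally show ?thesis .
qed

lemma relu_cost: "layer_cost relu_layer \<le> 2 * (2 * width + m * hats)"
proof -
  have "(\<Sum>c<width. tw_cost (const (if c = q then x else 0))) \<le> 1" for q x
  proof -
    have "(\<Sum>c<width. tw_cost (const (if c = q then x else 0))) \<le> (\<Sum>c<width. if c = q then 1 else 0)"
      by (intro sum_mono) (simp add: tw_cost_const)
    also have "\<dots> \<le> 1" by simp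
    finally show ?thesis .
  qed
  then have row: "(\<Sum>c<width. tw_cost (if r < width then const (if c = r then 1 else 0)
        else if r < 2 * width then const (if c = r - width then - 1 else 0)
        else const (if c = (r - 2 * width) div hats then 1 / H else 0))) \<le> 1" for r
    by (cases "r < width"; cases "r < 2 * width") simp_all
  have "(\<Sum>r<2 * width + m * hats. \<Sum>c<width. tw_cost (if r < width then const (if c = r then 1 else 0)
        else if r < 2 * width then const (if c = r - width then - 1 else 0)
        else const (if c = (r - 2 * width) div hats then 1 / H else 0))) \<le> 2 * width + m * hats"
    by (rule order_trans [OF sum_mono [OF row]]) simp
  moreover have "(\<Sum>r<2 * width + m * hats. tw_cost (const (if r < 2 * width then 0 else R / H - real ((r - 2 * width) mod hats))))
      \<le> (\<Sum>r<2 * width + m * hats. 1)"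
    by (intro sum_mono) (simp add: tw_cost_const)
  ultimately show ?thesis by (simp add: relu_layer_def mat_cost_def)
qed

lemma hat_cost: "layer_cost hat_layer \<le> 8 * (width + m * hats)"
proof -
  have "layer_cost hat_layer \<le> length [0..<width + m * hats] * 8"
    unfolding hat_layer_def layer_cost.simps map_map o_def
    by (rule sum_list_le) (simp add: hat_terms_def tw_cost_const)
  then show ?thesis by simp
qed

text \<open>Each monomial costs 3 for its time-dependent weight and \<open>m + 1\<close> for its variables.  The value is exact
  because it also serves as a lower bound when the complexity of the compositional representation is
  compared with the number of weights.\<close>
lemma update_cost: "layer_cost (update_layer k) = 2 * width + m * (dy * ((n + 1) ^ m * (m + 4)))"
proof -
  let ?c = "\<lambda>(u, S). if tw_cost u = 0 then 0 else tw_cost u + card (S :: nat set)"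
  have terms: "(\<Sum>x\<leftarrow>update_terms k r. ?c x) = dy * ((n + 1) ^ m * (m + 4))" for r
  proof -
    have "(\<Sum>\<iota>\<leftarrow>cells n m. ?c (time_ramp k (p j * drift_incr k j r \<iota>), cell_vars j \<iota>)) = (n + 1) ^ m * (m + 4)"
      if "j < dy" for j
    proof -
      have "(\<Sum>\<iota>\<leftarrow>cells n m. ?c (time_ramp k (p j * drift_incr k j r \<iota>), cell_vars j \<iota>)) = (\<Sum>\<iota>\<leftarrow>cells n m. m + 4)"
        using that by (intro arg_cong [where f = sum_list] map_cong refl)
          (simp add: time_ramp_def cell_vars_prod(2))
      then show ?thesis by (simp add: sum_list_triv length_cells)
    qed
    then show ?thesis unfolding update_terms_def sum_concat_upt by (simp add: o_def)
  qed
  have "layer_cost (update_layer k) = (\<Sum>r<width. 2 + (if r < m then dy * ((n + 1) ^ m * (m + 4)) else 0))"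
    unfolding update_layer_def layer_cost.simps map_map o_def interv_sum_list_conv_sum_set_nat set_upt
      atLeast0LessThan
    by (intro sum.cong refl) (simp add: terms tw_cost_const)
  also have "\<dots> = 2 * width + card ({..<width} \<inter> {r. r < m}) * (dy * ((n + 1) ^ m * (m + 4)))"
    unfolding sum.distrib by (simp add: sum.If_cases)
  also have "{..<width} \<inter> {r. r < m} = {..<m}" by (auto simp: width_def)
  finally show ?thesis by simp
qed

lemma output_cost: "mat_cost (output_layer euler_net) = m"
proof -
  have "(\<Sum>c<width. tw_cost (const (if r = c then 1 else 0))) = 1" if "r < m" for r
    using that by (simp add: tw_cost_const width_def if_distrib [of "\<lambda>x. if x = 0 then _ else _"] cong: if_cong)
  then show ?thesis by (simp add: euler_net_def mat_cost_def)
qed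

lemma num_weights_eq:
  "num_weights euler_net = K * (layer_cost relu_layer + layer_cost hat_layer + (2 * width + m * (dy * ((n + 1) ^ m * (m + 4))))) + m"
proof -
  have "num_weights euler_net = (\<Sum>L\<leftarrow>hidden euler_net. layer_cost L) + m"
    by (simp add: num_weights_def output_cost)
  also have "(\<Sum>L\<leftarrow>hidden euler_net. layer_cost L) = (\<Sum>k<K. layer_cost relu_layer + layer_cost hat_layer + layer_cost (update_layer k))"
    unfolding euler_net_def dnn.sel sum_concat_upt by (simp add: add.assoc)
  finally show ?thesis by (simp add: update_cost)
qed

lemma num_weights_le:
  "num_weights euler_net \<le> K * (dy * (n + 1) ^ m * (m\<^sup>2 + 28 * m + 14)) + m"
proof -
  let ?Q = "dy * (n + 1) ^ m"
  have "1 * (n + 1) ^ 1 \<le> ?Q" using m dy by (intro mult_mono power_increasing) auto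
  then have 1: "hats \<le> ?Q" by (simp add: hats_def)
  have 2: "dy \<le> ?Q" "1 \<le> ?Q" using dy by auto
  have 3: "width \<le> m * ?Q + ?Q" using 2 m unfolding width_def by (intro add_mono) (auto simp: dy)
  have 4: "m * hats \<le> m * ?Q" using 1 by (intro mult_left_mono) auto
  have "layer_cost relu_layer + layer_cost hat_layer + (2 * width + m * (dy * ((n + 1) ^ m * (m + 4))))
      \<le> 14 * width + 10 * (m * hats) + m * (m + 4) * ?Q"
    using relu_cost hat_cost by (simp add: algebra_simps)
  also have "\<dots> \<le> 14 * (m * ?Q + ?Q) + 10 * (m * ?Q) + m * (m + 4) * ?Q"
    by (intro add_mono mult_le_mono2 3 4 order_refl)
  also have "\<dots> = ?Q * (m\<^sup>2 + 28 * m + 14)" by (simp add: algebra_simps power2_eq_square)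
  finally show ?thesis unfolding num_weights_eq by (intro add_mono mult_left_mono) auto
qed

end

section \<open>Regularity of the scheme\<close>

lemma max_norm_le_iff: "max_norm v \<le> e \<longleftrightarrow> 0 \<le> e \<and> (\<forall>i<dim_vec v. \<bar>v $ i\<bar> \<le> e)"
  unfolding max_norm_def by (subst Max_le_iff) auto

lemma max_norm_nonneg: "0 \<le> max_norm v"
  using max_norm_le_iff [of v "max_norm v"] by simp

lemma component_le_max_norm: "i < dim_vec v \<Longrightarrow> \<bar>v $ i\<bar> \<le> max_norm v"
  using max_norm_le_iff [of v "max_norm v"] by simp

lemma linf_norm_le: "(\<And>x. x \<in> D \<Longrightarrow> max_norm (g x) \<le> c) \<Longrightarrow> linf_norm D g \<le> ennreal c"
  unfolding linf_norm_def by (intro SUP_least ennreal_leI)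

text \<open>Componentwise bounds are easier to propagate through the layers than quotients of norms.\<close>
lemma lip_seminorm_le:
  assumes "0 \<le> c" "D \<subseteq> carrier_vec d" "\<And>x. x \<in> D \<Longrightarrow> g x \<in> carrier_vec d'"
    and "\<And>x x' e r. x \<in> D \<Longrightarrow> x' \<in> D \<Longrightarrow> 0 \<le> e \<Longrightarrow> (\<And>i. i < d \<Longrightarrow> \<bar>x $ i - x' $ i\<bar> \<le> e) \<Longrightarrow> r < d'
      \<Longrightarrow> \<bar>g x $ r - g x' $ r\<bar> \<le> c * e"
  shows "lip_seminorm D g \<le> ennreal c"
  unfolding lip_seminorm_def
proof (rule SUP_least, clarify, rule ennreal_leI)
  fix x x' assume x: "x \<in> D" "x' \<in> D"
  then have dims: "dim_vec x = d" "dim_vec x' = d" using assms(2) by auto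
  have "max_norm (g x - g x') \<le> c * max_norm (x - x')"
    unfolding max_norm_le_iff
  proof (intro conjI allI impI)
    show "0 \<le> c * max_norm (x - x')" using assms(1) max_norm_nonneg by simp
    fix r assume "r < dim_vec (g x - g x')"
    then have r: "r < d'" using assms(3) [OF x(2)] by simp
    have "\<bar>g x $ r - g x' $ r\<bar> \<le> c * max_norm (x - x')"
    proof (rule assms(4) [OF x max_norm_nonneg _ r])
      fix i assume "i < d"
      then show "\<bar>x $ i - x' $ i\<bar> \<le> max_norm (x - x')"
        using component_le_max_norm [of i "x - x'"] dims by simp
    qed
    then show "\<bar>(g x - g x') $ r\<bar> \<le> c * max_norm (x - x')"
      using r assms(3) [OF x(2)] by simp
  qed
  then show "max_norm (g x - g x') / max_norm (x - x') \<le> c"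
    using max_norm_nonneg [of "x - x'"] assms(1) by (cases "max_norm (x - x') = 0") (auto simp: divide_le_eq)
qed

lemma num_vars_le:
  assumes "U \<subseteq> {..<d}"
    and "\<And>u u'. u \<in> X \<Longrightarrow> u' \<in> X \<Longrightarrow> (\<And>i. i \<in> U \<Longrightarrow> u $ i = u' $ i) \<Longrightarrow> f u = f u'"
  shows "num_vars X d f \<le> card U"
  unfolding num_vars_def
proof (rule card_mono)
  show "finite U" using assms(1) finite_subset by blast
  show "{i. i < d \<and> (\<exists>u\<in>X. \<exists>u'\<in>X. (\<forall>j<d. j \<noteq> i \<longrightarrow> u $ j = u' $ j) \<and> f u \<noteq> f u')} \<subseteq> U"
  proof clarify
    fix i u u'
    assume *: "u \<in> X" "u' \<in> X" "\<forall>j<d. j \<noteq> i \<longrightarrow> u $ j = u' $ j" "f u \<noteq> f u'"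
    show "i \<in> U"
    proof (rule ccontr)
      assume "i \<notin> U"
      then have "f u = f u'" using * assms(1) by (intro assms(2)) auto
      then show False using * by simp
    qed
  qed
qed

lemma reach_0 [simp]: "reach D gs 0 = D"
  by (auto simp: reach_def compose_def)

lemma reach_Suc: "q < length gs \<Longrightarrow> reach D gs (Suc q) = (gs ! q) ` reach D gs q"
  by (auto simp: reach_def compose_def take_Suc_conv_app_nth)

lemma compose_drop: "q < length gs \<Longrightarrow> compose (drop q gs) v = compose (drop (Suc q) gs) ((gs ! q) v)"
  by (simp add: compose_def Cons_nth_drop_Suc [symmetric])

lemma sum_lessThan_add: "(\<Sum>i<a + b. f i) = (\<Sum>i<a. f i) + (\<Sum>i<b. f (a + i))"
  for f :: "nat \<Rightarrow> 'a::comm_monoid_add"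
  by (induction b) (simp_all add: add.assoc)

lemma sum_even_odd: "(\<Sum>q<2 * k. f q) = (\<Sum>i<k. f (2 * i) + f (2 * i + 1))"
  for f :: "nat \<Rightarrow> 'a::comm_monoid_add"
  by (induction k) (simp_all add: add.assoc)

context euler_scheme
begin

text \<open>The vectors on which the two halves of a step are evaluated.  The coordinates \<open>x\<close> are not
  restricted, so that Lipschitz bounds on these sets are global in space.\<close>
definition states :: "real vec set" where
  "states = {v \<in> carrier_vec (m + dy). \<forall>j<dy. \<bar>v $ (m + j)\<bar> \<le> 1}"
definition expanded_states :: "real vec set" where
  "expanded_states = {v \<in> carrier_vec (m + dy + dy * m). (\<forall>j<dy. \<bar>v $ (m + j)\<bar> \<le> 1) \<and>
     (\<forall>j<dy. \<forall>i<m. \<bar>v $ (m + dy + (j * m + i))\<bar> \<le> A * h)}"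

definition out :: "real vec \<Rightarrow> real vec" where
  "out v = mat m (m + dy) (\<lambda>(r, c). if r = c then 1 else 0) *\<^sub>v v"

text \<open>The representation at a fixed time: \<open>expand\<close> and \<open>update\<close> alternate, and a linear map drops the
  parameters at the end.  It has far fewer intermediate variables than the network, since the hats are
  hidden inside \<open>expand\<close>.\<close>
definition factors :: "real \<Rightarrow> (real vec \<Rightarrow> real vec) list" where
  "factors t = map (\<lambda>q. if q = 2 * K then out
     else if even q then expand (q div 2) else update (q div 2) t) [0..<2 * K + 1]"

definition dims :: "nat list" where
  "dims = map (\<lambda>q. if q = 2 * K + 1 then m else if even q then m + dy else m + dy + dy * m) [0..<2 * K + 2]"

lemma length_factors [simp]: "length (factors t) = 2 * K + 1" by (simp add: factors_def)
lemma length_dims [simp]: "length dims = 2 * K + 2" by (simp add: dims_def)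
lemma factors_even: "k < K \<Longrightarrow> factors t ! (2 * k) = expand k"
  by (simp add: factors_def del: upt_Suc)
lemma factors_odd: "k < K \<Longrightarrow> factors t ! Suc (2 * k) = update k t"
  unfolding factors_def by (subst nth_map) (auto simp del: upt_Suc)
lemma factors_last: "factors t ! (2 * K) = out"
  by (simp add: factors_def del: upt_Suc)
lemma dims_even: "k \<le> K \<Longrightarrow> dims ! (2 * k) = m + dy"
  unfolding dims_def by (subst nth_map) (auto simp del: upt_Suc)
lemma dims_odd: "k < K \<Longrightarrow> dims ! Suc (2 * k) = m + dy + dy * m"
  unfolding dims_def by (subst nth_map) (auto simp del: upt_Suc)
lemma dims_last: "dims ! Suc (2 * K) = m"
  unfolding dims_def by (subst nth_map) (auto simp del: upt_Suc)

lemma out_carrier [simp]: "out v \<in> carrier_vec m" by (rule carrier_vecI) (simp add: out_def)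

lemma out_index: "v \<in> carrier_vec (m + dy) \<Longrightarrow> i < m \<Longrightarrow> out v $ i = v $ i"
  by (simp add: out_def scalar_prod_def if_distrib [of "\<lambda>a. a * _"] cong: if_cong)

lemma factor_cases:
  assumes "q < 2 * K + 1"
  obtains (even) k where "k < K" "q = 2 * k" | (odd) k where "k < K" "q = Suc (2 * k)" | (last) "q = 2 * K"
proof (cases "q = 2 * K")
  case False
  then have q: "q < 2 * K" using assms by simp
  show ?thesis
  proof (cases "even q")
    case True
    then have "q = 2 * (q div 2)" by simp
    then show ?thesis using q by (intro that(1) [of "q div 2"]) linarith+
  next
    case False
    then have "q = Suc (2 * (q div 2))" by simp
    then show ?thesis using q by (intro that(2) [of "q div 2"]) linarith+
  qed
qed (rule that(3))

lemma expand_in_S1: "k < K \<Longrightarrow> v \<in> states \<Longrightarrow> expand k v \<in> expanded_states"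
  by (auto simp: states_def expanded_states_def drift_bound)

lemma update_high: "m \<le> r \<Longrightarrow> r < m + dy \<Longrightarrow> update k t v $ r = v $ r"
  by (simp add: update_def)

lemma update_in_S0: "v \<in> expanded_states \<Longrightarrow> update k t v \<in> states"
  by (auto simp: states_def expanded_states_def update_high)

lemma step_in_S0: "k < K \<Longrightarrow> v \<in> states \<Longrightarrow> step k t v \<in> states"
  unfolding step_def by (intro update_in_S0 expand_in_S1)

lemma state_in_S0: "k \<le> K \<Longrightarrow> v \<in> states \<Longrightarrow> state k t v \<in> states"
  by (induction k) (auto intro: step_in_S0)

lemma expand_lipschitz:
  assumes "k < K" "\<And>r. r < m + dy \<Longrightarrow> \<bar>v $ r - v' $ r\<bar> \<le> e" "0 \<le> e" "r < m + dy + dy * m"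
  shows "\<bar>expand k v $ r - expand k v' $ r\<bar> \<le> max 1 (real m * l * h) * e"
proof (cases "r < m + dy")
  case True
  then have "\<bar>expand k v $ r - expand k v' $ r\<bar> \<le> 1 * e" using assms(2) by simp
  also have "\<dots> \<le> max 1 (real m * l * h) * e" using assms(3) by (intro mult_right_mono) auto
  finally show ?thesis .
next
  case False
  then have "(r - (m + dy)) div m < dy" "(r - (m + dy)) mod m < m"
    using assms(4) m by (auto simp: less_mult_imp_div_less)
  then have "\<bar>expand k v $ r - expand k v' $ r\<bar> \<le> (real m * l * h) * e"
    using False assms drift_lipschitz [of k "(r - (m + dy)) div m" "(r - (m + dy)) mod m" v v' e]
    by (simp add: expand_def)
  also have "\<dots> \<le> max 1 (real m * l * h) * e" using assms(3) by (intro mult_right_mono) auto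
  finally show ?thesis .
qed

lemma update_lipschitz:
  assumes "v \<in> expanded_states" "v' \<in> expanded_states" "r < m"
    and "\<bar>v $ r - v' $ r\<bar> \<le> e1"
    and "\<And>j. j < dy \<Longrightarrow> \<bar>v $ (m + j) - v' $ (m + j)\<bar> \<le> e2"
    and "\<And>j. j < dy \<Longrightarrow> \<bar>v $ (m + dy + (j * m + r)) - v' $ (m + dy + (j * m + r))\<bar> \<le> e3"
  shows "\<bar>update k t v $ r - update k t v' $ r\<bar> \<le> e1 + A * h * e2 + e3"
proof -
  let ?s = "\<lambda>v. \<Sum>j<dy. p j * (v $ (m + j) * v $ (m + dy + (j * m + r)))"
  have "\<bar>\<Sum>j<dy. p j * (v $ (m + j) * v $ (m + dy + (j * m + r)) - v' $ (m + j) * v' $ (m + dy + (j * m + r)))\<bar>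
      \<le> A * h * e2 + e3"
  proof (rule convex_bound)
    fix j assume j: "j < dy"
    let ?y = "v $ (m + j)" and ?y' = "v' $ (m + j)"
    let ?q = "v $ (m + dy + (j * m + r))" and ?q' = "v' $ (m + dy + (j * m + r))"
    have "\<bar>?y * ?q - ?y' * ?q'\<bar> = \<bar>?q * (?y - ?y') + ?y' * (?q - ?q')\<bar>"
      by (simp add: algebra_simps)
    also have "\<dots> \<le> \<bar>?q\<bar> * \<bar>?y - ?y'\<bar> + \<bar>?y'\<bar> * \<bar>?q - ?q'\<bar>"
      by (rule order_trans [OF abs_triangle_ineq]) (simp add: abs_mult)
    also have "\<dots> \<le> (A * h) * e2 + 1 * e3"
      using assms j A h_nonneg by (intro add_mono mult_mono) (auto simp: expanded_states_def)
    finally show "\<bar>?y * ?q - ?y' * ?q'\<bar> \<le> A * h * e2 + e3" by simp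
  qed
  then have "\<bar>?s v - ?s v'\<bar> \<le> A * h * e2 + e3"
    by (simp add: right_diff_distrib sum_subtractf)
  moreover define D where "D = \<tau> k t * (?s v - ?s v')"
  ultimately have "\<bar>D\<bar> \<le> 1 * (A * h * e2 + e3)"
    using \<tau>_range [of k t] unfolding D_def abs_mult by (intro mult_mono) auto
  moreover have "update k t v $ r - update k t v' $ r = (v $ r - v' $ r) + D"
    using assms(3) by (simp add: D_def update_def right_diff_distrib)
  moreover have "\<bar>v $ r - v' $ r + D\<bar> \<le> \<bar>v $ r - v' $ r\<bar> + \<bar>D\<bar>" by (rule abs_triangle_ineq)
  ultimately show ?thesis using assms(4) by simp
qed

lemma step_lipschitz:
  assumes "k < K" "v \<in> states" "v' \<in> states" "r < m"
    and e1: "\<And>i. i < m \<Longrightarrow> \<bar>v $ i - v' $ i\<bar> \<le> e1"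
    and e2: "\<And>j. j < dy \<Longrightarrow> \<bar>v $ (m + j) - v' $ (m + j)\<bar> \<le> e2"
  shows "\<bar>step k t v $ r - step k t v' $ r\<bar> \<le> (1 + real m * l * h) * e1 + A * h * e2"
proof -
  have "\<bar>step k t v $ r - step k t v' $ r\<bar> \<le> e1 + A * h * e2 + real m * l * h * e1"
    unfolding step_def using assms drift_lipschitz [OF assms(1) _ assms(4) e1]
    by (intro update_lipschitz expand_in_S1) auto
  then show ?thesis by (simp add: algebra_simps)
qed

text \<open>The last \<open>q\<close> steps.  A perturbation of the position is amplified by \<open>1 + m * l * h\<close> per step.  One of
  the parameters, which stays constant, enters anew in every step with weight \<open>A * h\<close>; the recursion is
  closed by bounding all its amplifications by the largest one.\<close>
lemma tail_even:
  assumes "q \<le> K" "v \<in> states" "v' \<in> states" "r < m"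
    and "\<And>i. i < m \<Longrightarrow> \<bar>v $ i - v' $ i\<bar> \<le> e1"
    and "\<And>j. j < dy \<Longrightarrow> \<bar>v $ (m + j) - v' $ (m + j)\<bar> \<le> e2" "0 \<le> e1" "0 \<le> e2"
  shows "\<bar>compose (drop (2 * (K - q)) (factors t)) v $ r - compose (drop (2 * (K - q)) (factors t)) v' $ r\<bar>
     \<le> (1 + real m * l * h) ^ q * (e1 + real q * (A * h) * e2)"
  using assms
proof (induction q arbitrary: v v' e1)
  case 0
  then have "v \<in> carrier_vec (m + dy)" "v' \<in> carrier_vec (m + dy)" by (auto simp: states_def)
  moreover have "drop (2 * K) (factors t) = [out]"
    using Cons_nth_drop_Suc [of "2 * K" "factors t"] by (simp add: factors_last)
  ultimately show ?case using 0 by (simp add: compose_def out_index)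
next
  case (Suc q)
  let ?k = "K - Suc q" and ?c = "1 + real m * l * h"
  have k: "?k < K" and kq: "K - q = Suc ?k" using Suc.prems by auto
  have drop_eq: "compose (drop (2 * ?k) (factors t)) u = compose (drop (2 * (K - q)) (factors t)) (step ?k t u)" for u
    using k compose_drop [of "2 * ?k" "factors t"] compose_drop [of "Suc (2 * ?k)" "factors t"]
    by (simp add: kq factors_even factors_odd step_def)
  have c: "1 \<le> ?c" using l h_nonneg by simp
  have "\<bar>compose (drop (2 * (K - q)) (factors t)) (step ?k t v) $ r - compose (drop (2 * (K - q)) (factors t)) (step ?k t v') $ r\<bar>
      \<le> ?c ^ q * ((?c * e1 + A * h * e2) + real q * (A * h) * e2)"
    using Suc.prems k l A h_nonneg
    by (intro Suc.IH step_in_S0 step_lipschitz) (auto simp: step_high)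
  also have "\<dots> \<le> ?c ^ q * (?c * (e1 + A * h * e2) + ?c * (real q * (A * h) * e2))"
  proof -
    have "1 * (A * h * e2) \<le> ?c * (A * h * e2)" "1 * (real q * (A * h) * e2) \<le> ?c * (real q * (A * h) * e2)"
      using c A h_nonneg Suc.prems by (intro mult_right_mono; simp)+
    then show ?thesis using c by (intro mult_left_mono) (auto simp: algebra_simps)
  qed
  also have "\<dots> = ?c ^ Suc q * (e1 + real (Suc q) * (A * h) * e2)"
    by (simp add: algebra_simps)
  finally show ?case unfolding drop_eq .
qed

lemma steps_time_le: "real q * h \<le> T" if "q \<le> K"
  using grid_time_le_T [OF that] by (simp add: grid_time_def)

lemma compose_take: "k \<le> K \<Longrightarrow> compose (take (2 * k) (factors t)) v = state k t v"
proof (induction k)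
  case (Suc k)
  then have "take (2 * Suc k) (factors t) = take (2 * k) (factors t) @ [expand k, update k t]"
    by (simp add: take_Suc_conv_app_nth factors_even factors_odd)
  then show ?case using Suc by (simp add: compose_def step_def)
qed (simp add: compose_def)

lemma compose_factors:
  assumes "v \<in> carrier_vec (m + dy)"
  shows "compose (factors t) v = dnn_eval euler_net t v"
proof -
  have split: "factors t = take (2 * K) (factors t) @ [out]"
    using take_Suc_conv_app_nth [of "2 * K" "factors t"] by (simp add: factors_last)
  have "compose (factors t) v = compose (take (2 * K) (factors t) @ [out]) v"
    by (rule arg_cong [OF split])
  also have "\<dots> = out (compose (take (2 * K) (factors t)) v)"
    by (simp add: compose_def)
  also have "\<dots> = out (state K t v)" by (simp add: compose_take)
  also have "\<dots> = dnn_eval euler_net t v"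
    using assms state_carrier [OF assms, of K t]
    by (intro eq_vecI) (auto simp: euler_net_eval out_index carrier_vecD [OF out_carrier])
  finally show ?thesis .
qed

lemma euler_net_continuous: "max_norm_continuous_on states (dnn_eval euler_net t)"
  unfolding max_norm_continuous_on_def
proof (intro ballI allI impI)
  fix v and e :: real assume v: "v \<in> states" and e: "0 < e"
  define c where "c = (1 + real m * l * h) ^ K * (1 + real K * (A * h))"
  have "0 < (1 + real m * l * h) ^ K" "0 < 1 + real K * (A * h)"
    using l h_nonneg A by (auto intro!: zero_less_power add_pos_nonneg)
  then have c: "0 < c" by (simp add: c_def)
  have "max_norm (dnn_eval euler_net t v' - dnn_eval euler_net t v) < e" if v': "v' \<in> states" and d: "max_norm (v' - v) < e / (2 * c)" for v'
  proof -
    have carr: "v \<in> carrier_vec (m + dy)" "v' \<in> carrier_vec (m + dy)" using v v' by (auto simp: states_def)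
    have comp: "\<bar>v' $ i - v $ i\<bar> \<le> max_norm (v' - v)" if "i < m + dy" for i
      using component_le_max_norm [of i "v' - v"] carr that by simp
    have "max_norm (dnn_eval euler_net t v' - dnn_eval euler_net t v) \<le> c * max_norm (v' - v)"
      unfolding max_norm_le_iff
    proof (intro conjI allI impI)
      show "0 \<le> c * max_norm (v' - v)" using c max_norm_nonneg [of "v' - v"] by simp
      fix r assume "r < dim_vec (dnn_eval euler_net t v' - dnn_eval euler_net t v)"
      then have r: "r < m" using carr by (simp add: euler_net_eval)
      have "\<bar>compose (factors t) v' $ r - compose (factors t) v $ r\<bar>
          \<le> (1 + real m * l * h) ^ K * (max_norm (v' - v) + real K * (A * h) * max_norm (v' - v))"
        using tail_even [of K v' v r "max_norm (v' - v)" "max_norm (v' - v)" t] v v' r comp max_norm_nonneg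
        by simp
      then show "\<bar>(dnn_eval euler_net t v' - dnn_eval euler_net t v) $ r\<bar> \<le> c * max_norm (v' - v)"
        using r carr by (simp add: compose_factors euler_net_eval c_def algebra_simps)
    qed
    also have "\<dots> \<le> c * (e / (2 * c))" using d c by (intro mult_left_mono) auto
    also have "\<dots> < e" using c e by simp
    finally show ?thesis .
  qed
  then show "\<exists>d>0. \<forall>w'\<in>states. max_norm (w' - v) < d \<longrightarrow> max_norm (dnn_eval euler_net t w' - dnn_eval euler_net t v) < e"
    using c e by (intro exI [of _ "e / (2 * c)"]) auto
qed

text \<open>Time enters only through the factors \<open>\<tau>\<close>, whose slope is \<open>1 / h\<close>, while the increments that they
  multiply are at most \<open>A * h\<close>; earlier differences are amplified as in \<open>step_lipschitz\<close>.\<close>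
lemma state_time_lipschitz:
  "k \<le> K \<Longrightarrow> \<exists>M\<ge>0. \<forall>s t. \<forall>v\<in>states. \<forall>i<m. \<bar>state k s v $ i - state k t v $ i\<bar> \<le> M * \<bar>s - t\<bar>"
proof (induction k)
  case (Suc k)
  from Suc.IH [OF Suc_leD [OF Suc.prems]] obtain M where M: "0 \<le> M"
    "\<And>s t v i. v \<in> states \<Longrightarrow> i < m \<Longrightarrow> \<bar>state k s v $ i - state k t v $ i\<bar> \<le> M * \<bar>s - t\<bar>"
    by blast
  have kK: "k < K" using Suc.prems by simp
  have h: "0 < h" using kK h_pos by simp
  show ?case
  proof (intro exI conjI allI ballI impI)
    show "0 \<le> (1 + real m * l * h) * M + A" using M l h A by simp
    fix s t v i assume v: "v \<in> states" and i: "i < m"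
    let ?s = "state k s v" and ?t = "state k t v"
    let ?\<sigma> = "\<Sum>j<dy. p j * (?t $ (m + j) * drift k j i ?t)"
    have states: "?s \<in> states" "?t \<in> states" using kK v by (auto intro: state_in_S0)
    have \<sigma>: "\<bar>?\<sigma>\<bar> \<le> A * h"
    proof (rule convex_bound)
      fix j assume j: "j < dy"
      have "\<bar>?t $ (m + j)\<bar> * \<bar>drift k j i ?t\<bar> \<le> 1 * (A * h)"
        using states j i drift_bound [OF kK] by (intro mult_mono) (auto simp: states_def)
      then show "\<bar>?t $ (m + j) * drift k j i ?t\<bar> \<le> A * h" by (simp add: abs_mult)
    qed
    have "\<bar>step k s ?s $ i - step k s ?t $ i\<bar> \<le> (1 + real m * l * h) * (M * \<bar>s - t\<bar>) + A * h * 0"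
      using v i kK states M by (intro step_lipschitz) (auto simp: state_high)
    moreover have "\<bar>(\<tau> k s - \<tau> k t) * ?\<sigma>\<bar> \<le> (\<bar>s - t\<bar> / h) * (A * h)"
      unfolding abs_mult using \<sigma> \<tau>_lipschitz kK h by (intro mult_mono) auto
    moreover have "step k s ?t $ i - step k t ?t $ i = (\<tau> k s - \<tau> k t) * ?\<sigma>"
      using i by (simp add: step_low algebra_simps)
    moreover have "(\<bar>s - t\<bar> / h) * (A * h) = A * \<bar>s - t\<bar>" using h by simp
    ultimately have "\<bar>step k s ?s $ i - step k t ?t $ i\<bar> \<le> (1 + real m * l * h) * (M * \<bar>s - t\<bar>) + A * \<bar>s - t\<bar>"
      by linarith
    then show "\<bar>state (Suc k) s v $ i - state (Suc k) t v $ i\<bar> \<le> ((1 + real m * l * h) * M + A) * \<bar>s - t\<bar>"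
      by (simp add: algebra_simps)
  qed
qed auto

lemma euler_net_Lip1_in_time: "Lip1_in_time T states (dnn_eval euler_net)"
proof -
  obtain M where M: "0 \<le> M"
    "\<And>s t v i. v \<in> states \<Longrightarrow> i < m \<Longrightarrow> \<bar>state K s v $ i - state K t v $ i\<bar> \<le> M * \<bar>s - t\<bar>"
    using state_time_lipschitz [of K] by auto
  have "linf_norm states (\<lambda>v. dnn_eval euler_net s v - dnn_eval euler_net t v) \<le> ennreal (M * \<bar>s - t\<bar>)" for s t
    using M by (intro linf_norm_le) (auto simp: max_norm_le_iff euler_net_eval states_def)
  then show ?thesis unfolding Lip1_in_time_def using euler_net_continuous by blast
qed

end

section \<open>Stability of the compositional representation\<close>

lemma join_sets_cube:
  "join_sets X (cube d' 1) = {v \<in> carrier_vec (m + d'). vec_first v m \<in> X \<and> (\<forall>j<d'. \<bar>v $ (m + j)\<bar> \<le> 1)}"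
  if "X \<subseteq> carrier_vec m"
proof (intro equalityI subsetI)
  fix v assume "v \<in> join_sets X (cube d' 1)"
  then obtain x y where v: "v = x @\<^sub>v y" and x: "x \<in> X" and "y \<in> carrier_vec d'" "max_norm y \<le> 1"
    by (auto simp: join_sets_def cube_def)
  moreover have x_carrier: "x \<in> carrier_vec m" using x that by auto
  moreover have "vec_first v m = x"
    using x_carrier by (intro eq_vecI) (auto simp: v vec_first_def)
  ultimately show "v \<in> {v \<in> carrier_vec (m + d'). vec_first v m \<in> X \<and> (\<forall>j<d'. \<bar>v $ (m + j)\<bar> \<le> 1)}"
    by (auto simp: max_norm_le_iff)
next
  fix v assume "v \<in> {v \<in> carrier_vec (m + d'). vec_first v m \<in> X \<and> (\<forall>j<d'. \<bar>v $ (m + j)\<bar> \<le> 1)}"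
  then have v: "v \<in> carrier_vec (m + d')" "vec_first v m \<in> X" "\<And>j. j < d' \<Longrightarrow> \<bar>v $ (m + j)\<bar> \<le> 1" by auto
  have "vec_last v d' \<in> cube d' 1"
    using v by (simp add: cube_def max_norm_le_iff vec_last_def)
  moreover have "v = vec_first v m @\<^sub>v vec_last v d'" using v by simp
  ultimately show "v \<in> join_sets X (cube d' 1)" using v(2) by (auto simp: join_sets_def)
qed

context euler_scheme
begin

lemma states_eq: "join_sets (carrier_vec m) (cube dy 1) = states"
  by (subst join_sets_cube) (auto simp: states_def)

definition initial_states :: "real \<Rightarrow> real vec set" where
  "initial_states r = {v \<in> states. \<forall>i<m. \<bar>v $ i\<bar> \<le> r}"

lemma initial_states_eq: "0 \<le> r \<Longrightarrow> join_sets (cube m r) (cube dy 1) = initial_states r"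
  by (subst join_sets_cube) (auto simp: cube_def states_def initial_states_def max_norm_le_iff vec_first_def)

lemma states_parameter: "v \<in> states \<Longrightarrow> m \<le> i \<Longrightarrow> i < m + dy \<Longrightarrow> \<bar>v $ i\<bar> \<le> 1"
  by (auto simp: states_def dest!: le_Suc_ex)

lemma expanded_states_parameter: "v \<in> expanded_states \<Longrightarrow> m \<le> i \<Longrightarrow> i < m + dy \<Longrightarrow> \<bar>v $ i\<bar> \<le> 1"
  by (auto simp: expanded_states_def dest!: le_Suc_ex)

lemma update_abs_le: "v \<in> expanded_states \<Longrightarrow> r < m \<Longrightarrow> \<bar>update k t v $ r\<bar> \<le> \<bar>v $ r\<bar> + A * h"
proof -
  assume v: "v \<in> expanded_states" and r: "r < m"
  let ?s = "\<Sum>j<dy. p j * (v $ (m + j) * v $ (m + dy + (j * m + r)))"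
  have "\<bar>?s\<bar> \<le> A * h"
  proof (rule convex_bound)
    fix j assume "j < dy"
    then have "\<bar>v $ (m + j)\<bar> * \<bar>v $ (m + dy + (j * m + r))\<bar> \<le> 1 * (A * h)"
      using v r by (intro mult_mono) (auto simp: expanded_states_def)
    then show "\<bar>v $ (m + j) * v $ (m + dy + (j * m + r))\<bar> \<le> A * h" by (simp add: abs_mult)
  qed
  then have "\<bar>\<tau> k t * ?s\<bar> \<le> 1 * (A * h)"
    using \<tau>_range [of k t] unfolding abs_mult by (intro mult_mono) auto
  moreover have "\<bar>v $ r + \<tau> k t * ?s\<bar> \<le> \<bar>v $ r\<bar> + \<bar>\<tau> k t * ?s\<bar>" by (rule abs_triangle_ineq)
  ultimately show ?thesis using r by (simp add: update_def)
qed

lemma reach_even: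
  "k \<le> K \<Longrightarrow> v \<in> reach (initial_states r) (factors t) (2 * k) \<Longrightarrow> v \<in> states \<and> (\<forall>i<m. \<bar>v $ i\<bar> \<le> r + real k * (A * h))"
proof (induction k arbitrary: v)
  case 0
  then show ?case by (simp add: initial_states_def)
next
  case (Suc k)
  then obtain u where u: "u \<in> reach (initial_states r) (factors t) (2 * k)" and v: "v = update k t (expand k u)"
    by (auto simp: reach_Suc factors_even factors_odd)
  then have IH: "u \<in> states" "\<And>i. i < m \<Longrightarrow> \<bar>u $ i\<bar> \<le> r + real k * (A * h)"
    using Suc.IH [of u] Suc.prems by auto
  have expanded_states: "expand k u \<in> expanded_states" using IH Suc.prems by (intro expand_in_S1) auto
  have "\<bar>v $ i\<bar> \<le> r + real (Suc k) * (A * h)" if "i < m" for i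
    using update_abs_le [OF expanded_states that, of k t] IH(2) [OF that] that by (simp add: v algebra_simps)
  then show ?case using update_in_S0 [OF expanded_states] by (simp add: v)
qed

lemma reach_odd:
  assumes "k < K" "v \<in> reach (initial_states r) (factors t) (Suc (2 * k))"
  shows "v \<in> expanded_states \<and> (\<forall>i<m. \<bar>v $ i\<bar> \<le> r + real k * (A * h))"
proof -
  obtain u where u: "u \<in> reach (initial_states r) (factors t) (2 * k)" and v: "v = expand k u"
    using assms by (auto simp: reach_Suc factors_even)
  show ?thesis using reach_even [OF _ u] assms by (simp add: v expand_in_S1)
qed

lemma compose_drop_carrier: "q \<le> 2 * K \<Longrightarrow> compose (drop q (factors t)) v \<in> carrier_vec m"
proof -
  assume q: "q \<le> 2 * K"
  have split: "factors t = take (2 * K) (factors t) @ [out]"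
    using take_Suc_conv_app_nth [of "2 * K" "factors t"] by (simp add: factors_last)
  have "drop q (factors t) = drop q (take (2 * K) (factors t)) @ [out]"
    by (subst split, subst drop_append) (use q in simp)
  then show ?thesis by (simp add: compose_def)
qed

text \<open>The common bound of all norms and Lipschitz constants of the representation: \<open>exp (m * l * T)\<close>
  accounts for the amplification by all steps, and \<open>exp (A * T)\<close> for the linear growth in \<open>A * T\<close> of the
  positions and of the sensitivity to the parameters.\<close>
definition stability_const :: "real \<Rightarrow> real" where
  "stability_const r = (3 + r) * exp (A * T + real m * l * T)"

context
  fixes r :: real
  assumes r: "0 \<le> r"
begin

lemma stability_const_ge: "(2 + A * T + r) * exp (real m * l * T) \<le> stability_const r" "2 + A * T + r \<le> stability_const r"
proof -
  have AT: "0 \<le> A * T" using A T by simp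
  have "2 + A * T + r \<le> (3 + r) * (1 + A * T)"
  proof -
    have "(3 + r) * (1 + A * T) = (2 + A * T + r) + (1 + 2 * (A * T) + r * (A * T))"
      by (simp add: algebra_simps)
    moreover have "0 \<le> r * (A * T)" using r AT by (rule mult_nonneg_nonneg)
    ultimately show ?thesis using AT by linarith
  qed
  also have "\<dots> \<le> (3 + r) * exp (A * T)"
    using r by (intro mult_left_mono exp_ge_add_one_self) auto
  finally show 1: "(2 + A * T + r) * exp (real m * l * T) \<le> stability_const r"
    by (simp add: stability_const_def exp_add mult.assoc [symmetric])
  have "(2 + A * T + r) * 1 \<le> (2 + A * T + r) * exp (real m * l * T)"
    using l T AT r by (intro mult_left_mono) auto
  then show "2 + A * T + r \<le> stability_const r" using 1 by simp
qed

lemma h_le_T: "0 < K \<Longrightarrow> h \<le> T"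
  using steps_time_le [of 1] by simp

lemma Ah_le: "k \<le> K \<Longrightarrow> real k * (A * h) \<le> A * T"
  using mult_left_mono [OF steps_time_le [of k], of A] A by (simp add: mult_ac)

lemma Ah_le1: "0 < K \<Longrightarrow> A * h \<le> A * T"
  using Ah_le [of 1] by simp

lemma mlh_le: "0 < K \<Longrightarrow> max 1 (real m * l * h) \<le> stability_const r"
proof -
  assume "0 < K"
  then have "real m * l * h \<le> real m * l * T" using l h_le_T by (intro mult_left_mono) auto
  also have "\<dots> \<le> 1 * exp (real m * l * T)" using exp_ge_add_one_self [of "real m * l * T"] by linarith
  also have "\<dots> \<le> (2 + A * T + r) * exp (real m * l * T)"
    using A T r by (intro mult_right_mono) auto
  finally show ?thesis using stability_const_ge A T r by (smt (verit) mult_pos_pos)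
qed

lemma expand_bounds:
  assumes "k < K"
  shows "lip_norm (reach (initial_states r) (factors t) (2 * k)) (expand k) \<le> ennreal (stability_const r)"
  unfolding lip_norm_def
proof (rule max.boundedI)
  have reach: "v \<in> states" "i < m \<Longrightarrow> \<bar>v $ i\<bar> \<le> r + A * T" if "v \<in> reach (initial_states r) (factors t) (2 * k)" for v i
    using reach_even [OF _ that] Ah_le [of k] assms by fastforce+
  show "linf_norm (reach (initial_states r) (factors t) (2 * k)) (expand k) \<le> ennreal (stability_const r)"
  proof (rule linf_norm_le)
    fix v assume v: "v \<in> reach (initial_states r) (factors t) (2 * k)"
    show "max_norm (expand k v) \<le> stability_const r"
      unfolding max_norm_le_iff
    proof (intro conjI allI impI)
      show "0 \<le> stability_const r" using r by (simp add: stability_const_def)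
      fix i assume "i < dim_vec (expand k v)"
      then have i: "i < m + dy + dy * m" by (simp add: expand_def)
      consider "i < m" | "m \<le> i" "i < m + dy" | "m + dy \<le> i" by linarith
      then show "\<bar>expand k v $ i\<bar> \<le> stability_const r"
      proof cases
        case 1
        then show ?thesis using reach [OF v] stability_const_ge by fastforce
      next
        case 2
        then have "\<bar>v $ i\<bar> \<le> 1" using reach(1) [OF v] by (intro states_parameter) auto
        moreover have "1 \<le> stability_const r" using stability_const_ge(2) A T r by (smt (verit) mult_pos_pos)
        ultimately show ?thesis using 2 by simp
      next
        case 3
        then have "(i - (m + dy)) div m < dy" "(i - (m + dy)) mod m < m"
          using i m by (auto simp: less_mult_imp_div_less)
        then have "\<bar>expand k v $ i\<bar> \<le> A * h"
          using 3 i drift_bound [OF assms] by (simp add: expand_def)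
        then show ?thesis using stability_const_ge(2) Ah_le1 assms r by linarith
      qed
    qed
  qed
  show "lip_seminorm (reach (initial_states r) (factors t) (2 * k)) (expand k) \<le> ennreal (stability_const r)"
  proof (rule lip_seminorm_le [where d = "m + dy" and d' = "m + dy + dy * m"])
    show "reach (initial_states r) (factors t) (2 * k) \<subseteq> carrier_vec (m + dy)" using reach(1) by (auto simp: states_def)
    fix v v' e i
    assume *: "0 \<le> (e :: real)" "\<And>i. i < m + dy \<Longrightarrow> \<bar>v $ i - v' $ i\<bar> \<le> e" "i < m + dy + dy * m"
    have "\<bar>expand k v $ i - expand k v' $ i\<bar> \<le> max 1 (real m * l * h) * e"
      using * assms by (intro expand_lipschitz) auto
    also have "\<dots> \<le> stability_const r * e" using mlh_le assms * by (intro mult_right_mono) auto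
    finally show "\<bar>expand k v $ i - expand k v' $ i\<bar> \<le> stability_const r * e" .
  qed (use r in \<open>simp_all add: stability_const_def\<close>)
qed

lemma update_bounds:
  assumes "k < K"
  shows "lip_norm (reach (initial_states r) (factors t) (Suc (2 * k))) (update k t) \<le> ennreal (stability_const r)"
  unfolding lip_norm_def
proof (rule max.boundedI)
  have reach: "v \<in> expanded_states" "i < m \<Longrightarrow> \<bar>v $ i\<bar> \<le> r + real k * (A * h)" if "v \<in> reach (initial_states r) (factors t) (Suc (2 * k))" for v i
    using reach_odd [OF assms that] by auto
  show "linf_norm (reach (initial_states r) (factors t) (Suc (2 * k))) (update k t) \<le> ennreal (stability_const r)"
  proof (rule linf_norm_le)
    fix v assume v: "v \<in> reach (initial_states r) (factors t) (Suc (2 * k))"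
    show "max_norm (update k t v) \<le> stability_const r"
      unfolding max_norm_le_iff
    proof (intro conjI allI impI)
      show "0 \<le> stability_const r" using r by (simp add: stability_const_def)
      fix i assume "i < dim_vec (update k t v)"
      then have i: "i < m + dy" by (simp add: update_def)
      show "\<bar>update k t v $ i\<bar> \<le> stability_const r"
      proof (cases "i < m")
        case True
        have "\<bar>update k t v $ i\<bar> \<le> r + real (Suc k) * (A * h)"
          using update_abs_le [OF reach(1) [OF v] True, of k t] reach(2) [OF v True] by (simp add: algebra_simps)
        then show ?thesis using Ah_le [of "Suc k"] assms stability_const_ge(2) by linarith
      next
        case False
        then have "\<bar>v $ i\<bar> \<le> 1" using reach(1) [OF v] i by (intro expanded_states_parameter) auto
        moreover have "1 \<le> stability_const r" using stability_const_ge(2) A T r by (smt (verit) mult_pos_pos)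
        ultimately show ?thesis using False i by (simp add: update_high)
      qed
    qed
  qed
  show "lip_seminorm (reach (initial_states r) (factors t) (Suc (2 * k))) (update k t) \<le> ennreal (stability_const r)"
  proof (rule lip_seminorm_le [where d = "m + dy + dy * m" and d' = "m + dy"])
    show "reach (initial_states r) (factors t) (Suc (2 * k)) \<subseteq> carrier_vec (m + dy + dy * m)" using reach(1) by (auto simp: expanded_states_def)
    fix v v' e i
    assume *: "v \<in> reach (initial_states r) (factors t) (Suc (2 * k))" "v' \<in> reach (initial_states r) (factors t) (Suc (2 * k))"
      "0 \<le> (e :: real)" "\<And>i. i < m + dy + dy * m \<Longrightarrow> \<bar>v $ i - v' $ i\<bar> \<le> e" "i < m + dy"
    have "\<bar>update k t v $ i - update k t v' $ i\<bar> \<le> (2 + A * h) * e"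
    proof (cases "i < m")
      case True
      have "\<bar>update k t v $ i - update k t v' $ i\<bar> \<le> e + A * h * e + e"
        using * True reach(1) index_bound by (intro update_lipschitz) auto
      then show ?thesis by (simp add: algebra_simps)
    next
      case False
      have "1 * e \<le> (2 + A * h) * e" using * A h_nonneg by (intro mult_right_mono) auto
      then show ?thesis using *(4) [of i] *(5) False by (simp add: update_high)
    qed
    also have "\<dots> \<le> stability_const r * e" using * Ah_le1 assms stability_const_ge(2) r by (intro mult_right_mono) auto
    finally show "\<bar>update k t v $ i - update k t v' $ i\<bar> \<le> stability_const r * e" .
  qed (use r in \<open>simp_all add: stability_const_def\<close>)
qed

lemma out_bounds: "lip_norm (reach (initial_states r) (factors t) (2 * K)) out \<le> ennreal (stability_const r)"
  unfolding lip_norm_def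
proof (rule max.boundedI)
  have reach: "v \<in> carrier_vec (m + dy)" "i < m \<Longrightarrow> \<bar>v $ i\<bar> \<le> r + A * T"
    if "v \<in> reach (initial_states r) (factors t) (2 * K)" for v i
    using reach_even [OF _ that] Ah_le [of K] by (fastforce simp: states_def)+
  have stability_const: "0 \<le> stability_const r" "1 \<le> stability_const r" using stability_const_ge(2) A T r by (smt (verit) mult_pos_pos)+
  show "linf_norm (reach (initial_states r) (factors t) (2 * K)) out \<le> ennreal (stability_const r)"
    using reach stability_const stability_const_ge(2)
    by (intro linf_norm_le) (fastforce simp: max_norm_le_iff out_index carrier_vecD [OF out_carrier])
  show "lip_seminorm (reach (initial_states r) (factors t) (2 * K)) out \<le> ennreal (stability_const r)"
  proof (rule lip_seminorm_le [where d = "m + dy" and d' = m])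
    fix v v' e i
    assume *: "v \<in> reach (initial_states r) (factors t) (2 * K)" "v' \<in> reach (initial_states r) (factors t) (2 * K)"
      "0 \<le> (e :: real)" "\<And>i. i < m + dy \<Longrightarrow> \<bar>v $ i - v' $ i\<bar> \<le> e" "i < m"
    have "1 * e \<le> stability_const r * e" using * stability_const by (intro mult_right_mono) auto
    then show "\<bar>out v $ i - out v' $ i\<bar> \<le> stability_const r * e"
      using *(4) [of i] *(5) reach(1) [OF *(1)] reach(1) [OF *(2)] by (simp add: out_index)
  qed (use stability_const reach in auto)
qed

text \<open>The case \<open>c = 1\<close> is needed for tails that start in the middle of a step: the bilinear half on its own
  has the Lipschitz constant \<open>2 + A * h\<close>.\<close>
lemma stability_const_tail:
  assumes "q \<le> K" "0 \<le> e" and qc: "real q + c \<le> real K" "0 \<le> c"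
  shows "(1 + real m * l * h) ^ q * ((2 + A * h * c) * e + real q * (A * h) * e) \<le> stability_const r * e"
proof -
  have hk: "(real q + c) * h \<le> T"
  proof -
    have "(real q + c) * h \<le> real K * h" using qc h_nonneg by (intro mult_right_mono) auto
    also have "\<dots> \<le> T" by (rule steps_time_le) simp
    finally show ?thesis .
  qed
  have "A * ((real q + c) * h) \<le> A * T" using hk A by (intro mult_left_mono) auto
  then have "2 + A * h * c + real q * (A * h) \<le> 2 + A * T + r" using r by (simp add: algebra_simps)
  moreover have "(1 + real m * l * h) ^ q \<le> exp (real m * l * T)" using power_le_exp [of "real m" q] assms by simp
  ultimately have "(1 + real m * l * h) ^ q * (2 + A * h * c + real q * (A * h)) \<le> exp (real m * l * T) * (2 + A * T + r)"
    using A h_nonneg qc by (intro mult_mono) auto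
  also have "\<dots> \<le> stability_const r" using stability_const_ge(1) by (simp add: mult.commute)
  finally show ?thesis using mult_right_mono [OF _ assms(2)] by (fastforce simp: algebra_simps)
qed

lemma tail_lip_even:
  assumes "k \<le> K"
  shows "tail_lip (initial_states r) (factors t) (2 * k) \<le> ennreal (stability_const r)"
proof -
  have reach: "reach (initial_states r) (factors t) (2 * k) \<subseteq> states" using reach_even assms by blast
  have q: "2 * (K - (K - k)) = 2 * k" using assms by simp
  have "lip_seminorm (reach (initial_states r) (factors t) (2 * k)) (compose (drop (2 * k) (factors t))) \<le> ennreal (stability_const r)"
  proof (rule lip_seminorm_le [where d = "m + dy" and d' = m])
    fix v v' e i
    assume *: "v \<in> reach (initial_states r) (factors t) (2 * k)" "v' \<in> reach (initial_states r) (factors t) (2 * k)"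
      "0 \<le> (e :: real)" "\<And>i. i < m + dy \<Longrightarrow> \<bar>v $ i - v' $ i\<bar> \<le> e" "i < m"
    have "\<bar>compose (drop (2 * k) (factors t)) v $ i - compose (drop (2 * k) (factors t)) v' $ i\<bar>
        \<le> (1 + real m * l * h) ^ (K - k) * (e + real (K - k) * (A * h) * e)"
      using tail_even [of "K - k" v v' i e e t] * reach unfolding q by auto
    also have "\<dots> \<le> (1 + real m * l * h) ^ (K - k) * ((2 + A * h * 0) * e + real (K - k) * (A * h) * e)"
      using * l h_nonneg by (intro mult_left_mono) auto
    also have "\<dots> \<le> stability_const r * e" using * by (intro stability_const_tail) auto
    finally show "\<bar>compose (drop (2 * k) (factors t)) v $ i - compose (drop (2 * k) (factors t)) v' $ i\<bar> \<le> stability_const r * e" .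
  qed (use reach r assms compose_drop_carrier in \<open>auto simp: stability_const_def states_def\<close>)
  then show ?thesis using assms by (simp add: tail_lip_def)
qed

lemma tail_lip_odd:
  assumes "k < K"
  shows "tail_lip (initial_states r) (factors t) (Suc (2 * k)) \<le> ennreal (stability_const r)"
proof -
  have reach: "reach (initial_states r) (factors t) (Suc (2 * k)) \<subseteq> expanded_states" using reach_odd assms by blast
  define q where "q = K - Suc k"
  have q: "2 * (K - q) = Suc (Suc (2 * k))" "Suc q \<le> K" using assms by (simp_all add: q_def)
  have drop_eq: "compose (drop (Suc (2 * k)) (factors t)) v = compose (drop (2 * (K - q)) (factors t)) (update k t v)" for v
    using compose_drop [of "Suc (2 * k)" "factors t" v] assms by (simp add: q factors_odd)
  have "lip_seminorm (reach (initial_states r) (factors t) (Suc (2 * k))) (compose (drop (Suc (2 * k)) (factors t))) \<le> ennreal (stability_const r)"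
  proof (rule lip_seminorm_le [where d = "m + dy + dy * m" and d' = m])
    fix v v' e i
    assume *: "v \<in> reach (initial_states r) (factors t) (Suc (2 * k))" "v' \<in> reach (initial_states r) (factors t) (Suc (2 * k))"
      "0 \<le> (e :: real)" "\<And>i. i < m + dy + dy * m \<Longrightarrow> \<bar>v $ i - v' $ i\<bar> \<le> e" "i < m"
    have expanded_states: "v \<in> expanded_states" "v' \<in> expanded_states" using * reach by auto
    have "\<bar>compose (drop (2 * (K - q)) (factors t)) (update k t v) $ i - compose (drop (2 * (K - q)) (factors t)) (update k t v') $ i\<bar>
        \<le> (1 + real m * l * h) ^ q * ((e + A * h * e + e) + real q * (A * h) * e)"
      using expanded_states * q A h_nonneg index_bound
      by (intro tail_even update_in_S0 update_lipschitz) (auto simp: update_high)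
    also have "\<dots> = (1 + real m * l * h) ^ q * ((2 + A * h * 1) * e + real q * (A * h) * e)"
      by (simp add: algebra_simps)
    also have "\<dots> \<le> stability_const r * e" using * q by (intro stability_const_tail) auto
    finally show "\<bar>compose (drop (Suc (2 * k)) (factors t)) v $ i - compose (drop (Suc (2 * k)) (factors t)) v' $ i\<bar> \<le> stability_const r * e"
      unfolding drop_eq .
  qed (use reach r assms compose_drop_carrier in \<open>auto simp: stability_const_def expanded_states_def\<close>)
  then show ?thesis using assms by (simp add: tail_lip_def)
qed

lemma factor_bounds:
  assumes "q < 2 * K + 1"
  shows "lip_norm (reach (initial_states r) (factors t) q) (factors t ! q) \<le> ennreal (stability_const r)"
    and "tail_lip (initial_states r) (factors t) (q + 1) \<le> ennreal (stability_const r)"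
proof -
  have "1 \<le> stability_const r" using stability_const_ge(2) A T r by (smt (verit) mult_pos_pos)
  then have one: "1 \<le> ennreal (stability_const r)" by (simp add: ennreal_1 [symmetric] del: ennreal_1)
  show "lip_norm (reach (initial_states r) (factors t) q) (factors t ! q) \<le> ennreal (stability_const r)"
    using assms by (cases rule: factor_cases)
      (simp_all add: factors_even factors_odd factors_last expand_bounds update_bounds out_bounds)
  show "tail_lip (initial_states r) (factors t) (q + 1) \<le> ennreal (stability_const r)"
    using assms
  proof (cases rule: factor_cases)
    case (odd k)
    then show ?thesis using tail_lip_even [of "Suc k" t] by simp
  next
    case last
    then show ?thesis using one by (simp add: tail_lip_def)
  qed (simp add: tail_lip_odd)
qed

lemma rep_stability_le: "rep_stability (initial_states r) (factors t) \<le> ennreal (stability_const r)"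
  unfolding rep_stability_def using factor_bounds by (intro SUP_least) simp

end

end

section \<open>Sparsity of the compositional representation\<close>

context euler_scheme
begin

lemma expand_num_vars:
  assumes "i < m + dy + dy * m"
  shows "num_vars X (m + dy) (\<lambda>v. expand k v $ i) \<le> (if i < m + dy then 1 else m)"
proof (cases "i < m + dy")
  case True
  have "num_vars X (m + dy) (\<lambda>v. expand k v $ i) \<le> card {i}"
    using True by (intro num_vars_le) auto
  then show ?thesis using True by simp
next
  case False
  have "num_vars X (m + dy) (\<lambda>v. expand k v $ i) \<le> card {..<m}"
  proof (rule num_vars_le)
    fix u u' :: "real vec" assume "\<And>c. c \<in> {..<m} \<Longrightarrow> u $ c = u' $ c"
    then show "expand k u $ i = expand k u' $ i"
      using False assms by (auto simp: expand_def intro!: drift_cong)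
  qed auto
  then show ?thesis using False by simp
qed

lemma update_num_vars:
  assumes "i < m + dy"
  shows "num_vars X (m + dy + dy * m) (\<lambda>v. update k t v $ i) \<le> (if i < m then 1 + 2 * dy else 1)"
proof (cases "i < m")
  case True
  let ?U = "insert i ((\<lambda>j. m + j) ` {..<dy} \<union> (\<lambda>j. m + dy + (j * m + i)) ` {..<dy})"
  have "num_vars X (m + dy + dy * m) (\<lambda>v. update k t v $ i) \<le> card ?U"
  proof (rule num_vars_le)
    show "?U \<subseteq> {..<m + dy + dy * m}" using True index_bound by auto
    fix u u' :: "real vec" assume "\<And>c. c \<in> ?U \<Longrightarrow> u $ c = u' $ c"
    then show "update k t u $ i = update k t u' $ i"
      using True by (simp add: update_def)
  qed
  also have "\<dots> \<le> Suc (card ((\<lambda>j. m + j) ` {..<dy} \<union> (\<lambda>j. m + dy + (j * m + i)) ` {..<dy}))"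
    by (rule card_insert_le_m1) auto
  also have "\<dots> \<le> Suc (card {..<dy} + card {..<dy})"
    by (intro Suc_leI le_imp_less_Suc order_trans [OF card_Un_le] add_mono card_image_le) auto
  finally show ?thesis using True by simp
next
  case False
  have "num_vars X (m + dy + dy * m) (\<lambda>v. update k t v $ i) \<le> card {i}"
    using False assms by (intro num_vars_le) (auto simp: update_high)
  then show ?thesis using False by simp
qed

lemma out_num_vars:
  assumes "X \<subseteq> carrier_vec (m + dy)" "i < m"
  shows "num_vars X (m + dy) (\<lambda>v. out v $ i) \<le> 1"
proof -
  have "num_vars X (m + dy) (\<lambda>v. out v $ i) \<le> card {i}"
    using assms by (intro num_vars_le) (auto simp: out_index subset_iff)
  then show ?thesis by simp
qed

text \<open>The coefficients are nonzero for the singleton of the component itself and, for a position, for the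
  pairs of a parameter and the matching drift.\<close>
lemma update_multilinear: "multilinear_on X (m + dy + dy * m) (m + dy) (update k t)"
  unfolding multilinear_on_def
proof (intro allI impI)
  let ?width = "m + dy + dy * m"
  fix i assume i: "i < m + dy"
  let ?pair = "\<lambda>j. {m + j, m + dy + (j * m + i)}"
  let ?c = "\<lambda>S. (if S = {i} then 1 else 0) +
      (if i < m then \<Sum>j<dy. if S = ?pair j then \<tau> k t * p j else 0 else 0)"
  have fin: "finite (Pow {..<?width})" by simp
  have mono: "(\<Sum>S\<in>Pow {..<?width}. (if S = S' then x else 0) * (\<Prod>q\<in>S. v $ q)) = x * (\<Prod>q\<in>S'. v $ q)"
    if "S' \<subseteq> {..<?width}" for S' x and v :: "real vec"
    using that fin by (simp add: if_distrib [of "\<lambda>a. a * _"] cong: if_cong)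
  have "update k t v $ i = (\<Sum>S\<in>Pow {..<?width}. ?c S * (\<Prod>q\<in>S. v $ q))" for v
  proof (cases "i < m")
    case True
    have "(\<Sum>S\<in>Pow {..<?width}. ?c S * (\<Prod>q\<in>S. v $ q))
        = (\<Sum>S\<in>Pow {..<?width}. (if S = {i} then 1 else 0) * (\<Prod>q\<in>S. v $ q))
        + (\<Sum>S\<in>Pow {..<?width}. \<Sum>j<dy. (if S = ?pair j then \<tau> k t * p j else 0) * (\<Prod>q\<in>S. v $ q))"
      using True by (simp add: distrib_right sum.distrib sum_distrib_right)
    also have "(\<Sum>S\<in>Pow {..<?width}. \<Sum>j<dy. (if S = ?pair j then \<tau> k t * p j else 0) * (\<Prod>q\<in>S. v $ q))
        = (\<Sum>j<dy. \<tau> k t * p j * (\<Prod>q\<in>?pair j. v $ q))"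
      unfolding sum.swap [of _ "{..<dy}"] using True index_bound by (intro sum.cong refl mono) auto
    also have "(\<Sum>S\<in>Pow {..<?width}. (if S = {i} then 1 else 0) * (\<Prod>q\<in>S. v $ q)) = v $ i"
      using i by (subst mono) auto
    also have "v $ i + (\<Sum>j<dy. \<tau> k t * p j * (\<Prod>q\<in>?pair j. v $ q)) = update k t v $ i"
      using True by (simp add: update_def sum_distrib_left mult.assoc)
    finally show ?thesis by simp
  next
    case False
    then show ?thesis using mono [of "{i}" 1 v] i by (simp add: update_high)
  qed
  then show "\<exists>c. \<forall>v\<in>X. update k t v $ i = (\<Sum>S\<in>Pow {..<?width}. c S * (\<Prod>q\<in>S. v $ q))"
    by (intro exI [of _ ?c] ballI)
qed

lemma initial_states_carrier: "initial_states r \<subseteq> carrier_vec (m + dy)"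
  by (auto simp: initial_states_def states_def)

lemma s_inf_le: "s_inf D dims (factors t) \<le> m"
proof -
  have "s_inf_factor (factor_dom D dims q) (dims ! q) (dims ! (q + 1)) (factors t ! q) \<le> m" if "q < 2 * K" for q
  proof -
  have "q < 2 * K + 1" using that by simp
  then show ?thesis
  proof (cases rule: factor_cases)
    case (even k)
    have "Max (insert 0 ((\<lambda>i. num_vars X (m + dy) (\<lambda>v. expand k v $ i)) ` {..<m + dy + dy * m})) \<le> m" for X
    proof (rule Max.boundedI, safe)
      fix i assume "i < m + dy + dy * m"
      then show "num_vars X (m + dy) (\<lambda>v. expand k v $ i) \<le> m"
        using expand_num_vars [of i X k] m by (auto split: if_splits)
    qed auto
    then show ?thesis using even m
      by (simp add: s_inf_factor_def factors_even dims_even dims_odd)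
  next
    case (odd k)
    then show ?thesis using m update_multilinear [of _ k t] dims_even [of "Suc k"]
      by (simp add: s_inf_factor_def factors_odd dims_odd)
  next
    case last
    then show ?thesis using that by simp
  qed
  qed
  then show ?thesis unfolding s_inf_def by (intro Max.boundedI) auto
qed

text \<open>Both sides grow by a fixed amount per step: the two factors use \<open>2 * width + m * dy * (m + 2)\<close> variables,
  whereas the third layer of the network alone costs at least \<open>2 * width + m * dy * (m + 4)\<close>.\<close>
lemma complexity_le: "comp_complexity (initial_states r) dims (factors t) \<le> num_weights euler_net"
proof -
  define f where "f q = (\<Sum>i<dims ! (q + 1). num_vars (factor_dom (initial_states r) dims q) (dims ! q) (\<lambda>v. (factors t ! q) v $ i))" for q
  have even: "f (2 * k) \<le> m + dy + dy * m * m" if "k < K" for k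
  proof -
    have "f (2 * k) \<le> (\<Sum>i<m + dy + dy * m. if i < m + dy then 1 else m)"
      using that expand_num_vars unfolding f_def
      by (simp add: factors_even dims_even dims_odd) (intro sum_mono, simp)
    also have "\<dots> = m + dy + dy * m * m"
      unfolding sum_lessThan_add [of _ "m + dy"] by simp
    finally show ?thesis .
  qed
  have odd: "f (2 * k + 1) \<le> m * (1 + 2 * dy) + dy" if "k < K" for k
  proof -
    have "f (2 * k + 1) \<le> (\<Sum>i<m + dy. if i < m then 1 + 2 * dy else 1)"
      using that update_num_vars dims_even [of "Suc k"] unfolding f_def
      by (simp add: factors_odd dims_odd) (intro sum_mono, simp)
    also have "\<dots> = m * (1 + 2 * dy) + dy"
      unfolding sum_lessThan_add [of _ "m"] by simp
    finally show ?thesis .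
  qed
  have last: "f (2 * K) \<le> m"
  proof -
    have "factor_dom (initial_states r) dims (2 * K) \<subseteq> carrier_vec (m + dy)"
      using initial_states_carrier by (auto simp: factor_dom_def dims_even)
    then have "f (2 * K) \<le> (\<Sum>i<m. 1)"
      using out_num_vars unfolding f_def
      by (simp only: factors_last dims_even dims_last Suc_eq_plus1 [symmetric] le_refl) (intro sum_mono, simp)
    then show ?thesis by simp
  qed
  have "comp_complexity (initial_states r) dims (factors t) = (\<Sum>k<K. f (2 * k) + f (2 * k + 1)) + f (2 * K)"
    unfolding comp_complexity_def f_def [symmetric] length_factors
    by (simp add: sum_even_odd)
  also have "\<dots> \<le> (\<Sum>k<K. (m + dy + dy * m * m) + (m * (1 + 2 * dy) + dy)) + m"
    using even odd last by (intro add_mono sum_mono) auto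
  also have "\<dots> = K * (2 * width + m * (dy * (m + 2))) + m"
    by (simp add: width_def algebra_simps)
  also have "\<dots> \<le> num_weights euler_net"
  proof -
    have "1 * (m + 2) \<le> (n + 1) ^ m * (m + 4)"
      by (intro mult_le_mono) auto
    then have "m * (dy * (m + 2)) \<le> m * (dy * ((n + 1) ^ m * (m + 4)))"
      by (intro mult_le_mono2) simp
    then show ?thesis unfolding num_weights_eq by (intro add_right_mono mult_le_mono2) linarith
  qed
  finally show ?thesis .
qed

lemma factors_comp_rep:
  assumes "0 \<le> r"
  shows "comp_rep (initial_states r) (m + dy) m dims (factors t)"
  unfolding comp_rep_def
proof (intro conjI allI impI)
  show "factors t \<noteq> []" by (simp add: factors_def)
  show "length dims = length (factors t) + 1" by simp
  have "dims \<noteq> []" by (simp add: dims_def)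
  then show "hd dims = m + dy" "last dims = m"
    using dims_even [of 0] dims_last by (simp_all add: hd_conv_nth last_conv_nth)
  show "initial_states r \<subseteq> carrier_vec (m + dy)" by (rule initial_states_carrier)
  fix q assume q: "q < length (factors t)"
  show "\<forall>v\<in>factor_dom (initial_states r) dims q. (factors t ! q) v \<in> carrier_vec (dims ! (q + 1))"
    using q [unfolded length_factors]
  proof (cases rule: factor_cases)
    case (odd k)
    then show ?thesis using dims_even [of "Suc k"] by (simp add: factors_odd)
  qed (simp_all add: factors_even factors_last dims_odd dims_last)
  have "lip_seminorm (reach (initial_states r) (factors t) q) (factors t ! q) \<le> ennreal (stability_const r)"
    using factor_bounds(1) [OF assms, of q t] q by (simp add: lip_norm_def)
  then show "lip_seminorm (reach (initial_states r) (factors t) q) (factors t ! q) < \<infinity>"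
    by (rule le_less_trans) simp
next
  have "factors t \<noteq> []" by (simp add: factors_def)
  then have "last (factors t) = out" by (simp add: last_conv_nth factors_last)
  moreover have "dims ! (length (factors t) - 1) = m + dy" by (simp add: dims_even)
  ultimately show "\<exists>M\<in>carrier_mat m (dims ! (length (factors t) - 1)).
      \<forall>v\<in>factor_dom (initial_states r) dims (length (factors t) - 1). last (factors t) v = M *\<^sub>v v"
    by (intro bexI [of _ "mat m (m + dy) (\<lambda>(r, c). if r = c then 1 else 0)"]) (auto simp: out_def)
qed

lemma comp_norm_le:
  assumes "0 \<le> r" "num_weights euler_net \<le> N"
  shows "comp_norm (initial_states r) (m + dy) m N m (dnn_eval euler_net t) \<le> ennreal (stability_const r)"
proof -
  have eval: "\<forall>v\<in>initial_states r. compose (factors t) v = dnn_eval euler_net t v"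
    using compose_factors initial_states_carrier by blast
  have "comp_norm (initial_states r) (m + dy) m N m (dnn_eval euler_net t) \<le> rep_stability (initial_states r) (factors t)"
    unfolding comp_norm_def
    using factors_comp_rep [OF assms(1)] s_inf_le complexity_le [of r t] assms(2) eval
    by (intro Inf_lower CollectI exI [of _ dims] exI [of _ "factors t"] conjI refl) auto
  also have "\<dots> \<le> ennreal (stability_const r)" using rep_stability_le assms by simp
  finally show ?thesis .
qed

end

section \<open>Characteristics of an affine convection field\<close>

lemma linf_norm_leD:
  assumes "linf_norm D g \<le> ennreal c" "0 \<le> c" "x \<in> D" "i < dim_vec (g x)"
  shows "\<bar>g x $ i\<bar> \<le> c"
proof -
  have "ennreal (max_norm (g x)) \<le> linf_norm D g"
    unfolding linf_norm_def by (rule SUP_upper [OF assms(3)])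
  then have "max_norm (g x) \<le> c"
    using assms(1,2) by (metis ennreal_le_iff order_trans)
  then show ?thesis using component_le_max_norm [OF assms(4)] by linarith
qed

lemma lip_seminorm_leD:
  assumes "lip_seminorm D g \<le> ennreal c" "0 \<le> c" "x \<in> D" "x' \<in> D" "D \<subseteq> carrier_vec d"
    and "g x' \<in> carrier_vec d'" "i < d'"
    and "\<And>k. k < d \<Longrightarrow> \<bar>x $ k - x' $ k\<bar> \<le> e" "0 \<le> e"
  shows "\<bar>g x $ i - g x' $ i\<bar> \<le> c * e"
proof (cases "x = x'")
  case True
  then show ?thesis using assms by simp
next
  case False
  have dims: "dim_vec x = d" "dim_vec x' = d" using assms(3-5) by auto
  have "max_norm (x - x') \<noteq> 0"
  proof
    assume "max_norm (x - x') = 0"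
    then have "x $ k = x' $ k" if "k < d" for k
      using component_le_max_norm [of k "x - x'"] that dims by simp
    then show False using False dims by auto
  qed
  then have pos: "0 < max_norm (x - x')" using max_norm_nonneg [of "x - x'"] by simp
  have "ennreal (max_norm (g x - g x') / max_norm (x - x')) \<le> lip_seminorm D g"
    unfolding lip_seminorm_def
    using SUP_upper [of "(x, x')" "{(x, x'). x \<in> D \<and> x' \<in> D \<and> x \<noteq> x'}"
        "\<lambda>(x, x'). ennreal (max_norm (g x - g x') / max_norm (x - x'))"] assms False by simp
  then have "max_norm (g x - g x') / max_norm (x - x') \<le> c"
    using assms(1,2) by (metis ennreal_le_iff order_trans)
  then have "max_norm (g x - g x') \<le> c * max_norm (x - x')"
    using pos by (simp add: divide_le_eq)
  also have "\<dots> \<le> c * e"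
    using assms dims by (intro mult_left_mono) (auto simp: max_norm_le_iff)
  finally show ?thesis
    using component_le_max_norm [of i "g x - g x'"] assms by simp
qed

text \<open>\<open>weight_const\<close> bounds the number of weights relative to its order of growth: 5 and \<open>6 * (R + 1)\<close>
  come from rounding up the numbers of steps and of cells, the polynomial in \<open>m\<close> from the cost of a cell,
  and the last \<open>m\<close> from the output layer.  The summand \<open>3 + R\<close> of \<open>rate_const\<close> is the factor in the
  stability bound.\<close>
definition weight_const :: "nat \<Rightarrow> real \<Rightarrow> real" where
  "weight_const m R = 5 * (6 * (R + 1)) ^ m * (real m ^ 2 + 28 * real m + 14) + real m"
definition rate_const :: "nat \<Rightarrow> real \<Rightarrow> real" where
  "rate_const m R = weight_const m R + 3 + R"

locale affine_transport =
  fixes m dy :: nat and T R A\<^sub>o \<Lambda> \<omega>\<^sub>1 A :: real and \<omega> :: "nat \<Rightarrow> real"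
    and a\<^sub>o :: "nat \<Rightarrow> real \<Rightarrow> real vec \<Rightarrow> real vec" and a :: "real \<Rightarrow> real vec \<Rightarrow> real vec"
    and z :: "real \<Rightarrow> real vec \<Rightarrow> real vec \<Rightarrow> real vec" and X :: "real vec set"
  assumes m: "0 < m" and T: "0 < T" and R: "0 < R"
    and \<omega>_nonneg: "j < dy \<Longrightarrow> 0 \<le> \<omega> j"
    and ao_carrier: "j < dy \<Longrightarrow> t \<in> {0..T} \<Longrightarrow> x \<in> carrier_vec m \<Longrightarrow> a\<^sub>o j t x \<in> carrier_vec m"
    and ao_bound: "j < dy \<Longrightarrow> linf_norm ({0..T} \<times> carrier_vec m) (\<lambda>(t, x). a\<^sub>o j t x) \<le> ennreal A\<^sub>o"
    and \<Lambda>: "0 \<le> \<Lambda>"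
    and ao_lip: "j < dy \<Longrightarrow> t \<in> {0..T} \<Longrightarrow> lip_seminorm (carrier_vec m) (a\<^sub>o j t) \<le> ennreal \<Lambda>"
    and \<omega>\<^sub>1: "\<omega>\<^sub>1 = (\<Sum>j<dy. \<omega> j)" and A_eq: "A = \<omega>\<^sub>1 * A\<^sub>o" and A: "1 \<le> A"
    and a: "a = affine_field m dy (\<lambda>j t x. \<omega> j \<cdot>\<^sub>v a\<^sub>o j t x)"
    and a_continuous: "continuous_into_Lip1 T (join_sets (carrier_vec m) (cube dy 1)) a"
    and z: "characteristics m T (cube dy 1) a z"
    and X: "X \<subseteq> carrier_vec m"
    and localized: "X \<subseteq> cube m R \<or>
        (\<forall>t\<in>{0..T}. \<forall>x\<in>carrier_vec m - cube m R. \<forall>y\<in>cube dy 1. a t (x @\<^sub>v y) = 0\<^sub>v m)"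
begin

text \<open>A characteristic that starts in the cube of radius \<open>R\<close> stays in that of radius \<open>R'\<close>.  Dividing by
  \<open>\<omega>\<^sub>1\<close> turns the weights into a convex combination; the fields are multiplied by \<open>\<omega>\<^sub>1\<close> in return.  A field
  of weight 0 is replaced by 0, because nothing is known about its continuity in time.\<close>
definition R' :: real where "R' = R + A * T"
definition p :: "nat \<Rightarrow> real" where "p j = \<omega> j / \<omega>\<^sub>1"
definition clip_vec :: "real vec \<Rightarrow> real vec" where "clip_vec x = vec m (\<lambda>k. clip (- R') R' (x $ k))"
definition b :: "nat \<Rightarrow> nat \<Rightarrow> real \<Rightarrow> real vec \<Rightarrow> real" where
  "b j i t x = (if \<omega> j = 0 then 0 else \<omega>\<^sub>1 * a\<^sub>o j t (clip_vec x) $ i)"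

lemma \<omega>\<^sub>1_pos: "0 < \<omega>\<^sub>1" and Ao_pos: "0 < A\<^sub>o" and dy: "0 < dy"
proof -
  have "0 \<le> \<omega>\<^sub>1" unfolding \<omega>\<^sub>1 using \<omega>_nonneg by (intro sum_nonneg) auto
  moreover have "0 < \<omega>\<^sub>1 * A\<^sub>o" using A A_eq by simp
  ultimately show "0 < \<omega>\<^sub>1" "0 < A\<^sub>o" by (auto simp: zero_less_mult_iff)
  then show "0 < dy" using \<omega>\<^sub>1 by (cases dy) auto
qed

lemma R'_pos: "0 < R'" and R_le: "R \<le> R'" and R_less: "R < R'"
  using R A T by (simp_all add: R'_def add_pos_pos)

lemma clip_vec_carrier [simp]: "clip_vec x \<in> carrier_vec m" by (simp add: clip_vec_def)

lemma a_index:
  assumes "x \<in> carrier_vec m" "y \<in> carrier_vec dy" "i < m" "t \<in> {0..T}"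
  shows "a t (x @\<^sub>v y) $ i = (\<Sum>j<dy. y $ j * (\<omega> j * a\<^sub>o j t x $ i))"
proof -
  have "vec_first (x @\<^sub>v y) m = x" "vec_last (x @\<^sub>v y) dy = y"
    using assms by (auto simp: vec_first_def vec_last_def intro!: eq_vecI)
  moreover have "(\<omega> j \<cdot>\<^sub>v a\<^sub>o j t x) $ i = \<omega> j * a\<^sub>o j t x $ i" if "j < dy" for j
    using ao_carrier [OF that assms(4,1)] assms(3) by simp
  ultimately show ?thesis
    using assms(3) by (simp add: a affine_field_def)
qed

lemma a_dim [simp]: "dim_vec (a t w) = m" by (simp add: a affine_field_def)

lemma ao_abs_le:
  assumes "j < dy" "i < m" "t \<in> {0..T}" "x \<in> carrier_vec m"
  shows "\<bar>a\<^sub>o j t x $ i\<bar> \<le> A\<^sub>o"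
  using linf_norm_leD [OF ao_bound [OF assms(1)], of "(t, x)" i] ao_carrier [OF assms(1,3,4)] assms Ao_pos
  by auto

lemma weighted_average:
  assumes "x \<in> carrier_vec m" "y \<in> carrier_vec dy" "i < m" "t \<in> {0..T}"
  shows "a t (clip_vec x @\<^sub>v y) $ i = (\<Sum>j<dy. p j * (y $ j * b j i t x))"
  unfolding a_index [OF clip_vec_carrier assms(2-4)]
  using \<omega>\<^sub>1_pos by (intro sum.cong refl) (simp add: p_def b_def)

lemma a_abs_le:
  assumes "x \<in> carrier_vec m" "y \<in> cube dy 1" "i < m" "t \<in> {0..T}"
  shows "\<bar>a t (x @\<^sub>v y) $ i\<bar> \<le> A"
proof -
  have y: "y \<in> carrier_vec dy" "\<And>j. j < dy \<Longrightarrow> \<bar>y $ j\<bar> \<le> 1"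
    using assms(2) by (auto simp: cube_def max_norm_le_iff)
  have "\<bar>a t (x @\<^sub>v y) $ i\<bar> \<le> (\<Sum>j<dy. \<bar>y $ j * (\<omega> j * a\<^sub>o j t x $ i)\<bar>)"
    unfolding a_index [OF assms(1) y(1) assms(3,4)] by (rule sum_abs)
  also have "\<dots> \<le> (\<Sum>j<dy. 1 * (\<omega> j * A\<^sub>o))"
    unfolding abs_mult using assms y ao_abs_le \<omega>_nonneg by (intro sum_mono mult_mono) auto
  also have "\<dots> = A" by (simp add: A_eq \<omega>\<^sub>1 sum_distrib_right)
  finally show ?thesis .
qed

text \<open>The sum is continuous in time for every parameter, and a unit vector as parameter singles out one
  summand.\<close>
lemma ao_continuous:
  assumes j: "j < dy" "\<omega> j \<noteq> 0" and i: "i < m" and x: "x \<in> carrier_vec m"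
  shows "continuous_on {0..T} (\<lambda>t. a\<^sub>o j t x $ i)"
proof -
  let ?D = "join_sets (carrier_vec m) (cube dy 1)"
  let ?y = "unit_vec dy j :: real vec"
  have y: "?y \<in> cube dy 1" using j by (auto simp: cube_def max_norm_le_iff)
  have w: "x @\<^sub>v ?y \<in> ?D" using x y by (auto simp: join_sets_def)
  have idx: "a t (x @\<^sub>v ?y) $ i = \<omega> j * a\<^sub>o j t x $ i" if "t \<in> {0..T}" for t
  proof -
    have "a t (x @\<^sub>v ?y) $ i = (\<Sum>k<dy. (if k = j then 1 else 0) * (\<omega> k * a\<^sub>o k t x $ i))"
      unfolding a_index [OF x unit_vec_carrier i that] using j by (intro sum.cong) auto
    also have "\<dots> = \<omega> j * a\<^sub>o j t x $ i"
      using j by (simp add: if_distrib [of "\<lambda>a. a * _"] cong: if_cong)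
    finally show ?thesis .
  qed
  have "continuous_on {0..T} (\<lambda>t. a t (x @\<^sub>v ?y) $ i)"
    unfolding continuous_on_def
  proof (intro ballI tendstoI)
    fix t and e :: real assume t: "t \<in> {0..T}" and e: "0 < e"
    have "((\<lambda>s. lip_norm ?D (\<lambda>w. a s w - a t w)) \<longlongrightarrow> 0) (at t within {0..T})"
      using a_continuous t by (auto simp: continuous_into_Lip1_def)
    then have "eventually (\<lambda>s. lip_norm ?D (\<lambda>w. a s w - a t w) < ennreal (e / 2)) (at t within {0..T})"
      using e by (intro order_tendstoD) auto
    then show "eventually (\<lambda>s. dist (a s (x @\<^sub>v ?y) $ i) (a t (x @\<^sub>v ?y) $ i) < e) (at t within {0..T})"
    proof (rule eventually_mono)
      fix s assume "lip_norm ?D (\<lambda>w. a s w - a t w) < ennreal (e / 2)"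
      then have "linf_norm ?D (\<lambda>w. a s w - a t w) \<le> ennreal (e / 2)"
        by (simp add: lip_norm_def less_imp_le)
      then have "\<bar>(a s (x @\<^sub>v ?y) - a t (x @\<^sub>v ?y)) $ i\<bar> \<le> e / 2"
        using e i by (intro linf_norm_leD [OF _ _ w]) auto
      then show "dist (a s (x @\<^sub>v ?y) $ i) (a t (x @\<^sub>v ?y) $ i) < e"
        using e i by (simp add: dist_real_def)
    qed
  qed
  then have "continuous_on {0..T} (\<lambda>t. inverse (\<omega> j) * a t (x @\<^sub>v ?y) $ i)"
    by (intro continuous_intros)
  moreover have "continuous_on {0..T} (\<lambda>t. a\<^sub>o j t x $ i)
      \<longleftrightarrow> continuous_on {0..T} (\<lambda>t. inverse (\<omega> j) * a t (x @\<^sub>v ?y) $ i)"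
    using j by (intro continuous_on_cong refl) (simp add: idx)
  ultimately show ?thesis by blast
qed

lemma scheme: "0 < n \<Longrightarrow> euler_scheme m dy n T A (\<Lambda> * \<omega>\<^sub>1) R' p b"
proof (unfold_locales)
  show "0 < A" using A by simp
  show "0 \<le> \<Lambda> * \<omega>\<^sub>1" using \<Lambda> \<omega>\<^sub>1_pos by simp
  show "0 \<le> p j" if "j < dy" for j using \<omega>_nonneg that \<omega>\<^sub>1_pos by (simp add: p_def)
  show "(\<Sum>j<dy. p j) = 1" using \<omega>\<^sub>1_pos by (simp add: p_def sum_divide_distrib [symmetric] \<omega>\<^sub>1 [symmetric])
  show "continuous_on {0..T} (\<lambda>t. b j i t x)" if "j < dy" "i < m" "x \<in> carrier_vec m" for j i x
    unfolding b_def using ao_continuous [OF that(1) _ that(2) clip_vec_carrier]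
    by (cases "\<omega> j = 0") (auto intro!: continuous_intros)
  show "\<bar>b j i t x\<bar> \<le> A" if "j < dy" "i < m" "x \<in> carrier_vec m" "t \<in> {0..T}" for j i x t
  proof -
    have "\<omega>\<^sub>1 * \<bar>a\<^sub>o j t (clip_vec x) $ i\<bar> \<le> \<omega>\<^sub>1 * A\<^sub>o"
      using ao_abs_le [OF that(1,2,4) clip_vec_carrier] \<omega>\<^sub>1_pos by (intro mult_left_mono) auto
    then show ?thesis using \<omega>\<^sub>1_pos A by (simp add: b_def A_eq [symmetric] abs_mult)
  qed
  show "\<bar>b j i t x - b j i t x'\<bar> \<le> \<Lambda> * \<omega>\<^sub>1 * e"
    if *: "j < dy" "i < m" "x \<in> carrier_vec m" "x' \<in> carrier_vec m" "t \<in> {0..T}"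
      "\<And>k. k < m \<Longrightarrow> \<bar>clip (- R') R' (x $ k) - clip (- R') R' (x' $ k)\<bar> \<le> e" for j i x x' t e
  proof -
    have e: "0 \<le> e" using *(6) [OF m] by linarith
    have "\<bar>a\<^sub>o j t (clip_vec x) $ i - a\<^sub>o j t (clip_vec x') $ i\<bar> \<le> \<Lambda> * e"
      using * e ao_lip \<Lambda> ao_carrier
      by (intro lip_seminorm_leD [where D = "carrier_vec m" and d = m and d' = m]) (auto simp: clip_vec_def)
    then have "\<omega>\<^sub>1 * \<bar>a\<^sub>o j t (clip_vec x) $ i - a\<^sub>o j t (clip_vec x') $ i\<bar> \<le> \<omega>\<^sub>1 * (\<Lambda> * e)"
      using \<omega>\<^sub>1_pos by (intro mult_left_mono) auto
    then show ?thesis using \<omega>\<^sub>1_pos \<Lambda> e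
      by (auto simp: b_def right_diff_distrib [symmetric] abs_mult mult_ac)
  qed
qed (use m dy T R'_pos in auto)

context
  fixes x y :: "real vec"
  assumes x: "x \<in> X" and y: "y \<in> cube dy 1"
begin

lemma x_carrier: "x \<in> carrier_vec m" and y_carrier: "y \<in> carrier_vec dy"
  and y_abs: "j < dy \<Longrightarrow> \<bar>y $ j\<bar> \<le> 1"
  using x y X by (auto simp: cube_def max_norm_le_iff)

lemma z_start: "z 0 x y = x" and z_carrier: "t \<in> {0..<T} \<Longrightarrow> z t x y \<in> carrier_vec m"
  and z_deriv: "t \<in> {0..<T} \<Longrightarrow> i < m \<Longrightarrow>
    ((\<lambda>s. z s x y $ i) has_real_derivative a t (z t x y @\<^sub>v y) $ i) (at t within {0..<T})"
  using z x_carrier y by (auto simp: characteristics_def)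

lemma z_displacement: "t \<in> {0..<T} \<Longrightarrow> i < m \<Longrightarrow> \<bar>z t x y $ i - x $ i\<bar> \<le> A * T"
proof -
  assume t: "t \<in> {0..<T}" and i: "i < m"
  have "\<bar>z t x y $ i - z 0 x y $ i\<bar> \<le> A * (t - 0)"
    using t i z_deriv a_abs_le [OF z_carrier y i]
    by (intro deriv_bound_increment [where S = "{0..<T}" and f' = "\<lambda>t. a t (z t x y @\<^sub>v y) $ i"]) auto
  also have "\<dots> \<le> A * T" using t A by simp
  finally show ?thesis by (simp add: z_start)
qed

text \<open>Clipping is invisible along a characteristic.  If \<open>X\<close> lies in the cube, the characteristic does not
  leave the cube of radius \<open>R'\<close>.  Otherwise the field vanishes outside the cube of radius \<open>R < R'\<close>, and
  clipping to \<open>R'\<close> keeps points outside that cube outside.\<close>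
lemma a_clip: "t \<in> {0..<T} \<Longrightarrow> a t (z t x y @\<^sub>v y) = a t (clip_vec (z t x y) @\<^sub>v y)"
proof -
  assume t: "t \<in> {0..<T}"
  have zc: "z t x y \<in> carrier_vec m" using z_carrier [OF t] .
  have id: "clip_vec (z t x y) = z t x y" if "\<And>k. k < m \<Longrightarrow> \<bar>z t x y $ k\<bar> \<le> R'"
  proof (rule eq_vecI)
    fix k assume "k < dim_vec (z t x y)"
    then have k: "k < m" using zc by simp
    then have "- R' \<le> z t x y $ k" "z t x y $ k \<le> R'" using that [OF k] by linarith+
    then show "clip_vec (z t x y) $ k = z t x y $ k" using k by (simp add: clip_vec_def clip_id)
  qed (use zc in \<open>simp add: clip_vec_def\<close>)
  show ?thesis
  proof (cases "X \<subseteq> cube m R")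
    case True
    then have "x \<in> cube m R" using x by auto
    then have "\<bar>x $ k\<bar> \<le> R" if "k < m" for k using that by (auto simp: cube_def max_norm_le_iff)
    then have "\<bar>z t x y $ k\<bar> \<le> R'" if "k < m" for k
      using z_displacement [OF t that] that unfolding R'_def by (smt (verit))
    then show ?thesis by (simp add: id)
  next
    case False
    then have zero: "a t (u @\<^sub>v y) = 0\<^sub>v m" if "u \<in> carrier_vec m - cube m R" for u
      using localized t y that by auto
    show ?thesis
    proof (cases "z t x y \<in> cube m R")
      case True
      then have "\<bar>z t x y $ k\<bar> \<le> R'" if "k < m" for k
        using that R_le by (fastforce simp: cube_def max_norm_le_iff)
      then show ?thesis by (simp add: id)
    next
      case False
      then obtain k where k: "k < m" "R < \<bar>z t x y $ k\<bar>"
        using zc R by (auto simp: cube_def max_norm_le_iff not_le)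
      then have "R < \<bar>clip_vec (z t x y) $ k\<bar>"
        using R_less R by (auto simp: clip_vec_def clip_def max_def min_def)
      then have "clip_vec (z t x y) \<notin> cube m R"
        using k by (auto simp: cube_def max_norm_le_iff not_le clip_vec_def)
      then show ?thesis using zero [of "z t x y"] zero [of "clip_vec (z t x y)"] zc False by simp
    qed
  qed
qed

lemma z_deriv_average:
  "t \<in> {0..<T} \<Longrightarrow> i < m \<Longrightarrow>
    ((\<lambda>s. z s x y $ i) has_real_derivative
      (\<Sum>j<dy. p j * ((x @\<^sub>v y) $ (m + j) * b j i t (z t x y)))) (at t within {0..<T})"
  using z_deriv [of t i] weighted_average [OF z_carrier y_carrier, of t i t] x_carrier y_carrier
  by (simp add: a_clip)

end

text \<open>Without any step (\<open>K = 0\<close>) the network is the map \<open>(x, y) \<mapsto> x\<close>, and its error is the distance travelled.\<close>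
lemma scheme_network:
  assumes n: "0 < n"
  shows "\<exists>\<N>. dnn_type (m + dy) m \<N> \<and>
    num_weights \<N> \<le> K * (dy * (n + 1) ^ m * (m\<^sup>2 + 28 * m + 14)) + m \<and>
    linf_norm ({0..<T} \<times> X \<times> cube dy 1) (\<lambda>(t, x, y). z t x y - dnn_eval \<N> t (x @\<^sub>v y))
      \<le> ennreal (if K = 0 then A * T else exp (\<Lambda> * \<omega>\<^sub>1 * T) * (2 * A * (T / real K) + 2 * R' / real n)) \<and>
    Lip1_in_time T (join_sets (carrier_vec m) (cube dy 1)) (dnn_eval \<N>) \<and>
    (\<forall>N t. num_weights \<N> \<le> N \<longrightarrow>
      comp_norm (join_sets (cube m R) (cube dy 1)) (m + dy) m N m (dnn_eval \<N> t)
        \<le> ennreal ((3 + R) * exp (A * T + real m * (\<Lambda> * \<omega>\<^sub>1) * T)))"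
proof -
  interpret E: euler_scheme m dy K n T A "\<Lambda> * \<omega>\<^sub>1" R' p b by (rule scheme [OF n])
  let ?c = "if K = 0 then A * T else exp (\<Lambda> * \<omega>\<^sub>1 * T) * (2 * A * (T / real K) + 2 * R' / real n)"
  have c: "0 \<le> ?c" using A T R'_pos by simp
  have "linf_norm ({0..<T} \<times> X \<times> cube dy 1) (\<lambda>(t, x, y). z t x y - dnn_eval E.euler_net t (x @\<^sub>v y)) \<le> ennreal ?c"
  proof (rule linf_norm_le, clarify)
    fix t x y assume t: "t \<in> {0..<T}" and xy: "x \<in> X" "y \<in> cube dy 1"
    have w: "x @\<^sub>v y \<in> carrier_vec (m + dy)" using x_carrier [OF xy] y_carrier [OF xy] by simp
    have idx: "(x @\<^sub>v y) $ i = x $ i" if "i < m" for i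
      using that x_carrier [OF xy] y_carrier [OF xy] by simp
    have par: "\<bar>(x @\<^sub>v y) $ (m + j)\<bar> \<le> 1" if "j < dy" for j
      using that x_carrier [OF xy] y_carrier [OF xy] y_abs [OF xy] by simp
    have "\<bar>z t x y $ i - E.state K t (x @\<^sub>v y) $ i\<bar> \<le> ?c" if i: "i < m" for i
    proof (cases "K = 0")
      case True
      have "k = 0 \<Longrightarrow> E.state k t (x @\<^sub>v y) = x @\<^sub>v y" for k by simp
      from this [OF True] have "E.state K t (x @\<^sub>v y) $ i = x $ i" using idx [OF i] by (rule ssubst)
      then have "\<bar>z t x y $ i - E.state K t (x @\<^sub>v y) $ i\<bar> \<le> A * T"
        using z_displacement [OF xy t i] by (simp only:)
      then show ?thesis using if_P [OF True] by (rule ssubst [rotated])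
    next
      case False
      have "\<bar>z t x y $ i - E.state K t (x @\<^sub>v y) $ i\<bar> \<le> exp (\<Lambda> * \<omega>\<^sub>1 * T) * (2 * A * E.h + E.H)"
        using False t i w par z_start [OF xy] z_carrier [OF xy] z_deriv_average [OF xy] idx
        by (intro E.scheme_error [where z = "\<lambda>t. z t x y"]) auto
      then show ?thesis using False by (simp add: E.h_def E.H_def)
    qed
    then show "max_norm (z t x y - dnn_eval E.euler_net t (x @\<^sub>v y)) \<le> ?c"
      using c by (simp add: max_norm_le_iff E.euler_net_eval [OF w])
  qed
  moreover have "Lip1_in_time T (join_sets (carrier_vec m) (cube dy 1)) (dnn_eval E.euler_net)"
    using E.euler_net_Lip1_in_time by (simp add: E.states_eq)
  moreover have "comp_norm (join_sets (cube m R) (cube dy 1)) (m + dy) m N m (dnn_eval E.euler_net t)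
      \<le> ennreal ((3 + R) * exp (A * T + real m * (\<Lambda> * \<omega>\<^sub>1) * T))" if "num_weights E.euler_net \<le> N" for N t
    using E.comp_norm_le [of R N t] that R by (simp add: E.initial_states_eq E.stability_const_def)
  ultimately show ?thesis using E.euler_net_type E.num_weights_le by blast
qed


text \<open>If \<open>A * T \<le> \<epsilon>\<close>, no step is needed.  Otherwise \<open>K\<close> and \<open>n\<close> are the least integers for which time and
  space contribute at most \<open>\<epsilon> / 2\<close> each, so \<open>K\<close> is of order \<open>A * T * q\<close> and \<open>n\<close> of order \<open>R' * q\<close> with
  \<open>q = exp (\<Lambda> * \<omega>\<^sub>1 * T) / \<epsilon>\<close>.  The growth of \<open>R'\<close> with \<open>A * T\<close> is absorbed by the factor \<open>exp (A * T)\<close> that \<open>E\<close>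
  has in addition.\<close>
lemma network_for_accuracy:
  assumes \<epsilon>: "0 < \<epsilon>"
  defines "E \<equiv> exp ((A + \<Lambda> * \<omega>\<^sub>1) * T)"
  shows "\<exists>\<N>. dnn_type (m + dy) m \<N> \<and>
    real (num_weights \<N>) \<le> (if A * T \<le> \<epsilon> then real m
      else (5 * (6 * (R + 1)) ^ m * (real m ^ 2 + 28 * real m + 14) + real m)
        * (real dy * (A * T) * (E / \<epsilon>) ^ (m + 1))) \<and>
    linf_norm ({0..<T} \<times> X \<times> cube dy 1) (\<lambda>(t, x, y). z t x y - dnn_eval \<N> t (x @\<^sub>v y)) \<le> ennreal \<epsilon> \<and>
    Lip1_in_time T (join_sets (carrier_vec m) (cube dy 1)) (dnn_eval \<N>) \<and>
    (\<forall>N t. num_weights \<N> \<le> N \<longrightarrow>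
      comp_norm (join_sets (cube m R) (cube dy 1)) (m + dy) m N m (dnn_eval \<N> t)
        \<le> ennreal ((3 + R) * exp (A * T + real m * (\<Lambda> * \<omega>\<^sub>1) * T)))"
proof (cases "A * T \<le> \<epsilon>")
  case True
  obtain \<N> where \<N>: "dnn_type (m + dy) m \<N>" "num_weights \<N> \<le> m"
    "linf_norm ({0..<T} \<times> X \<times> cube dy 1) (\<lambda>(t, x, y). z t x y - dnn_eval \<N> t (x @\<^sub>v y)) \<le> ennreal (A * T)"
    "Lip1_in_time T (join_sets (carrier_vec m) (cube dy 1)) (dnn_eval \<N>)"
    "\<forall>N t. num_weights \<N> \<le> N \<longrightarrow>
      comp_norm (join_sets (cube m R) (cube dy 1)) (m + dy) m N m (dnn_eval \<N> t)
        \<le> ennreal ((3 + R) * exp (A * T + real m * (\<Lambda> * \<omega>\<^sub>1) * T))"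
    using scheme_network [of 1 0] by auto
  moreover have "ennreal (A * T) \<le> ennreal \<epsilon>" using True by (rule ennreal_leI)
  ultimately show ?thesis using True
    by (intro exI [of _ \<N>]) (auto intro: order_trans)
next
  case False
  define s where "s = \<Lambda> * \<omega>\<^sub>1 * T"
  define q where "q = exp s / \<epsilon>"
  define K where "K = nat \<lceil>4 * (A * T) * q\<rceil>"
  define n where "n = nat \<lceil>4 * R' * q\<rceil>"
  have s: "0 \<le> s" using \<Lambda> \<omega>\<^sub>1_pos T by (simp add: s_def)
  have q: "0 < q" "1 / \<epsilon> \<le> q" using \<epsilon> s by (auto simp: q_def divide_right_mono)
  have AT: "0 < A * T" using A T by simp
  have "1 < (A * T) * (1 / \<epsilon>)" using False \<epsilon> by (simp add: field_simps)
  also have "\<dots> \<le> (A * T) * q" using q AT by (intro mult_left_mono) auto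
  finally have ATq: "1 < A * T * q" .
  have Kpos: "0 < 4 * (A * T) * q" and npos: "0 < 4 * R' * q" using AT q R'_pos by auto
  have K: "4 * (A * T) * q \<le> real K" "real K \<le> 4 * (A * T) * q + 1"
    unfolding K_def using Kpos by linarith+
  have n: "4 * R' * q \<le> real n" "real n \<le> 4 * R' * q + 1"
    unfolding n_def using npos by linarith+
  have n0: "0 < n" and K0: "0 < K" using K n Kpos npos by linarith+
  obtain \<N> where \<N>: "dnn_type (m + dy) m \<N>"
    "num_weights \<N> \<le> K * (dy * (n + 1) ^ m * (m\<^sup>2 + 28 * m + 14)) + m"
    "linf_norm ({0..<T} \<times> X \<times> cube dy 1) (\<lambda>(t, x, y). z t x y - dnn_eval \<N> t (x @\<^sub>v y))
      \<le> ennreal (exp s * (2 * A * (T / real K) + 2 * R' / real n))"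
    "Lip1_in_time T (join_sets (carrier_vec m) (cube dy 1)) (dnn_eval \<N>)"
    "\<forall>N t. num_weights \<N> \<le> N \<longrightarrow>
      comp_norm (join_sets (cube m R) (cube dy 1)) (m + dy) m N m (dnn_eval \<N> t)
        \<le> ennreal ((3 + R) * exp (A * T + real m * (\<Lambda> * \<omega>\<^sub>1) * T))"
    using scheme_network [OF n0, of K] K0 unfolding s_def by (smt (verit) less_irrefl)
  \<comment> \<open>the error budget is split evenly between time and space\<close>
  have "2 * A * (T / real K) \<le> 1 / (2 * q)"
    using K(1) K0 q by (simp add: field_simps)
  moreover have "2 * R' / real n \<le> 1 / (2 * q)"
    using n(1) n0 q by (simp add: field_simps)
  ultimately have "exp s * (2 * A * (T / real K) + 2 * R' / real n) \<le> exp s * (1 / (2 * q) + 1 / (2 * q))"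
    by (intro mult_left_mono) auto
  also have "\<dots> = \<epsilon>" using \<epsilon> by (simp add: q_def)
  finally have err: "ennreal (exp s * (2 * A * (T / real K) + 2 * R' / real n)) \<le> ennreal \<epsilon>"
    by (rule ennreal_leI)
  \<comment> \<open>the number of weights\<close>
  have E: "E = exp (A * T) * exp s" by (simp add: E_def s_def exp_add [symmetric] algebra_simps)
  have expAT: "1 + A * T \<le> exp (A * T)" by (rule exp_ge_add_one_self)
  have qE: "(1 + A * T) * q \<le> E / \<epsilon>"
    using mult_right_mono [OF expAT, of q] q by (simp add: E q_def)
  have "1 * q \<le> (1 + A * T) * q" using AT q by (intro mult_right_mono) auto
  then have qE': "q \<le> E / \<epsilon>" using qE by simp
  have "A * T * q \<le> (1 + A * T) * q" using q by simp
  then have E1: "1 \<le> E / \<epsilon>" using ATq qE by linarith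
  have E0: "0 < E / \<epsilon>" using E1 by linarith
  have Kle: "real K \<le> 5 * (A * T) * (E / \<epsilon>)"
  proof -
    have "real K \<le> 5 * (A * T) * q" using K(2) ATq by linarith
    also have "\<dots> \<le> 5 * (A * T) * (E / \<epsilon>)" using qE' AT by (intro mult_left_mono) auto
    finally show ?thesis .
  qed
  have nle: "real (n + 1) \<le> 6 * (R + 1) * (E / \<epsilon>)"
  proof -
    have "real (n + 1) \<le> 4 * R' * q + 2" using n(2) by simp
    also have "\<dots> \<le> 4 * R' * q + 2 * (A * T * q)" using ATq by linarith
    also have "\<dots> = 4 * (R * q) + 6 * (A * T * q)" by (simp add: R'_def algebra_simps)
    also have "\<dots> \<le> 6 * (R + 1) * ((1 + A * T) * q)"
    proof -
      have "6 * (R + 1) * ((1 + A * T) * q) = 6 * (R * q) + 6 * (R * (A * T * q)) + 6 * q + 6 * (A * T * q)"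
        by (simp add: algebra_simps)
      moreover have "0 \<le> R * (A * T * q)" "0 \<le> R * q" using R AT q by auto
      ultimately show ?thesis using q by linarith
    qed
    also have "\<dots> \<le> 6 * (R + 1) * (E / \<epsilon>)" using qE R by (intro mult_left_mono) auto
    finally show ?thesis .
  qed
  let ?c = "real m ^ 2 + 28 * real m + 14" and ?W = "real dy * (A * T) * (E / \<epsilon>) ^ (m + 1)"
  have W1: "1 \<le> ?W"
  proof -
    have "1 \<le> (A * T) * (E / \<epsilon>)"
      using ATq mult_left_mono [OF qE', of "A * T"] AT by linarith
    moreover have "1 \<le> (E / \<epsilon>) ^ m" using E1 by (rule one_le_power)
    moreover have "1 \<le> real dy" using dy by simp
    ultimately have "1 * (1 * 1) \<le> real dy * (((A * T) * (E / \<epsilon>)) * (E / \<epsilon>) ^ m)"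
      by (intro mult_mono) auto
    then show ?thesis by (simp add: mult_ac)
  qed
  have "real (num_weights \<N>) \<le> real (K * (dy * (n + 1) ^ m * (m\<^sup>2 + 28 * m + 14)) + m)"
    using \<N>(2) by (simp only: of_nat_le_iff)
  also have "\<dots> = real K * (real dy * real (n + 1) ^ m * ?c) + real m" by simp
  also have "\<dots> \<le> (5 * (A * T) * (E / \<epsilon>)) * (real dy * (6 * (R + 1) * (E / \<epsilon>)) ^ m * ?c) + real m * ?W"
  proof (rule add_mono)
    show "real K * (real dy * real (n + 1) ^ m * ?c)
        \<le> (5 * (A * T) * (E / \<epsilon>)) * (real dy * (6 * (R + 1) * (E / \<epsilon>)) ^ m * ?c)"
      using Kle nle AT E0 by (intro mult_mono power_mono) auto
    show "real m \<le> real m * ?W" using mult_left_mono [OF W1, of "real m"] by simp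
  qed
  also have "\<dots> = (5 * (6 * (R + 1)) ^ m * ?c + real m) * ?W"
  proof -
    have "(5 * P * F) * (D * (G * F) ^ m * c) + M * (D * P * F ^ (m + 1)) = (5 * G ^ m * c + M) * (D * P * F ^ (m + 1))"
      for P F D G c M :: real
      by (simp add: power_mult_distrib algebra_simps)
    then show ?thesis .
  qed
  finally show ?thesis using \<N> err False
    by (intro exI [of _ \<N>]) (auto intro: order_trans)
qed

lemma weight_const_ge: "real m \<le> weight_const m R" "1 \<le> weight_const m R" "weight_const m R \<le> rate_const m R"
proof -
  have "0 \<le> 5 * (6 * (R + 1)) ^ m * (real m ^ 2 + 28 * real m + 14)"
    using R by (intro mult_nonneg_nonneg) auto
  then show "real m \<le> weight_const m R" by (simp add: weight_const_def)
  then show "1 \<le> weight_const m R" using m by linarith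
  show "weight_const m R \<le> rate_const m R" using R by (simp add: rate_const_def)
qed

lemma stability_bound:
  "(3 + R) * exp (A * T + real m * (\<Lambda> * \<omega>\<^sub>1) * T)
    \<le> rate_const m R * exp ((A + 1 / T + real m * (1 + A\<^sub>o) * \<Lambda> * \<omega>\<^sub>1) * T)"
proof (rule mult_mono)
  show "3 + R \<le> rate_const m R" using weight_const_ge by (simp add: rate_const_def)
  have "0 \<le> (real m * (\<Lambda> * \<omega>\<^sub>1) * T) * A\<^sub>o"
    using \<Lambda> \<omega>\<^sub>1_pos T Ao_pos by simp
  moreover have "(A + 1 / T + real m * (1 + A\<^sub>o) * \<Lambda> * \<omega>\<^sub>1) * T
      = A * T + real m * (\<Lambda> * \<omega>\<^sub>1) * T + (1 + (real m * (\<Lambda> * \<omega>\<^sub>1) * T) * A\<^sub>o)"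
    using T by (simp add: field_simps)
  ultimately show "exp (A * T + real m * (\<Lambda> * \<omega>\<^sub>1) * T)
      \<le> exp ((A + 1 / T + real m * (1 + A\<^sub>o) * \<Lambda> * \<omega>\<^sub>1) * T)"
    by simp
qed (use weight_const_ge R in auto)

text \<open>From \<open>\<epsilon> < A * T\<close> and \<open>2 * u \<le> exp u\<close>.\<close>
lemma log_factor_ge_1:
  assumes "0 < \<epsilon>" "\<epsilon> < A * T"
  shows "1 \<le> log 2 (exp ((A + \<Lambda> * \<omega>\<^sub>1) * T) / \<epsilon>)"
proof -
  have "0 \<le> (A * T - 1)\<^sup>2" by simp
  then have "2 * (A * T) \<le> 1 + A * T + (A * T)\<^sup>2 / 2"
    by (simp add: power2_eq_square algebra_simps)
  also have "\<dots> \<le> exp (A * T)" using A T by (intro exp_lower_Taylor_quadratic) auto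
  also have "\<dots> \<le> exp ((A + \<Lambda> * \<omega>\<^sub>1) * T)" using \<Lambda> \<omega>\<^sub>1_pos T by (simp add: distrib_right)
  finally have "2 * \<epsilon> \<le> exp ((A + \<Lambda> * \<omega>\<^sub>1) * T)" using assms by linarith
  then have "2 \<le> exp ((A + \<Lambda> * \<omega>\<^sub>1) * T) / \<epsilon>" using assms by (simp add: le_divide_eq)
  then show ?thesis using assms by (simp add: le_log_iff)
qed

text \<open>\<open>\<epsilon>\<close> solves the equation that equates the bound on the weights with \<open>N\<close>.  The factors of \<open>gamma_rate\<close> which
  do not cancel are powers of \<open>m\<close> and of the truncated logarithm with negative exponents, hence at most 1.\<close>
lemma rate_bound:
  assumes N: "0 < (N::nat)"
  defines "E \<equiv> exp ((A + \<Lambda> * \<omega>\<^sub>1) * T)"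
  defines "\<epsilon> \<equiv> E * (weight_const m R * (real dy * (A * T)) / real N) powr (1 / (real m + 1))"
  shows "0 < \<epsilon>" "weight_const m R * (real dy * (A * T) * (E / \<epsilon>) ^ (m + 1)) = real N"
    and "\<epsilon> \<le> rate_const m R * E / gamma_rate m A T dy (real N)"
proof -
  let ?e = "1 / (real m + 1)"
  define W where "W = weight_const m R * (real dy * (A * T)) / real N"
  have AT: "0 < A * T" using A T by simp
  have W: "0 < W" using weight_const_ge dy AT N by (simp add: W_def)
  have \<epsilon>: "\<epsilon> = E * W powr ?e" by (simp add: \<epsilon>_def W_def)
  have E: "0 < E" by (simp add: E_def)
  show "0 < \<epsilon>" using W E by (simp add: \<epsilon>)
  have "(W powr ?e) ^ (m + 1) = W"
    using W by (simp add: powr_realpow [symmetric] powr_powr add.commute del: power_Suc)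
  then have "(E / \<epsilon>) ^ (m + 1) = 1 / W" using E by (simp add: \<epsilon> power_divide)
  then show "weight_const m R * (real dy * (A * T) * (E / \<epsilon>) ^ (m + 1)) = real N"
    using weight_const_ge dy A T N by (simp add: W_def)
  define M where "M = max 1 \<bar>log 2 (real N / real dy)\<bar>"
  define g where "g = gamma_rate m A T dy (real N)"
  have g: "g = (A * T * real m ^ 2) powr (- ?e) * (real N / real dy) powr ?e * M powr (- (2 * ?e))"
    by (simp add: g_def gamma_rate_def M_def)
  have m2: "1 \<le> real m ^ 2" using m by simp
  have M: "1 \<le> M" by (simp add: M_def)
  have gpos: "0 < g"
    using A T m M N dy unfolding g by (intro mult_pos_pos powr_gt_zero [THEN iffD2]) auto
  have W_powr: "W powr ?e = weight_const m R powr ?e * (A * T) powr ?e * (real dy / real N) powr ?e"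
    using weight_const_ge AT by (simp add: W_def powr_mult [symmetric] mult_ac)
  have cancel_N: "(real dy / real N) powr ?e * (real N / real dy) powr ?e = 1"
    using N dy by (simp add: powr_mult [symmetric])
  have cancel_AT: "(A * T) powr ?e * (A * T * real m ^ 2) powr (- ?e) = (real m ^ 2) powr (- ?e)"
    using AT m2 A T by (simp add: powr_mult powr_minus field_simps)
  have "W powr ?e * g = weight_const m R powr ?e * ((A * T) powr ?e * (A * T * real m ^ 2) powr (- ?e))
      * ((real dy / real N) powr ?e * (real N / real dy) powr ?e) * M powr (- (2 * ?e))"
    unfolding W_powr g by (simp only: mult_ac)
  also have "\<dots> = weight_const m R powr ?e * (real m ^ 2) powr (- ?e) * M powr (- (2 * ?e))"
    unfolding cancel_N cancel_AT by simp
  also have "\<dots> \<le> weight_const m R * 1 * 1"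
  proof (intro mult_mono)
    show "weight_const m R powr ?e \<le> weight_const m R"
      using powr_mono [of ?e 1 "weight_const m R"] weight_const_ge by simp
    show "(real m ^ 2) powr (- ?e) \<le> 1" using powr_mono [of "- ?e" 0 "real m ^ 2"] m2 m by simp
    show "M powr (- (2 * ?e)) \<le> 1" using powr_mono [of "- (2 * ?e)" 0 M] M by simp
  qed (use weight_const_ge in auto)
  also have "\<dots> \<le> rate_const m R" using weight_const_ge by simp
  finally have "E * (W powr ?e * g) \<le> E * rate_const m R" using E by (intro mult_left_mono) auto
  then show "\<epsilon> \<le> rate_const m R * E / gamma_rate m A T dy (real N)"
    using gpos by (simp add: \<epsilon> le_divide_eq g_def [symmetric] mult_ac)
qed

lemma stable_network:
  assumes "0 < \<epsilon>"
  obtains \<N> where "dnn_type (m + dy) m \<N>"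
    "real (num_weights \<N>) \<le> (if A * T \<le> \<epsilon> then real m
       else weight_const m R * (real dy * (A * T) * (exp ((A + \<Lambda> * \<omega>\<^sub>1) * T) / \<epsilon>) ^ (m + 1)))"
    "linf_norm ({0..<T} \<times> X \<times> cube dy 1) (\<lambda>(t, x, y). z t x y - dnn_eval \<N> t (x @\<^sub>v y)) \<le> ennreal \<epsilon>"
    "Lip1_in_time T (join_sets (carrier_vec m) (cube dy 1)) (dnn_eval \<N>)"
    "\<And>N t. num_weights \<N> \<le> N \<Longrightarrow> comp_norm (join_sets (cube m R) (cube dy 1)) (m + dy) m N m (dnn_eval \<N> t)
        \<le> ennreal (rate_const m R * exp ((A + 1 / T + real m * (1 + A\<^sub>o) * \<Lambda> * \<omega>\<^sub>1) * T))"
proof -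
  obtain \<N> where \<N>: "dnn_type (m + dy) m \<N>"
    "real (num_weights \<N>) \<le> (if A * T \<le> \<epsilon> then real m
       else weight_const m R * (real dy * (A * T) * (exp ((A + \<Lambda> * \<omega>\<^sub>1) * T) / \<epsilon>) ^ (m + 1)))"
    "linf_norm ({0..<T} \<times> X \<times> cube dy 1) (\<lambda>(t, x, y). z t x y - dnn_eval \<N> t (x @\<^sub>v y)) \<le> ennreal \<epsilon>"
    "Lip1_in_time T (join_sets (carrier_vec m) (cube dy 1)) (dnn_eval \<N>)"
    "\<And>N t. num_weights \<N> \<le> N \<Longrightarrow> comp_norm (join_sets (cube m R) (cube dy 1)) (m + dy) m N m (dnn_eval \<N> t)
        \<le> ennreal ((3 + R) * exp (A * T + real m * (\<Lambda> * \<omega>\<^sub>1) * T))"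
    using network_for_accuracy [OF assms] unfolding weight_const_def by blast
  show thesis
    by (rule that [OF \<N>(1-4) order_trans [OF \<N>(5) ennreal_leI [OF stability_bound]]])
qed

lemma network_of_accuracy:
  assumes \<epsilon>: "0 < \<epsilon>"
  shows "\<exists>\<N>. dnn_type (m + dy) m \<N> \<and>
    linf_norm ({0..<T} \<times> X \<times> cube dy 1) (\<lambda>(t, x, y). z t x y - dnn_eval \<N> t (x @\<^sub>v y)) \<le> ennreal \<epsilon> \<and>
    real (num_weights \<N>) \<le>
      rate_const m R * max 1 (real dy * real m ^ 2 * A * T * (exp ((A + \<Lambda> * \<omega>\<^sub>1) * T) / \<epsilon>) ^ (m + 1)
                 * \<bar>log 2 (exp ((A + \<Lambda> * \<omega>\<^sub>1) * T) / \<epsilon>)\<bar> ^ 2) \<and>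
    Lip1_in_time T (join_sets (carrier_vec m) (cube dy 1)) (dnn_eval \<N>) \<and>
    (\<exists>Lhat. (\<forall>t\<in>{0..T}.
         comp_norm (join_sets (cube m R) (cube dy 1)) (m + dy) m (num_weights \<N>) m (dnn_eval \<N> t)
           \<le> ennreal (rate_const m R * exp (Lhat * T))) \<and>
       (\<epsilon> \<le> 1 \<longrightarrow> Lhat \<le> A + 1 / T + real m * (1 + A\<^sub>o) * \<Lambda> * \<omega>\<^sub>1))"
proof -
  let ?E = "exp ((A + \<Lambda> * \<omega>\<^sub>1) * T)"
  obtain \<N> where \<N>: "dnn_type (m + dy) m \<N>"
    "real (num_weights \<N>) \<le> (if A * T \<le> \<epsilon> then real m else weight_const m R * (real dy * (A * T) * (?E / \<epsilon>) ^ (m + 1)))"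
    "linf_norm ({0..<T} \<times> X \<times> cube dy 1) (\<lambda>(t, x, y). z t x y - dnn_eval \<N> t (x @\<^sub>v y)) \<le> ennreal \<epsilon>"
    "Lip1_in_time T (join_sets (carrier_vec m) (cube dy 1)) (dnn_eval \<N>)"
    "\<And>N t. num_weights \<N> \<le> N \<Longrightarrow> comp_norm (join_sets (cube m R) (cube dy 1)) (m + dy) m N m (dnn_eval \<N> t)
        \<le> ennreal (rate_const m R * exp ((A + 1 / T + real m * (1 + A\<^sub>o) * \<Lambda> * \<omega>\<^sub>1) * T))"
    by (rule stable_network [OF \<epsilon>]) blast
  let ?B = "real dy * real m ^ 2 * A * T * (?E / \<epsilon>) ^ (m + 1) * \<bar>log 2 (?E / \<epsilon>)\<bar> ^ 2"
  have "real (num_weights \<N>) \<le> weight_const m R * max 1 ?B"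
  proof (cases "A * T \<le> \<epsilon>")
    case True
    have "weight_const m R * 1 \<le> weight_const m R * max 1 ?B"
      using weight_const_ge by (intro mult_left_mono) auto
    then show ?thesis using \<N>(2) True weight_const_ge(1) by simp
  next
    case False
    let ?W = "real dy * (A * T) * (?E / \<epsilon>) ^ (m + 1)"
    have "1 \<le> \<bar>log 2 (?E / \<epsilon>)\<bar>" using log_factor_ge_1 [OF \<epsilon>] False by linarith
    then have "1 * 1 \<le> real m ^ 2 * \<bar>log 2 (?E / \<epsilon>)\<bar> ^ 2"
      using m by (intro mult_mono one_le_power) auto
    then have "?W * 1 \<le> ?W * (real m ^ 2 * \<bar>log 2 (?E / \<epsilon>)\<bar> ^ 2)"
      using A T \<epsilon> by (intro mult_left_mono) auto
    also have "\<dots> = ?B" by (simp add: mult_ac)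
    finally have "?W \<le> max 1 ?B" by simp
    then have "weight_const m R * ?W \<le> weight_const m R * max 1 ?B"
      using weight_const_ge by (intro mult_left_mono) auto
    then show ?thesis using \<N>(2) False by simp
  qed
  also have "\<dots> \<le> rate_const m R * max 1 ?B" using weight_const_ge by (intro mult_right_mono) auto
  finally show ?thesis using \<N> by (intro exI [of _ \<N>]) blast
qed

lemma network_of_size:
  assumes N: "m \<le> N"
  shows "\<exists>\<N>. dnn_type (m + dy) m \<N> \<and>
    num_weights \<N> \<le> N \<and>
    linf_norm ({0..<T} \<times> X \<times> cube dy 1) (\<lambda>(t, x, y). z t x y - dnn_eval \<N> t (x @\<^sub>v y))
      \<le> ennreal (rate_const m R * exp ((A + \<Lambda> * \<omega>\<^sub>1) * T) / gamma_rate m A T dy (real N)) \<and>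
    Lip1_in_time T (join_sets (carrier_vec m) (cube dy 1)) (dnn_eval \<N>) \<and>
    (\<exists>Lhat. (\<forall>t\<in>{0..T}.
         comp_norm (join_sets (cube m R) (cube dy 1)) (m + dy) m N m (dnn_eval \<N> t)
           \<le> ennreal (rate_const m R * exp (Lhat * T))) \<and>
       (linf_norm ({0..<T} \<times> X \<times> cube dy 1) (\<lambda>(t, x, y). z t x y - dnn_eval \<N> t (x @\<^sub>v y)) \<le> 1 \<longrightarrow>
          Lhat \<le> A + 1 / T + real m * (1 + A\<^sub>o) * \<Lambda> * \<omega>\<^sub>1))"
proof -
  let ?E = "exp ((A + \<Lambda> * \<omega>\<^sub>1) * T)"
  define \<epsilon> where "\<epsilon> = ?E * (weight_const m R * (real dy * (A * T)) / real N) powr (1 / (real m + 1))"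
  have N0: "0 < N" using N m by linarith
  note \<epsilon> = rate_bound [OF N0, folded \<epsilon>_def]
  obtain \<N> where \<N>: "dnn_type (m + dy) m \<N>"
    "real (num_weights \<N>) \<le> (if A * T \<le> \<epsilon> then real m else weight_const m R * (real dy * (A * T) * (?E / \<epsilon>) ^ (m + 1)))"
    "linf_norm ({0..<T} \<times> X \<times> cube dy 1) (\<lambda>(t, x, y). z t x y - dnn_eval \<N> t (x @\<^sub>v y)) \<le> ennreal \<epsilon>"
    "Lip1_in_time T (join_sets (carrier_vec m) (cube dy 1)) (dnn_eval \<N>)"
    "\<And>N t. num_weights \<N> \<le> N \<Longrightarrow> comp_norm (join_sets (cube m R) (cube dy 1)) (m + dy) m N m (dnn_eval \<N> t)
        \<le> ennreal (rate_const m R * exp ((A + 1 / T + real m * (1 + A\<^sub>o) * \<Lambda> * \<omega>\<^sub>1) * T))"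
    by (rule stable_network [OF \<epsilon>(1)]) blast
  have size: "num_weights \<N> \<le> N" using \<N>(2) N \<epsilon>(2) by (simp split: if_splits)
  show ?thesis
    using \<N>(1,4) size \<N>(5) [OF size] order_trans [OF \<N>(3) ennreal_leI [OF \<epsilon>(3)]]
    by (intro exI [of _ \<N>]) blast
qed

end

theorem theorem4p6:
  fixes m :: nat
  assumes "m \<in> {1, 2, 3}"
  shows "\<exists>c3>0. \<forall>R>0. \<exists>C>0.
    \<forall>(dy::nat) (T::real) (\<omega> :: nat \<Rightarrow> real) (a\<^sub>o :: nat \<Rightarrow> real \<Rightarrow> real vec \<Rightarrow> real vec)
     (A\<^sub>o::real) (\<Lambda>::real) (\<omega>\<^sub>1::real) (A::real) (L::real)
     (a :: real \<Rightarrow> real vec \<Rightarrow> real vec) (z :: real \<Rightarrow> real vec \<Rightarrow> real vec \<Rightarrow> real vec)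
     (X :: real vec set) (Y :: real vec set) (\<Omega> :: (real \<times> real vec \<times> real vec) set).
      0 < T \<longrightarrow>
      Y = cube dy 1 \<longrightarrow>
      (\<forall>j<dy. 0 \<le> \<omega> j) \<longrightarrow>
      (\<forall>j<dy. \<forall>t\<in>{0..T}. \<forall>x\<in>carrier_vec m. a\<^sub>o j t x \<in> carrier_vec m) \<longrightarrow>
      (\<forall>j<dy. linf_norm ({0..T} \<times> carrier_vec m) (\<lambda>(t, x). a\<^sub>o j t x) \<le> ennreal A\<^sub>o) \<longrightarrow>
      0 \<le> \<Lambda> \<longrightarrow>
      ennreal \<Lambda> = (SUP j\<in>{..<dy}. SUP t\<in>{0..T}. lip_seminorm (carrier_vec m) (a\<^sub>o j t)) \<longrightarrow>
      \<omega>\<^sub>1 = (\<Sum>j<dy. \<omega> j) \<longrightarrow>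
      A = \<omega>\<^sub>1 * A\<^sub>o \<longrightarrow>
      L = A + \<Lambda> * \<omega>\<^sub>1 \<longrightarrow>
      1 \<le> A \<longrightarrow>
      a = affine_field m dy (\<lambda>j t x. \<omega> j \<cdot>\<^sub>v a\<^sub>o j t x) \<longrightarrow>
      continuous_into_Lip1 T (join_sets (carrier_vec m) Y) a \<longrightarrow>
      characteristics m T Y a z \<longrightarrow>
      X \<subseteq> carrier_vec m \<longrightarrow>
      (X \<subseteq> cube m R \<or>
        (\<forall>t\<in>{0..T}. \<forall>x\<in>carrier_vec m - cube m R. \<forall>y\<in>Y. a t (x @\<^sub>v y) = 0\<^sub>v m)) \<longrightarrow>
      \<Omega> = {0..<T} \<times> X \<times> Y \<longrightarrow>
      (\<forall>\<epsilon>>0. \<exists>\<N>. dnn_type (m + dy) m \<N> \<and>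
         linf_norm \<Omega> (\<lambda>(t, x, y). z t x y - dnn_eval \<N> t (x @\<^sub>v y)) \<le> ennreal \<epsilon> \<and>
         real (num_weights \<N>) \<le>
           C * max 1 (real dy * real m ^ 2 * A * T * (exp (L * T) / \<epsilon>) ^ (m + 1)
                      * \<bar>log 2 (exp (L * T) / \<epsilon>)\<bar> ^ 2) \<and>
         Lip1_in_time T (join_sets (carrier_vec m) Y) (dnn_eval \<N>) \<and>
         (\<exists>Lhat. (\<forall>t\<in>{0..T}.
              comp_norm (join_sets (cube m R) Y) (m + dy) m (num_weights \<N>) m (dnn_eval \<N> t)
                \<le> ennreal (C * exp (Lhat * T))) \<and>
            (\<epsilon> \<le> 1 \<longrightarrow> Lhat \<le> A + 1 / T + c3 * (1 + A\<^sub>o) * \<Lambda> * \<omega>\<^sub>1))) \<and>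
      (\<forall>N\<ge>m. \<exists>\<N>. dnn_type (m + dy) m \<N> \<and>
         num_weights \<N> \<le> N \<and>
         linf_norm \<Omega> (\<lambda>(t, x, y). z t x y - dnn_eval \<N> t (x @\<^sub>v y))
           \<le> ennreal (C * exp (L * T) / gamma_rate m A T dy (real N)) \<and>
         Lip1_in_time T (join_sets (carrier_vec m) Y) (dnn_eval \<N>) \<and>
         (\<exists>Lhat. (\<forall>t\<in>{0..T}.
              comp_norm (join_sets (cube m R) Y) (m + dy) m N m (dnn_eval \<N> t)
                \<le> ennreal (C * exp (Lhat * T))) \<and>
            (linf_norm \<Omega> (\<lambda>(t, x, y). z t x y - dnn_eval \<N> t (x @\<^sub>v y)) \<le> 1 \<longrightarrow>
               Lhat \<le> A + 1 / T + c3 * (1 + A\<^sub>o) * \<Lambda> * \<omega>\<^sub>1)))"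
proof -
  have m: "0 < m" using assms by auto
  show ?thesis
    apply (rule exI [of _ "real m"], rule conjI, use m in simp)
    apply (intro allI impI)
    subgoal premises R for R
      apply (rule exI [of _ "rate_const m R"], rule conjI)
      subgoal
        using R unfolding rate_const_def weight_const_def
        by (intro add_pos_pos add_nonneg_pos add_nonneg_nonneg mult_nonneg_nonneg zero_le_power) auto
      apply (intro allI impI)
      subgoal premises prems for dy T \<omega> a\<^sub>o A\<^sub>o \<Lambda> \<omega>\<^sub>1 A L a z X Y \<Omega>
      proof -
        have lip: "lip_seminorm (carrier_vec m) (a\<^sub>o j t) \<le> ennreal \<Lambda>" if "j < dy" "t \<in> {0..T}" for j t
          unfolding prems(7) using that by (intro SUP_upper2 [of j] SUP_upper2 [of t]) auto
        interpret affine_transport m dy T R A\<^sub>o \<Lambda> \<omega>\<^sub>1 A \<omega> a\<^sub>o a z X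
          using m R prems lip by unfold_locales (auto)
        show ?thesis
          \<comment> \<open>the equations for \<open>Y\<close>, \<open>L\<close> and \<open>\<Omega>\<close>\<close>
          unfolding prems(2,10,17)
          by (intro conjI allI impI network_of_accuracy network_of_size)
      qed
      done
    done
qed

end
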